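(* Let $\mathbb{E}(\psi_i(X_i))<\infty$ for $1\le i\le n$, let $\mathbf{X}^{(1)},\dots,\mathbf{X}^{(N)}$ be independent copies of $\mathbf{X}=(X_1,\dots,X_n)$ (whose components $X_1,\dots,X_n$ may be dependent), and let $S\subset\{1,\dots,n\}$ with $|S|\ge 2$. Let $\|\mathbb{G}\|_{\rho_S}^2$ be the distributional limit of the test statistic $N\cdot{}^N\!M_{\rho_S}^2$ under the hypothesis of independence (see context). Put $B_i:=(\psi_i(X_i^{(l)}-X_i^{(k)}))_{l,k=1,\dots,N}$, $|A|:=\sum_{l,k=1}^N|a_{l,k}|$ for a matrix $A$, let $\circ$ be the Hadamard (entrywise) product, and define $${}^N\!\mu_i^{(1)}:=\tfrac1{N^2}|B_i|,\qquad {}^N\!\mu_i^{(2)}:=\tfrac1{N^2}|B_i\circ B_i|-\tfrac2{N^3}|B_i^2|+\tfrac1{N^4}|B_i|^2,$$ $${}^N\!\mu_i^{(3)}:=-\tfrac1{N^3}|B_i^2\circ B_i|+\tfrac3{N^4}|B_i^3|-\tfrac3{N^3}|B_i^2|\tfrac1{N^2}|B_i|+\tfrac1{N^6}|B_i|^3,$$ $${}^N\!\mu_i^{(4)}:=\tfrac1{N^4}|B_i^3\circ B_i|-\tfrac4{N^5}|B_i^4|+\tfrac4{N^4}|B_i^3|\tfrac1{N^2}|B_i|+2\Bigl[\tfrac1{N^3}|B_i^2|\Bigr]^2-\tfrac4{N^3}|B_i^2|\tfrac1{N^4}|B_i|^2+\tfrac1{N^8}|B_i|^4,$$ and ${}^N\!\mu_S^{(k)}:=\prod_{i\in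 S}{}^N\!\mu_i^{(k)}$. Then, almost surely as $N\to\infty$, $${}^N\!\mu_S^{(1)}\to\mathbb{E}(\|\mathbb{G}\|_{\rho_S}^2),\qquad 2\cdot{}^N\!\mu_S^{(2)}\to\mathbb{V}(\|\mathbb{G}\|_{\rho_S}^2),$$ $$8\cdot{}^N\!\mu_S^{(3)}\to\mathbb{E}\bigl[(\|\mathbb{G}\|_{\rho_S}^2-\mathbb{E}(\|\mathbb{G}\|_{\rho_S}^2))^3\bigr],$$ $$48\cdot{}^N\!\mu_S^{(4)}+12\cdot\bigl({}^N\!\mu_S^{(2)}\bigr)^2\to\mathbb{E}\bigl[(\|\mathbb{G}\|_{\rho_S}^2-\mathbb{E}(\|\mathbb{G}\|_{\rho_S}^2))^4\bigr].$$
   Context: Each $X_i$ takes values in $\mathbb{R}^{d_i}$ and has characteristic function $f_i(t_i)=\mathbb{E}(e^{\mathrm{i}X_i\cdot t_i})$. For each $i$, $\rho_i$ is a symmetric measure with full support on $\mathbb{R}^{d_i}$ with $\int 1\wedge|t_i|^2\,\rho_i(dt_i)<\infty$; $\psi_i(x_i)=\int_{\mathbb{R}^{d_i}}1-\cos(x_i\cdot t_i)\,\rho_i(dt_i)$; $\rho_S=\bigotimes_{i\in S}\rho_i$; $t_S=(t_i)_{i\in S}$; $\|g\|_{\rho_S}^2=\int|g(t_S)|^2\,\rho_S(dt_S)$. $\mathbb{V}$ denotes variance. Powers $B_i^k$ are matrix powers. Sample distance multivariance is ${}^N\!M_{\rho_S}(\mathbf{x}^{(1)},\dots,\mathbf{x}^{(N)})=\|{}^N\!Z_S\|_{\rho_S}$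 with ${}^N\!Z_S(t_S)=\frac1N\sum_{l=1}^N\prod_{i\in S}\bigl(e^{\mathrm{i}x_i^{(l)}\cdot t_i}-\frac1N\sum_{k=1}^Ne^{\mathrm{i}x_i^{(k)}\cdot t_i}\bigr)$. The limit of $N\cdot{}^N\!M_{\rho_S}^2$ under the hypothesis of independence (i.e. for samples of a vector with independent components having the same marginal laws as $X_1,\dots,X_n$) has the law of $\|\mathbb{G}\|_{\rho_S}^2=\|\mathbb{G}_S\|_{\rho_S}^2$, where $\mathbb{G}_S$ is the (jointly measurable) centered complex Gaussian random field indexed by $t_S$ with $\mathbb{E}(\mathbb{G}_S(t_S)\overline{\mathbb{G}_S(t_S')})=\prod_{i\in S}(f_i(t_i-t_i')-f_i(t_i)f_i(-t_i'))$ and $\mathbb{E}(\mathbb{G}_S(t_S)\mathbb{G}_S(t_S'))=\prod_{i\in S}(f_i(t_i+t_i')-f_i(t_i)f_i(t_i'))$; $\|\mathbb{G}\|_{\rho_S}^2$ is understood as a random variable with this law. *)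

theory Defs
  imports "HOL-Probability.Probability" "HOL-Library.Function_Algebras" "Jordan_Normal_Form.Matrix"
begin

text \<open>
  The dimensions \<open>d i\<close> vary with \<open>i\<close>, so \<open>\<real>\<^sup>d\<close> is the carrier of \<^const>\<open>Euclidean_space\<close>: sequences
  \<open>nat \<Rightarrow> real\<close> that vanish from index \<open>d\<close> on. This set is closed under the pointwise operations
  \<open>x - y\<close> and \<open>- x\<close> of the function type, and the trace on it of the Borel sets of the product
  topology is the usual Borel \<open>\<sigma>\<close>-algebra of \<open>\<real>\<^sup>d\<close>.
\<close>

definition euclid_borel :: "nat \<Rightarrow> (nat \<Rightarrow> real) measure" where
  "euclid_borel d = restrict_space borel (topspace (Euclidean_space d))"

definition dotp :: "nat \<Rightarrow> (nat \<Rightarrow> real) \<Rightarrow> (nat \<Rightarrow> real) \<Rightarrow> real" where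
  "dotp d x t = (\<Sum>j<d. x j * t j)"

text \<open>
  \<open>\<sigma>\<close>-finiteness is what makes the product measure \<open>\<Otimes>\<rho>\<^sub>i\<close> well defined. The integrability condition
  already gives it off the origin, so it only excludes an infinite atom at \<open>0\<close>.
\<close>

definition admissible_measure :: "nat \<Rightarrow> (nat \<Rightarrow> real) measure \<Rightarrow> bool" where
  "admissible_measure d \<rho> \<longleftrightarrow>
     sets \<rho> = sets (euclid_borel d) \<and>
     sigma_finite_measure \<rho> \<and>
     (\<forall>A\<in>sets \<rho>. emeasure \<rho> (uminus ` A) = emeasure \<rho> A) \<and>
     (\<forall>U. openin (Euclidean_space d) U \<and> U \<noteq> {} \<longrightarrow> emeasure \<rho> U > 0) \<and>
     (\<integral>\<^sup>+ t. ennreal (min 1 (dotp d t t)) \<partial>\<rho>) < \<infinity>"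

definition psi :: "nat \<Rightarrow> (nat \<Rightarrow> real) measure \<Rightarrow> (nat \<Rightarrow> real) \<Rightarrow> real" where
  "psi d \<rho> x = (LINT t|\<rho>. 1 - cos (dotp d x t))"

definition char_fun :: "'w measure \<Rightarrow> nat \<Rightarrow> ('w \<Rightarrow> nat \<Rightarrow> real) \<Rightarrow> (nat \<Rightarrow> real) \<Rightarrow> complex" where
  "char_fun M d X t = (LINT \<omega>|M. iexp (dotp d (X \<omega>) t))"

text \<open>
  Constants count as (degenerate) Gaussian variables; this is needed since \<open>\<GG>\<close> may have
  degenerate finite-dimensional distributions.
\<close>

definition gaussian_rv :: "'v measure \<Rightarrow> ('v \<Rightarrow> real) \<Rightarrow> bool" where
  "gaussian_rv Q Y \<longleftrightarrow> Y \<in> borel_measurable Q \<and>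
     ((\<exists>m s. 0 < s \<and> distributed Q lborel Y (normal_density m s)) \<or>
      (\<exists>c. AE \<omega> in Q. Y \<omega> = c))"

definition complex_gaussian_field :: "'v measure \<Rightarrow> 't set \<Rightarrow> ('t \<Rightarrow> 'v \<Rightarrow> complex) \<Rightarrow> bool" where
  "complex_gaussian_field Q T G \<longleftrightarrow>
     (\<forall>F a b. finite F \<and> F \<subseteq> T \<longrightarrow>
        gaussian_rv Q (\<lambda>\<omega>. \<Sum>t\<in>F. a t * Re (G t \<omega>) + b t * Im (G t \<omega>)))"

text \<open>
  The jointly measurable centered complex Gaussian field whose squared \<open>L\<^sup>2(\<rho>\<^sub>S)\<close>-norm has the limit
  law of the test statistic under independence; \<open>f i\<close> is the characteristic function of \<open>X\<^sub>i\<close>.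
\<close>

definition limit_field ::
  "'v measure \<Rightarrow> nat set \<Rightarrow> (nat \<Rightarrow> (nat \<Rightarrow> real) measure) \<Rightarrow> (nat \<Rightarrow> (nat \<Rightarrow> real) \<Rightarrow> complex) \<Rightarrow>
   ((nat \<Rightarrow> nat \<Rightarrow> real) \<Rightarrow> 'v \<Rightarrow> complex) \<Rightarrow> bool" where
  "limit_field Q S \<rho> f G \<longleftrightarrow>
     (\<lambda>(t, \<omega>). G t \<omega>) \<in> borel_measurable (Pi\<^sub>M S \<rho> \<Otimes>\<^sub>M Q) \<and>
     complex_gaussian_field Q (space (Pi\<^sub>M S \<rho>)) G \<and>
     (\<forall>t\<in>space (Pi\<^sub>M S \<rho>). (LINT \<omega>|Q. G t \<omega>) = 0) \<and>
     (\<forall>t\<in>space (Pi\<^sub>M S \<rho>). \<forall>t'\<in>space (Pi\<^sub>M S \<rho>).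
        (LINT \<omega>|Q. G t \<omega> * cnj (G t' \<omega>)) =
          (\<Prod>i\<in>S. f i (t i - t' i) - f i (t i) * f i (- t' i)) \<and>
        (LINT \<omega>|Q. G t \<omega> * G t' \<omega>) =
          (\<Prod>i\<in>S. f i (t i + t' i) - f i (t i) * f i (t' i)))"

definition norm_sq :: "nat set \<Rightarrow> (nat \<Rightarrow> (nat \<Rightarrow> real) measure) \<Rightarrow>
    ((nat \<Rightarrow> nat \<Rightarrow> real) \<Rightarrow> complex) \<Rightarrow> real" where
  "norm_sq S \<rho> g = (LINT t|Pi\<^sub>M S \<rho>. (cmod (g t))\<^sup>2)"

definition hadamard :: "real mat \<Rightarrow> real mat \<Rightarrow> real mat"  (infixl "\<circ>\<^sub>H" 70) where
  "A \<circ>\<^sub>H B = Matrix.mat (dim_row A) (dim_col A) (\<lambda>(l, k). A $$ (l, k) * B $$ (l, k))"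

definition abs_sum :: "real mat \<Rightarrow> real" where
  "abs_sum A = (\<Sum>l<dim_row A. \<Sum>k<dim_col A. \<bar>A $$ (l, k)\<bar>)"

text \<open>Samples are numbered from \<open>0\<close>: \<open>x l\<close> is the \<open>(l+1)\<close>-st sample.\<close>

definition dist_mat :: "nat \<Rightarrow> nat \<Rightarrow> (nat \<Rightarrow> real) measure \<Rightarrow> (nat \<Rightarrow> nat \<Rightarrow> real) \<Rightarrow> real mat" where
  "dist_mat N d \<rho> x = Matrix.mat N N (\<lambda>(l, k). psi d \<rho> (x l - x k))"

definition mu1 :: "nat \<Rightarrow> real mat \<Rightarrow> real" where
  "mu1 N B = 1 / real N ^ 2 * abs_sum B"

definition mu2 :: "nat \<Rightarrow> real mat \<Rightarrow> real" where
  "mu2 N B = 1 / real N ^ 2 * abs_sum (B \<circ>\<^sub>H B)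
     - 2 / real N ^ 3 * abs_sum (B ^\<^sub>m 2)
     + 1 / real N ^ 4 * (abs_sum B) ^ 2"

definition mu3 :: "nat \<Rightarrow> real mat \<Rightarrow> real" where
  "mu3 N B = - (1 / real N ^ 3) * abs_sum ((B ^\<^sub>m 2) \<circ>\<^sub>H B)
     + 3 / real N ^ 4 * abs_sum (B ^\<^sub>m 3)
     - 3 / real N ^ 3 * abs_sum (B ^\<^sub>m 2) * (1 / real N ^ 2 * abs_sum B)
     + 1 / real N ^ 6 * (abs_sum B) ^ 3"

definition mu4 :: "nat \<Rightarrow> real mat \<Rightarrow> real" where
  "mu4 N B = 1 / real N ^ 4 * abs_sum ((B ^\<^sub>m 3) \<circ>\<^sub>H B)
     - 4 / real N ^ 5 * abs_sum (B ^\<^sub>m 4)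
     + 4 / real N ^ 4 * abs_sum (B ^\<^sub>m 3) * (1 / real N ^ 2 * abs_sum B)
     + 2 * (1 / real N ^ 3 * abs_sum (B ^\<^sub>m 2)) ^ 2
     - 4 / real N ^ 3 * abs_sum (B ^\<^sub>m 2) * (1 / real N ^ 4 * (abs_sum B) ^ 2)
     + 1 / real N ^ 8 * (abs_sum B) ^ 4"

text \<open>The product over \<open>S\<close> of \<open>m N B\<^sub>i\<close>, for \<open>m\<close> one of \<open>mu1, \<dots>, mu4\<close>; \<open>x l i\<close> is the
  \<open>i\<close>-th component of the sample with number \<open>l\<close>.\<close>

definition mu_prod :: "(nat \<Rightarrow> real mat \<Rightarrow> real) \<Rightarrow> nat set \<Rightarrow> (nat \<Rightarrow> nat) \<Rightarrow>
    (nat \<Rightarrow> (nat \<Rightarrow> real) measure) \<Rightarrow> (nat \<Rightarrow> nat \<Rightarrow> nat \<Rightarrow> real) \<Rightarrow> nat \<Rightarrow> real" where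
  "mu_prod m S d \<rho> x N = (\<Prod>i\<in>S. m N (dist_mat N (d i) (\<rho> i) (\<lambda>l. x l i)))"

end

theory Submission
  imports Defs "HOL-Real_Asymp.Real_Asymp"
begin

text \<open>
  With the empirical characteristic function \<open>f\<^sub>N\<close> of the \<open>i\<close>-th component put
  \<open>C\<^sub>N(s,t) = f\<^sub>N(s-t) - f\<^sub>N(s) f\<^sub>N(-t)\<close>. Since \<open>\<psi>\<^sub>i\<close> is the integral of \<open>1 - cos\<close>, the number
  \<open>\<mu>\<^sub>i\<^sup>(\<^sup>k\<^sup>)\<close> is the trace of the \<open>k\<close>-th power of the integral operator with kernel \<open>C\<^sub>N\<close>, written as
  the trace of the \<open>k\<close>-th power of the doubly centred distance matrix. By the strong law \<open>C\<^sub>N\<close>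
  converges almost surely, almost everywhere, to the kernel \<open>C\<close> made from the true characteristic
  function. Moreover \<open>|C\<^sub>N(s,t)|\<^sup>2 \<le> g\<^sub>N(s) g\<^sub>N(t)\<close> with \<open>g\<^sub>N = 2 (1 - Re f\<^sub>N)\<close>, and the integral
  of \<open>g\<^sub>N\<close> is twice the sample mean of \<open>\<psi>\<^sub>i(X\<^sub>i)\<close>, which converges by the strong law as well; only
  a first moment is needed. Dominated convergence with varying dominating functions then yields
  convergence of the traces.

  In the limit, \<open>G(-t)\<close> is almost surely the conjugate of \<open>G(t)\<close>, so \<open>\<parallel>G\<parallel>\<^sup>2\<close> is the squared norm of
  the real Gaussian field \<open>H = Re G + Im G\<close>, whose covariance operator is unitarily equivalent (by a
  Hartley transform) to that of the product kernel. Isserlis' formula gives its central moments as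
  \<open>2 tr C\<^sup>2\<close>, \<open>8 tr C\<^sup>3\<close> and \<open>48 tr C\<^sup>4 + 12 (tr C\<^sup>2)\<^sup>2\<close>, and traces of product kernels factor over \<open>S\<close>.
\<close>

section \<open>The strong law of large numbers\<close>

text \<open>No spectral decomposition is used. A kernel bounded by \<open>K * (w s * w t)\<close>
  with \<open>w\<close> square integrable has an integrable diagonal, so traces of powers are
  iterated integrals and Fubini does the algebra. Two obstacles shape the proof. The strong law
  gives, for each fixed argument, a null set that depends on the argument, whereas the traces need
  one null set valid for almost all arguments; Fubini exchanges the two. And the diagonal may itself
  be a null set, so convergence on it has to be secured separately. On the sample side
  \<open>C\<^sub>N\<close> has finite rank: it is a sum of products of the centred exponentials,
  whose Gram matrix is, up to sign, the doubly centred distance matrix. On the limit side the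
  passage from \<open>G\<close> to \<open>H\<close> leaves the norm unchanged because
  \<open>H\<^sup>2\<close> is the squared modulus of \<open>G\<close> plus
  \<open>2 Re G Im G\<close>, and the last product is odd under reflection. Each factor of an
  estimator involves a single component, and the limit kernel is the product of the marginal ones,
  so dependence between the components does no harm.\<close>

lemma geometric_sum_below_le:
  fixes \<alpha> y :: real
  assumes "1 < \<alpha>" "0 \<le> y"
  shows "(\<Sum>n<m. \<alpha> ^ n * indicator {\<alpha> ^ n<..} y) \<le> \<alpha> / (\<alpha> - 1) * y"
proof (induction m)
  case 0
  then show ?case using assms by simp
next
  case (Suc m)
  show ?case
  proof (cases "\<alpha> ^ m < y")
    case True
    have "(\<Sum>n<Suc m. \<alpha> ^ n * indicator {\<alpha> ^ n<..} y) \<le> (\<Sum>n<Suc m. \<alpha> ^ n)"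
      using assms by (intro sum_mono) (auto simp: indicator_def)
    also have "\<dots> = (\<alpha> ^ Suc m - 1) / (\<alpha> - 1)"
      using assms by (subst geometric_sum) auto
    also have "\<dots> \<le> \<alpha> * y / (\<alpha> - 1)"
    proof (intro divide_right_mono)
      have "\<alpha> * \<alpha> ^ m \<le> \<alpha> * y" using assms True by (intro mult_left_mono) auto
      then show "\<alpha> ^ Suc m - 1 \<le> \<alpha> * y" by simp
    qed (use assms in auto)
    finally show ?thesis by simp
  qed (use Suc in simp)
qed

text \<open>Integrated against the law of a variable, the previous sum controls the tail
  probabilities at the truncation levels and this one the normalised truncated second moments. Both
  come out as a multiple of the mean, which is how a first moment suffices for the strong
  law.\<close>

lemma geometric_sum_above_le:
  fixes \<alpha> y :: real
  assumes "1 < \<alpha>" "0 \<le> y"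
  shows "(\<Sum>n<m. y\<^sup>2 / \<alpha> ^ n * indicator {..\<alpha> ^ n} y) \<le> \<alpha> / (\<alpha> - 1) * y"
proof -
  define c where "c = \<alpha> / (\<alpha> - 1)"
  define s where "s m = (\<Sum>n<m. y\<^sup>2 / \<alpha> ^ n * indicator {..\<alpha> ^ n} y)" for m
  have c: "0 < c" "1 + c / \<alpha> = c"
    using assms by (auto simp: c_def field_simps)
  have small: "c * y\<^sup>2 / \<alpha> ^ n \<le> c * y" if "y \<le> \<alpha> ^ n" for n
  proof -
    have "y * y \<le> y * \<alpha> ^ n" by (rule mult_left_mono[OF that assms(2)])
    then have "c * (y * y) \<le> c * (y * \<alpha> ^ n)" by (rule mult_left_mono) (use c in auto)
    then show ?thesis using assms by (subst pos_divide_le_eq) (auto simp: power2_eq_square mult.assoc)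
  qed
  \<comment> \<open>The extra term \<open>c * y\<^sup>2 / \<alpha> ^ m\<close> is the exact value of
    the geometric tail from index \<open>m\<close> on, so the left side stays constant in
    \<open>m\<close> once \<open>y\<close> lies below the threshold.\<close>
  have "if y \<le> \<alpha> ^ m then s m + c * y\<^sup>2 / \<alpha> ^ m \<le> c * y else s m = 0"
  proof (induction m)
    case 0
    then show ?case using small[of 0] by (auto simp: s_def)
  next
    case (Suc m)
    show ?case
    proof (cases "y \<le> \<alpha> ^ m")
      case True
      have "y\<^sup>2 / \<alpha> ^ m + c * y\<^sup>2 / \<alpha> ^ Suc m = (1 + c / \<alpha>) * (y\<^sup>2 / \<alpha> ^ m)"
        using assms by (simp add: field_simps)
      also have "\<dots> = c * y\<^sup>2 / \<alpha> ^ m"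
        unfolding c by simp
      finally have "s (Suc m) + c * y\<^sup>2 / \<alpha> ^ Suc m = s m + c * y\<^sup>2 / \<alpha> ^ m"
        using True by (simp add: s_def)
      moreover have "y \<le> \<alpha> ^ Suc m"
        using True assms power_increasing[of m "Suc m" \<alpha>] by linarith
      ultimately show ?thesis using Suc True by simp
    next
      case False
      then have "s (Suc m) = 0" using Suc by (simp add: s_def)
      then show ?thesis using small[of "Suc m"] by auto
    qed
  qed
  moreover have "0 \<le> c * y\<^sup>2 / \<alpha> ^ m" using assms c by simp
  moreover have "0 \<le> c * y" using assms c by simp
  ultimately have "s m \<le> c * y" by (auto split: if_splits)
  then show ?thesis by (simp add: s_def c_def)
qed

text \<open>Partial sums of a nonnegative sequence increase, so the average at \<open>N\<close> in
  the block from \<open>\<alpha> ^ k\<close> to \<open>\<alpha> ^ Suc k\<close> differs from the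
  neighbouring block averages by at most a factor \<open>\<alpha>\<close>. Ratios
  \<open>1 + 1 / Suc p\<close> come arbitrarily close to 1 and are countable, as an almost sure
  statement requires.\<close>

lemma averages_tendsto_if_geometric_averages_tendsto:
  fixes y :: "nat \<Rightarrow> real"
  assumes nonneg: "\<And>j. 0 \<le> y j"
    and lim: "\<And>p. (\<lambda>n. (\<Sum>j<nat \<lfloor>(1 + 1 / Suc p) ^ n\<rfloor>. y j) / (1 + 1 / Suc p) ^ n) \<longlonglongrightarrow> m"
  shows "(\<lambda>N. (\<Sum>j<N. y j) / N) \<longlonglongrightarrow> m"
proof (rule LIMSEQ_I)
  fix e :: real assume "0 < e"
  have "(\<lambda>p. (1 + 1 / real (Suc p)) * m) \<longlonglongrightarrow> (1 + 0) * m"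
    by (intro tendsto_intros LIMSEQ_Suc lim_1_over_n)
  moreover have "(\<lambda>p. m / (1 + 1 / real (Suc p))) \<longlonglongrightarrow> m / (1 + 0)"
    by (intro tendsto_intros LIMSEQ_Suc lim_1_over_n) simp
  \<comment> \<open>The ratio is fixed so close to 1 that both \<open>\<alpha> * m\<close> and
    \<open>m / \<alpha>\<close> stay within \<open>e\<close> of \<open>m\<close>.\<close>
  ultimately have "\<forall>\<^sub>F p in sequentially. (1 + 1 / real (Suc p)) * m < m + e \<and> m / (1 + 1 / real (Suc p)) > m - e"
    using \<open>0 < e\<close> by (intro eventually_conj order_tendstoD[of _ m]) simp_all
  then obtain p where p: "(1 + 1 / real (Suc p)) * m < m + e" "m / (1 + 1 / real (Suc p)) > m - e"
    using eventually_happens'[OF sequentially_bot] by blast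
  define \<alpha> where "\<alpha> = 1 + 1 / real (Suc p)"
  have \<alpha>: "1 < \<alpha>" by (simp add: \<alpha>_def)
  define b where "b n = (\<Sum>j<nat \<lfloor>\<alpha> ^ n\<rfloor>. y j) / \<alpha> ^ n" for n
  define k where "k N = nat \<lfloor>log \<alpha> (real N)\<rfloor>" for N
  have b: "b \<longlonglongrightarrow> m" using lim[of p] unfolding b_def \<alpha>_def .
  have k: "filterlim k sequentially sequentially"
    unfolding k_def
  proof (intro filterlim_compose[OF filterlim_nat_sequentially] filterlim_compose[OF filterlim_floor_sequentially])
    have "filterlim (\<lambda>N. 1 / ln \<alpha> * ln (real N)) at_top sequentially"
      using \<alpha>
      by (intro filterlim_tendsto_pos_mult_at_top[OF tendsto_const]
          filterlim_compose[OF ln_at_top filterlim_real_sequentially]) auto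
    then show "filterlim (\<lambda>N. log \<alpha> (real N)) at_top sequentially"
      by (simp add: log_def)
  qed
  have up: "(\<lambda>N. \<alpha> * b (Suc (k N))) \<longlonglongrightarrow> \<alpha> * m"
    by (intro tendsto_intros filterlim_compose[OF LIMSEQ_Suc[OF b] k])
  have lo: "(\<lambda>N. b (k N) / \<alpha>) \<longlonglongrightarrow> m / \<alpha>"
    using \<alpha> by (intro tendsto_intros filterlim_compose[OF b k]) auto
  have "\<forall>\<^sub>F N in sequentially. \<alpha> * b (Suc (k N)) < m + e"
    using order_tendstoD(2)[OF up] p by (simp add: \<alpha>_def)
  moreover have "\<forall>\<^sub>F N in sequentially. b (k N) / \<alpha> > m - e"
    using order_tendstoD(1)[OF lo] p by (simp add: \<alpha>_def)
  ultimately have "\<forall>\<^sub>F N in sequentially. norm ((\<Sum>j<N. y j) / N - m) < e"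
    using eventually_gt_at_top[of 0]
  proof eventually_elim
    case (elim N)
    have l0: "0 \<le> log \<alpha> (real N)" using elim \<alpha> by simp
    have "real (k N) \<le> log \<alpha> (real N)" "log \<alpha> (real N) < real (Suc (k N))"
      using l0 by (auto simp: k_def) linarith
    then have N: "\<alpha> ^ k N \<le> real N" "real N < \<alpha> ^ Suc (k N)"
      using elim \<alpha> powr_realpow[of \<alpha> "Suc (k N)"]
      by (auto simp: le_log_iff log_less_iff powr_realpow simp del: power_Suc of_nat_Suc)
    then have nN: "nat \<lfloor>\<alpha> ^ k N\<rfloor> \<le> N" "N \<le> nat \<lfloor>\<alpha> ^ Suc (k N)\<rfloor>"
      by (simp_all add: floor_le_iff le_nat_iff le_floor_iff nat_le_iff del: power_Suc)
    have "(\<Sum>j<N. y j) / N \<le> (\<Sum>j<nat \<lfloor>\<alpha> ^ Suc (k N)\<rfloor>. y j) / \<alpha> ^ k N"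
      using nN N \<alpha> by (intro frac_le sum_mono2 sum_nonneg nonneg) auto
    also have "\<dots> = \<alpha> * b (Suc (k N))" using \<alpha> by (simp add: b_def)
    finally have A: "(\<Sum>j<N. y j) / N \<le> \<alpha> * b (Suc (k N))" .
    have "b (k N) / \<alpha> = (\<Sum>j<nat \<lfloor>\<alpha> ^ k N\<rfloor>. y j) / \<alpha> ^ Suc (k N)" using \<alpha> by (simp add: b_def field_simps)
    also have "\<dots> \<le> (\<Sum>j<N. y j) / N"
      using nN N \<alpha> elim by (intro frac_le sum_mono2 sum_nonneg nonneg) auto
    finally show ?case using A elim by (auto simp: abs_less_iff)
  qed
  then show "\<exists>n0. \<forall>N\<ge>n0. norm ((\<Sum>j<N. y j) / N - m) < e"
    by (simp add: eventually_at_top_linorder)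
qed

text \<open>The cross terms vanish because two distinct variables are independent and centred;
  boundedness makes all products integrable.\<close>

lemma (in prob_space) second_moment_sum_indep:
  fixes Z :: "nat \<Rightarrow> 'a \<Rightarrow> real"
  assumes indep: "indep_vars (\<lambda>_. borel) Z UNIV"
    and bound: "\<And>j \<omega>. \<bar>Z j \<omega>\<bar> \<le> B" and mean: "\<And>j. expectation (Z j) = 0"
  shows "expectation (\<lambda>\<omega>. (\<Sum>j<k. Z j \<omega>)\<^sup>2) = (\<Sum>j<k. expectation (\<lambda>\<omega>. (Z j \<omega>)\<^sup>2))"
proof -
  have [measurable]: "Z j \<in> borel_measurable M" for j
    using indep by (auto simp: indep_vars_def)
  have B: "0 \<le> B" using bound[of 0 undefined] by simp
  have int: "integrable M (Z j)" for j
    using bound by (intro integrable_const_bound[of _ B]) auto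
  have int2: "integrable M (\<lambda>\<omega>. Z i \<omega> * Z j \<omega>)" for i j
    using B mult_mono[OF bound bound]
    by (intro integrable_const_bound[of _ "B * B"]) (auto simp: abs_mult)
  have orth: "expectation (\<lambda>\<omega>. Z i \<omega> * Z j \<omega>) = (if i = j then expectation (\<lambda>\<omega>. (Z j \<omega>)\<^sup>2) else 0)" for i j
  proof (cases "i = j")
    case False
    then have "indep_var (Pi\<^sub>M {i} (\<lambda>_. borel)) (\<lambda>\<omega>. \<lambda>i\<in>{i}. Z i \<omega>) (Pi\<^sub>M {j} (\<lambda>_. borel)) (\<lambda>\<omega>. \<lambda>i\<in>{j}. Z i \<omega>)"
      by (intro indep_var_restrict[OF indep]) auto
    from indep_var_compose[OF this, of "\<lambda>f. f i" borel "\<lambda>f. f j" borel]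
    have "indep_var borel (Z i) borel (Z j)"
      by (simp add: comp_def)
    then show ?thesis
      using False int mean by (subst indep_var_lebesgue_integral) auto
  qed (simp add: power2_eq_square)
  have "expectation (\<lambda>\<omega>. (\<Sum>j<k. Z j \<omega>)\<^sup>2) = (\<Sum>i<k. \<Sum>j<k. expectation (\<lambda>\<omega>. Z i \<omega> * Z j \<omega>))"
    using int2 by (simp add: power2_eq_square sum_product)
  also have "\<dots> = (\<Sum>j<k. expectation (\<lambda>\<omega>. (Z j \<omega>)\<^sup>2))"
    by (simp add: orth)
  finally show ?thesis .
qed

text \<open>Nonnegativity reduces the claim to the ends of geometric blocks. There the Chebyshev
  bounds for truncated sums are summable without any second moment of the variables
  themselves.\<close>

lemma (in prob_space) slln_nonneg:
  fixes Y :: "nat \<Rightarrow> 'a \<Rightarrow> real"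
  assumes indep: "indep_vars (\<lambda>_. borel) Y UNIV"
    and ident: "\<And>j. distr M borel (Y j) = distr M borel (Y 0)"
    and nonneg: "\<And>j \<omega>. 0 \<le> Y j \<omega>" and int: "integrable M (Y 0)"
  shows "AE \<omega> in M. (\<lambda>N. (\<Sum>j<N. Y j \<omega>) / N) \<longlonglongrightarrow> expectation (Y 0)"
proof -
  have meas[measurable]: "Y j \<in> borel_measurable M" for j
    using indep by (auto simp: indep_vars_def)
  have trans: "expectation (\<lambda>\<omega>. \<phi> (Y j \<omega>)) = expectation (\<lambda>\<omega>. \<phi> (Y 0 \<omega>))"
    if "\<phi> \<in> borel_measurable borel" for \<phi> :: "real \<Rightarrow> real" and j
    using integral_distr[OF meas that, of j] integral_distr[OF meas that, of 0] ident[of j] by simp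
  \<comment> \<open>Etemadi's argument: along the blocks of length \<open>\<alpha> ^ n\<close>, truncate at \<open>\<alpha> ^ n\<close>.\<close>
  have block: "AE \<omega> in M. (\<lambda>n. (\<Sum>j<nat \<lfloor>\<alpha> ^ n\<rfloor>. Y j \<omega>) / \<alpha> ^ n) \<longlonglongrightarrow> expectation (Y 0)"
    if \<alpha>: "1 < \<alpha>" for \<alpha> :: real
  proof -
    define k where "k n = nat \<lfloor>\<alpha> ^ n\<rfloor>" for n
    define \<tau> where "\<tau> n y = y * indicator {..\<alpha> ^ n} y" for n and y :: real
    define e where "e n = expectation (\<lambda>\<omega>. \<tau> n (Y 0 \<omega>))" for n
    define T where "T n \<omega> = (\<Sum>j<k n. \<tau> n (Y j \<omega>) - e n)" for n \<omega>
    have pos: "0 < \<alpha> ^ n" for n using \<alpha> by simp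
    have k: "real (k n) \<le> \<alpha> ^ n" for n
      using pos[of n] by (simp add: k_def)
    have [measurable]: "\<tau> n \<in> borel_measurable borel" for n
      unfolding \<tau>_def by measurable
    have [measurable]: "T n \<in> borel_measurable M" for n
      unfolding T_def by measurable
    have \<tau>_bound: "\<bar>\<tau> n (Y j \<omega>)\<bar> \<le> \<alpha> ^ n" for n j \<omega>
      using nonneg[of j \<omega>] pos[of n] by (auto simp: \<tau>_def indicator_def)
    have \<tau>_int: "integrable M (\<lambda>\<omega>. \<tau> n (Y j \<omega>))" for n j
      using \<tau>_bound by (intro integrable_const_bound[of _ "\<alpha> ^ n"]) auto
    have \<tau>_int2: "integrable M (\<lambda>\<omega>. (\<tau> n (Y j \<omega>))\<^sup>2)" for n j
      using \<tau>_bound pos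
      by (intro integrable_const_bound[of _ "(\<alpha> ^ n)\<^sup>2"]) (auto intro!: power2_le_iff_abs_le[THEN iffD2] simp: less_imp_le)
    have e_bound: "\<bar>e n\<bar> \<le> \<alpha> ^ n" for n
    proof -
      have "\<bar>e n\<bar> \<le> expectation (\<lambda>\<omega>. \<bar>\<tau> n (Y 0 \<omega>)\<bar>)"
        unfolding e_def by (rule integral_abs_bound)
      also have "\<dots> \<le> expectation (\<lambda>\<omega>. \<alpha> ^ n)"
        by (rule integral_mono) (use \<tau>_bound \<tau>_int in auto)
      finally show ?thesis by (simp add: prob_space)
    qed
    let ?C = "\<alpha> / (\<alpha> - 1) * expectation (Y 0)"

    \<comment> \<open>Outside \<open>A n\<close> no term of block \<open>n\<close> exceeds the
      truncation level, so truncated and original block sums agree. The union bound leaves at most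
      \<open>\<alpha> ^ n\<close> times a tail probability, summable by
      \<open>geometric_sum_below_le\<close>.\<close>
    define A where "A n = {\<omega> \<in> space M. \<exists>j<k n. \<alpha> ^ n < Y j \<omega>}" for n
    have [measurable]: "A n \<in> sets M" for n
      unfolding A_def by measurable
    have "measure M (A n) \<le> expectation (\<lambda>\<omega>. \<alpha> ^ n * indicator {\<alpha> ^ n<..} (Y 0 \<omega>))" for n
    proof -
      have "A n = (\<Union>j<k n. {\<omega> \<in> space M. \<alpha> ^ n < Y j \<omega>})" by (auto simp: A_def)
      then have "measure M (A n) \<le> (\<Sum>j<k n. measure M {\<omega> \<in> space M. \<alpha> ^ n < Y j \<omega>})"
        by (auto intro!: finite_measure_subadditive_finite)
      also have "\<dots> = (\<Sum>j<k n. expectation (\<lambda>\<omega>. indicator {\<alpha> ^ n<..} (Y j \<omega>)))"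
      proof (intro sum.cong refl)
        fix j
        have "measure M {\<omega> \<in> space M. \<alpha> ^ n < Y j \<omega>} = expectation (indicator {\<omega> \<in> space M. \<alpha> ^ n < Y j \<omega>})"
          by simp
        also have "\<dots> = expectation (\<lambda>\<omega>. indicator {\<alpha> ^ n<..} (Y j \<omega>))"
          by (intro Bochner_Integration.integral_cong) (auto simp: indicator_def)
        finally show "measure M {\<omega> \<in> space M. \<alpha> ^ n < Y j \<omega>} = expectation (\<lambda>\<omega>. indicator {\<alpha> ^ n<..} (Y j \<omega>))" .
      qed
      also have "\<dots> = real (k n) * expectation (\<lambda>\<omega>. indicator {\<alpha> ^ n<..} (Y 0 \<omega>))"
        by (subst trans) auto
      also have "\<dots> \<le> \<alpha> ^ n * expectation (\<lambda>\<omega>. indicator {\<alpha> ^ n<..} (Y 0 \<omega>))"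
        using k by (intro mult_right_mono integral_nonneg_AE) auto
      finally show ?thesis by simp
    qed
    moreover have "summable (\<lambda>n. expectation (\<lambda>\<omega>. \<alpha> ^ n * indicator {\<alpha> ^ n<..} (Y 0 \<omega>)))"
    proof (rule summableI_nonneg_bounded[where x = ?C])
      fix m
      have int_ind: "integrable M (\<lambda>\<omega>. \<alpha> ^ n * indicator {\<alpha> ^ n<..} (Y 0 \<omega>))" for n
        using pos[of n] by (intro integrable_const_bound[of _ "\<alpha> ^ n"]) (auto simp: indicator_def)
      have "(\<Sum>n<m. expectation (\<lambda>\<omega>. \<alpha> ^ n * indicator {\<alpha> ^ n<..} (Y 0 \<omega>)))
        = expectation (\<lambda>\<omega>. \<Sum>n<m. \<alpha> ^ n * indicator {\<alpha> ^ n<..} (Y 0 \<omega>))"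
        using int_ind by (subst Bochner_Integration.integral_sum) auto
      also have "\<dots> \<le> expectation (\<lambda>\<omega>. \<alpha> / (\<alpha> - 1) * Y 0 \<omega>)"
        using int_ind int \<alpha> nonneg
        by (intro integral_mono Bochner_Integration.integrable_sum integrable_mult_right geometric_sum_below_le) auto
      finally show "(\<Sum>n<m. expectation (\<lambda>\<omega>. \<alpha> ^ n * indicator {\<alpha> ^ n<..} (Y 0 \<omega>))) \<le> ?C"
        by simp
    qed (use pos in \<open>auto intro!: integral_nonneg_AE simp: less_imp_le\<close>)
    ultimately have "summable (\<lambda>n. measure M (A n))"
      using summable_comparison_test'[of "\<lambda>n. expectation (\<lambda>\<omega>. \<alpha> ^ n * indicator {\<alpha> ^ n<..} (Y 0 \<omega>))" 0 "\<lambda>n. measure M (A n)"]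
      by simp
    then have trunc: "AE \<omega> in M. \<forall>\<^sub>F n in sequentially. \<omega> \<in> space M - A n"
      by (intro borel_cantelli_AE1) (auto simp: less_top[symmetric])

    \<comment> \<open>Chebyshev at scale \<open>\<alpha> ^ n\<close>: the variance of a block sum is
      at most \<open>\<alpha> ^ n\<close> truncated second moments, so the probability is at most a
      multiple of \<open>v n\<close>, summable by \<open>geometric_sum_above_le\<close>.\<close>
    have dev: "AE \<omega> in M. \<forall>\<^sub>F n in sequentially. \<bar>T n \<omega> / \<alpha> ^ n\<bar> < \<epsilon>" if \<epsilon>: "0 < \<epsilon>" for \<epsilon>
    proof -
      define D where "D n = {\<omega> \<in> space M. \<epsilon> * \<alpha> ^ n \<le> \<bar>T n \<omega>\<bar>}" for n
      have [measurable]: "D n \<in> sets M" for n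
        unfolding D_def by measurable
      define v where "v n = expectation (\<lambda>\<omega>. (Y 0 \<omega>)\<^sup>2 / \<alpha> ^ n * indicator {..\<alpha> ^ n} (Y 0 \<omega>))" for n
      have v: "v n = expectation (\<lambda>\<omega>. (\<tau> n (Y 0 \<omega>))\<^sup>2) / \<alpha> ^ n" for n
        unfolding v_def integral_divide_zero[symmetric]
        by (intro Bochner_Integration.integral_cong) (auto simp: \<tau>_def indicator_def)
      have "measure M (D n) \<le> 1 / \<epsilon>\<^sup>2 * v n" for n
      proof -
        have cen: "expectation (\<lambda>\<omega>. \<tau> n (Y j \<omega>) - e n) = 0" for j
          using trans[of "\<tau> n" j] \<tau>_int by (simp add: e_def prob_space)
        have ET: "expectation (T n) = 0"
          unfolding T_def using \<tau>_int cen by (subst Bochner_Integration.integral_sum) auto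
        have bnd: "\<bar>\<tau> n (Y j \<omega>) - e n\<bar> \<le> 2 * \<alpha> ^ n" for j \<omega>
          using \<tau>_bound[of n j \<omega>] e_bound[of n] by linarith
        have Tbnd: "\<bar>T n \<omega>\<bar> \<le> k n * (2 * \<alpha> ^ n)" for \<omega>
        proof -
          have "\<bar>T n \<omega>\<bar> \<le> (\<Sum>j<k n. \<bar>\<tau> n (Y j \<omega>) - e n\<bar>)"
            unfolding T_def by (rule sum_abs)
          also have "\<dots> \<le> (\<Sum>j<k n. 2 * \<alpha> ^ n)"
            by (rule sum_mono) (rule bnd)
          finally show ?thesis by simp
        qed
        have "expectation (\<lambda>\<omega>. (T n \<omega>)\<^sup>2) = (\<Sum>j<k n. expectation (\<lambda>\<omega>. (\<tau> n (Y j \<omega>) - e n)\<^sup>2))"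
          unfolding T_def
          by (intro second_moment_sum_indep[where B = "2 * \<alpha> ^ n"] bnd cen
              indep_vars_compose2[OF indep, where Y = "\<lambda>_ y. \<tau> n y - e n"]) auto
        also have "\<dots> \<le> (\<Sum>j<k n. expectation (\<lambda>\<omega>. (\<tau> n (Y j \<omega>))\<^sup>2))"
        proof (intro sum_mono)
          fix j
          have "expectation (\<lambda>\<omega>. (\<tau> n (Y j \<omega>) - e n)\<^sup>2) = expectation (\<lambda>\<omega>. (\<tau> n (Y j \<omega>))\<^sup>2) - (e n)\<^sup>2"
          proof -
            have "expectation (\<lambda>\<omega>. \<tau> n (Y j \<omega>)) = e n" using trans[of "\<tau> n" j] by (simp add: e_def)
            moreover have "expectation (\<lambda>\<omega>. (\<tau> n (Y j \<omega>) - e n)\<^sup>2)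
              = expectation (\<lambda>\<omega>. (\<tau> n (Y j \<omega>))\<^sup>2 + (- 2 * e n * \<tau> n (Y j \<omega>) + (e n)\<^sup>2))"
              by (simp add: power2_eq_square algebra_simps)
            moreover have "\<dots> = expectation (\<lambda>\<omega>. (\<tau> n (Y j \<omega>))\<^sup>2) + (- 2 * e n * expectation (\<lambda>\<omega>. \<tau> n (Y j \<omega>)) + (e n)\<^sup>2)"
              using \<tau>_int[of n j] \<tau>_int2[of n j]
              by (subst Bochner_Integration.integral_add) (auto simp: prob_space)
            ultimately show ?thesis by (simp add: power2_eq_square)
          qed
          then show "expectation (\<lambda>\<omega>. (\<tau> n (Y j \<omega>) - e n)\<^sup>2) \<le> expectation (\<lambda>\<omega>. (\<tau> n (Y j \<omega>))\<^sup>2)" by simp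
        qed
        also have "\<dots> = k n * expectation (\<lambda>\<omega>. (\<tau> n (Y 0 \<omega>))\<^sup>2)"
          by (subst trans[of "\<lambda>y. (\<tau> n y)\<^sup>2"]) auto
        also have "\<dots> \<le> \<alpha> ^ n * expectation (\<lambda>\<omega>. (\<tau> n (Y 0 \<omega>))\<^sup>2)"
          using k by (intro mult_right_mono integral_nonneg_AE) auto
        finally have var: "expectation (\<lambda>\<omega>. (T n \<omega>)\<^sup>2) \<le> (\<alpha> ^ n)\<^sup>2 * v n"
          using pos[of n] \<alpha> by (simp add: v power2_eq_square)
        have "measure M (D n) \<le> expectation (\<lambda>\<omega>. (T n \<omega>)\<^sup>2) / (\<epsilon> * \<alpha> ^ n)\<^sup>2"
        proof -
          have "integrable M (\<lambda>\<omega>. (T n \<omega>)\<^sup>2)"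
          proof (rule integrable_const_bound)
            show "AE \<omega> in M. norm ((T n \<omega>)\<^sup>2) \<le> (k n * (2 * \<alpha> ^ n))\<^sup>2"
              using power_mono[OF Tbnd abs_ge_zero, of _ 2] by simp
          qed simp
          then show ?thesis
            using Chebyshev_inequality[of "T n" "\<epsilon> * \<alpha> ^ n"] ET \<epsilon> pos[of n] by (simp add: D_def)
        qed
        also have "\<dots> \<le> (\<alpha> ^ n)\<^sup>2 * v n / (\<epsilon> * \<alpha> ^ n)\<^sup>2"
          by (intro divide_right_mono var) auto
        finally show ?thesis using \<epsilon> \<alpha> by (simp add: power_mult_distrib)
      qed
      moreover have "summable (\<lambda>n. 1 / \<epsilon>\<^sup>2 * v n)"
      proof (intro summable_mult summableI_nonneg_bounded[where x = ?C])
        fix m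
        have int_ind: "integrable M (\<lambda>\<omega>. (Y 0 \<omega>)\<^sup>2 / \<alpha> ^ n * indicator {..\<alpha> ^ n} (Y 0 \<omega>))" for n
        proof -
          have "(\<lambda>\<omega>. (Y 0 \<omega>)\<^sup>2 / \<alpha> ^ n * indicator {..\<alpha> ^ n} (Y 0 \<omega>)) = (\<lambda>\<omega>. (\<tau> n (Y 0 \<omega>))\<^sup>2 / \<alpha> ^ n)"
            by (auto simp: \<tau>_def indicator_def)
          then show ?thesis using \<tau>_int2 by simp
        qed
        have "(\<Sum>n<m. v n) = expectation (\<lambda>\<omega>. \<Sum>n<m. (Y 0 \<omega>)\<^sup>2 / \<alpha> ^ n * indicator {..\<alpha> ^ n} (Y 0 \<omega>))"
          unfolding v_def using int_ind by (subst Bochner_Integration.integral_sum) auto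
        also have "\<dots> \<le> expectation (\<lambda>\<omega>. \<alpha> / (\<alpha> - 1) * Y 0 \<omega>)"
          using int_ind int \<alpha> nonneg
          by (intro integral_mono Bochner_Integration.integrable_sum integrable_mult_right geometric_sum_above_le) auto
        finally show "(\<Sum>n<m. v n) \<le> ?C" by simp
      qed (use pos in \<open>auto intro!: integral_nonneg_AE simp: less_imp_le v_def\<close>)
      ultimately have "summable (\<lambda>n. measure M (D n))"
        using summable_comparison_test'[of "\<lambda>n. 1 / \<epsilon>\<^sup>2 * v n" 0 "\<lambda>n. measure M (D n)"] by simp
      then have "AE \<omega> in M. \<forall>\<^sub>F n in sequentially. \<omega> \<in> space M - D n"
        by (intro borel_cantelli_AE1) (auto simp: less_top[symmetric])
      then show ?thesis
      proof (rule AE_mp, intro AE_I2 impI)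
        fix \<omega> assume "\<omega> \<in> space M" and ev: "\<forall>\<^sub>F n in sequentially. \<omega> \<in> space M - D n"
        show "\<forall>\<^sub>F n in sequentially. \<bar>T n \<omega> / \<alpha> ^ n\<bar> < \<epsilon>"
          using ev
        proof (rule eventually_mono)
          fix n assume "\<omega> \<in> space M - D n"
          then show "\<bar>T n \<omega> / \<alpha> ^ n\<bar> < \<epsilon>"
            using pos[of n] by (simp add: D_def abs_divide pos_divide_less_eq not_le del: power_abs)
        qed
      qed
    qed
    have "AE \<omega> in M. \<forall>p. \<forall>\<^sub>F n in sequentially. \<bar>T n \<omega> / \<alpha> ^ n\<bar> < 1 / Suc p"
      unfolding AE_all_countable by (intro allI dev) simp

    \<comment> \<open>The centring constants are truncated means; dominated convergence with
      majorant \<open>Y 0\<close> recovers the full mean.\<close>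
    have e_lim: "e \<longlonglongrightarrow> expectation (Y 0)"
      unfolding e_def
    proof (rule integral_dominated_convergence[where w = "Y 0"])
      show "AE \<omega> in M. (\<lambda>n. \<tau> n (Y 0 \<omega>)) \<longlonglongrightarrow> Y 0 \<omega>"
      proof (intro AE_I2 tendsto_eventually)
        fix \<omega>
        have "\<forall>\<^sub>F n in sequentially. Y 0 \<omega> \<le> \<alpha> ^ n"
          using \<alpha> by real_asymp
        then show "\<forall>\<^sub>F n in sequentially. \<tau> n (Y 0 \<omega>) = Y 0 \<omega>"
          by eventually_elim (auto simp: \<tau>_def)
      qed
    qed (use int nonneg in \<open>auto simp: \<tau>_def indicator_def\<close>)
    have k_lim: "(\<lambda>n. real (k n) / \<alpha> ^ n) \<longlonglongrightarrow> 1"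
      unfolding k_def using \<alpha> by real_asymp
    show ?thesis
      using trunc \<open>AE \<omega> in M. \<forall>p. \<forall>\<^sub>F n in sequentially. \<bar>T n \<omega> / \<alpha> ^ n\<bar> < 1 / Suc p\<close>
    proof eventually_elim
      case (elim \<omega>)
      have "(\<lambda>n. T n \<omega> / \<alpha> ^ n) \<longlonglongrightarrow> 0"
        unfolding tendsto_iff
      proof safe
        fix r :: real assume "0 < r"
        then obtain p where p: "1 / Suc p < r" using nat_approx_posE by blast
        show "\<forall>\<^sub>F n in sequentially. dist (T n \<omega> / \<alpha> ^ n) 0 < r"
          using elim(2)[rule_format, of p] by eventually_elim (use p in auto)
      qed
      then have "(\<lambda>n. T n \<omega> / \<alpha> ^ n + real (k n) / \<alpha> ^ n * e n) \<longlonglongrightarrow> 0 + 1 * expectation (Y 0)"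
        by (intro tendsto_intros e_lim k_lim)
      moreover have "\<forall>\<^sub>F n in sequentially. T n \<omega> / \<alpha> ^ n + real (k n) / \<alpha> ^ n * e n = (\<Sum>j<k n. Y j \<omega>) / \<alpha> ^ n"
      proof (rule eventually_mono[OF elim(1)])
        fix n assume "\<omega> \<in> space M - A n"
        then have "\<tau> n (Y j \<omega>) = Y j \<omega>" if "j < k n" for j
          using that by (auto simp: A_def \<tau>_def indicator_def not_le)
        then have "(\<Sum>j<k n. \<tau> n (Y j \<omega>)) = (\<Sum>j<k n. Y j \<omega>)"
          by (intro sum.cong) auto
        then show "T n \<omega> / \<alpha> ^ n + real (k n) / \<alpha> ^ n * e n = (\<Sum>j<k n. Y j \<omega>) / \<alpha> ^ n"
          by (simp add: T_def sum_subtractf diff_divide_distrib)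
      qed
      ultimately show ?case by (simp add: k_def tendsto_cong)
    qed
  qed
  have "AE \<omega> in M. \<forall>p. (\<lambda>n. (\<Sum>j<nat \<lfloor>(1 + 1 / Suc p) ^ n\<rfloor>. Y j \<omega>) / (1 + 1 / Suc p) ^ n) \<longlonglongrightarrow> expectation (Y 0)"
    unfolding AE_all_countable by (intro allI block) simp
  then show ?thesis
    by eventually_elim (intro averages_tendsto_if_geometric_averages_tendsto nonneg, blast)
qed

text \<open>Positive and negative part both have the form \<open>max 0 (c * y)\<close>, with
  \<open>c = 1\<close> and \<open>c = - 1\<close>, so one instance of the nonnegative case serves
  twice.\<close>

lemma (in prob_space) slln:
  fixes Y :: "nat \<Rightarrow> 'a \<Rightarrow> real"
  assumes indep: "indep_vars (\<lambda>_. borel) Y UNIV"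
    and ident: "\<And>j. distr M borel (Y j) = distr M borel (Y 0)"
    and int: "integrable M (Y 0)"
  shows "AE \<omega> in M. (\<lambda>N. (\<Sum>j<N. Y j \<omega>) / N) \<longlonglongrightarrow> expectation (Y 0)"
proof -
  have [measurable]: "Y j \<in> borel_measurable M" for j
    using indep by (auto simp: indep_vars_def)
  have part: "AE \<omega> in M. (\<lambda>N. (\<Sum>j<N. max 0 (c * Y j \<omega>)) / N) \<longlonglongrightarrow> expectation (\<lambda>\<omega>. max 0 (c * Y 0 \<omega>))" for c
  proof (rule slln_nonneg[where Y = "\<lambda>j \<omega>. max 0 (c * Y j \<omega>)"])
    show "indep_vars (\<lambda>_. borel) (\<lambda>j \<omega>. max 0 (c * Y j \<omega>)) UNIV"
      by (rule indep_vars_compose2[OF indep, where Y = "\<lambda>_ y. max 0 (c * y)"]) simp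
    fix j
    have "distr M borel (\<lambda>\<omega>. max 0 (c * Y j \<omega>)) = distr (distr M borel (Y j)) borel (\<lambda>y. max 0 (c * y))" for j
      by (subst distr_distr) (auto simp: comp_def)
    then show "distr M borel (\<lambda>\<omega>. max 0 (c * Y j \<omega>)) = distr M borel (\<lambda>\<omega>. max 0 (c * Y 0 \<omega>))"
      using ident[of j] by simp
  next
    show "integrable M (\<lambda>\<omega>. max 0 (c * Y 0 \<omega>))"
      by (intro integrable_max integrable_mult_right int) simp
  qed simp
  have split: "y = max 0 (1 * y) - max 0 (- 1 * y)" for y :: real by auto
  have "expectation (Y 0) = expectation (\<lambda>\<omega>. max 0 (1 * Y 0 \<omega>)) - expectation (\<lambda>\<omega>. max 0 (- 1 * Y 0 \<omega>))"
  proof -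
    have "integrable M (\<lambda>\<omega>. max 0 (1 * Y 0 \<omega>))" "integrable M (\<lambda>\<omega>. max 0 (- 1 * Y 0 \<omega>))"
      using int by auto
    then show ?thesis
      by (subst Bochner_Integration.integral_diff[symmetric]) (simp_all only: split[symmetric])
  qed
  moreover have "(\<Sum>j<N. Y j \<omega>) / N = (\<Sum>j<N. max 0 (1 * Y j \<omega>)) / N - (\<Sum>j<N. max 0 (- 1 * Y j \<omega>)) / N" for N \<omega>
    by (subst split) (simp only: sum_subtractf diff_divide_distrib)
  ultimately show ?thesis
    using part[of 1] part[of "- 1"] by (auto intro: tendsto_diff)
qed

section \<open>Dominated convergence with varying majorants\<close>

lemma integral_pratt_convergence:
  fixes f :: "'a \<Rightarrow> 'b::{banach, second_countable_topology}"
  assumes [measurable]: "\<And>n. F n \<in> borel_measurable M" "f \<in> borel_measurable M"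
    and g: "\<And>n. integrable M (g n)" "integrable M g'"
    and Ff: "AE x in M. (\<lambda>n. F n x) \<longlonglongrightarrow> f x"
    and gg: "AE x in M. (\<lambda>n. g n x) \<longlonglongrightarrow> (g' x :: real)"
    and dom: "\<And>n x. x \<in> space M \<Longrightarrow> norm (F n x) \<le> g n x"
    and Ig: "(\<lambda>n. integral\<^sup>L M (g n)) \<longlonglongrightarrow> integral\<^sup>L M g'"
  shows "(\<lambda>n. integral\<^sup>L M (F n)) \<longlonglongrightarrow> integral\<^sup>L M f"
proof -
  have [measurable]: "g n \<in> borel_measurable M" "g' \<in> borel_measurable M" for n
    using g by auto
  have g_nonneg: "0 \<le> g n x" if "x \<in> space M" for n x
    using dom[OF that, of n] norm_ge_zero order_trans by blast
  have fg: "AE x in M. norm (f x) \<le> g' x \<and> 0 \<le> g' x"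
    using Ff gg AE_space
  proof eventually_elim
    case (elim x)
    have "norm (f x) \<le> g' x"
      by (rule tendsto_le[OF _ elim(2) tendsto_norm[OF elim(1)]]) (use dom elim in auto)
    then show ?case using norm_ge_zero[of "f x"] by linarith
  qed
  have F: "integrable M (F n)" for n
    by (rule Bochner_Integration.integrable_bound[OF g(1)[of n]]) (use dom g_nonneg in auto)
  have f: "integrable M f"
    by (rule Bochner_Integration.integrable_bound[OF g(2)]) (use fg in auto)
  \<comment> \<open>The error \<open>norm (F n x - f x)\<close> is at most
    \<open>g n x + g' x\<close>. It is split into \<open>h\<close>, capped by the fixed majorant
    \<open>2 * g'\<close> and hence open to ordinary dominated convergence, and \<open>r\<close>,
    the excess of \<open>g n\<close> over \<open>g'\<close>.\<close>
  define h where "h n x = min (norm (F n x - f x)) (2 * g' x)" for n x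
  define r where "r n x = max 0 (g n x - g' x)" for n x
  have hr: "integrable M (h n)" "integrable M (r n)" for n
    unfolding h_def r_def
    by (intro integrable_min integrable_max integrable_norm Bochner_Integration.integrable_diff
        integrable_mult_right F f g integrable_zero)+
  have h: "(\<lambda>n. integral\<^sup>L M (h n)) \<longlonglongrightarrow> integral\<^sup>L M (\<lambda>_. 0)"
  proof (rule integral_dominated_convergence[where w = "\<lambda>x. 2 * g' x"])
    show "AE x in M. (\<lambda>n. h n x) \<longlonglongrightarrow> 0"
      using Ff fg
    proof eventually_elim
      case (elim x)
      then have "(\<lambda>n. norm (F n x - f x)) \<longlonglongrightarrow> 0"
        using tendsto_norm[OF LIM_zero[OF elim(1)]] by simp
      then have "(\<lambda>n. h n x) \<longlonglongrightarrow> min 0 (2 * g' x)"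
        unfolding h_def by (intro tendsto_intros)
      then show ?case using elim(2) by (simp add: min_def)
    qed
    show "AE x in M. norm (h n x) \<le> 2 * g' x" for n
      using fg by eventually_elim (auto simp: h_def min_def)
    show "h n \<in> borel_measurable M" for n using hr by auto
  qed (use g in auto)
  \<comment> \<open>Scheffe's argument: the negative part of \<open>g n - g'\<close> is dominated by
    \<open>g'\<close>, and the integrals of positive and negative part differ by a quantity that
    tends to zero by \<open>Ig\<close>.\<close>
  have r: "(\<lambda>n. integral\<^sup>L M (r n)) \<longlonglongrightarrow> 0"
  proof -
    have "(\<lambda>n. integral\<^sup>L M (\<lambda>x. max 0 (g' x - g n x))) \<longlonglongrightarrow> integral\<^sup>L M (\<lambda>_. 0)"
    proof (rule integral_dominated_convergence[where w = g'])
      show "AE x in M. (\<lambda>n. max 0 (g' x - g n x)) \<longlonglongrightarrow> 0"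
        using gg
      proof eventually_elim
        case (elim x)
        have "(\<lambda>n. max 0 (g' x - g n x)) \<longlonglongrightarrow> max 0 (g' x - g' x)"
          by (intro tendsto_intros elim)
        then show ?case by simp
      qed
      show "AE x in M. norm (max 0 (g' x - g n x)) \<le> g' x" for n
        using fg AE_space by eventually_elim (use g_nonneg in \<open>auto simp: max_def\<close>)
    qed (use g in auto)
    moreover have "integral\<^sup>L M (r n) = integral\<^sup>L M (\<lambda>x. max 0 (g' x - g n x)) + (integral\<^sup>L M (g n) - integral\<^sup>L M g')" for n
    proof -
      have "integral\<^sup>L M (r n) = integral\<^sup>L M (\<lambda>x. max 0 (g' x - g n x) + (g n x - g' x))"
        by (intro Bochner_Integration.integral_cong) (auto simp: r_def)
      then show ?thesis using g by simp
    qed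
    ultimately show ?thesis
      using tendsto_add[OF _ LIM_zero[OF Ig]] by fastforce
  qed
  have "(\<lambda>n. integral\<^sup>L M (F n) - integral\<^sup>L M f) \<longlonglongrightarrow> 0"
  proof (rule tendsto_norm_zero_cancel, rule tendsto_sandwich[of "\<lambda>_. 0"])
    show "(\<lambda>n. integral\<^sup>L M (h n) + integral\<^sup>L M (r n)) \<longlonglongrightarrow> 0"
      using tendsto_add[OF h r] by simp
    have "norm (integral\<^sup>L M (F n) - integral\<^sup>L M f) \<le> integral\<^sup>L M (h n) + integral\<^sup>L M (r n)" for n
    proof -
      have "norm (integral\<^sup>L M (F n) - integral\<^sup>L M f) = norm (integral\<^sup>L M (\<lambda>x. F n x - f x))"
        using F f by simp
      also have "\<dots> \<le> integral\<^sup>L M (\<lambda>x. norm (F n x - f x))"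
        by (rule integral_norm_bound)
      also have "\<dots> \<le> integral\<^sup>L M (\<lambda>x. h n x + r n x)"
      proof (rule integral_mono_AE)
        show "AE x in M. norm (F n x - f x) \<le> h n x + r n x"
          using fg AE_space
        proof eventually_elim
          case (elim x)
          have "norm (F n x - f x) \<le> g n x + g' x"
            using norm_triangle_ineq4[of "F n x" "f x"] dom[OF elim(2), of n] elim(1) by linarith
          then show ?case by (auto simp: h_def r_def)
        qed
      qed (use F[of n] f hr[of n] in auto)
      finally show ?thesis using hr by simp
    qed
    then show "\<forall>\<^sub>F n in sequentially. norm (integral\<^sup>L M (F n) - integral\<^sup>L M f) \<le> integral\<^sup>L M (h n) + integral\<^sup>L M (r n)"
      by simp
  qed auto
  then show ?thesis by (rule LIM_zero_cancel)
qed

section \<open>Kernels dominated by a product weight\<close>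

definition kcomp :: "'t measure \<Rightarrow> ('t \<Rightarrow> 't \<Rightarrow> complex) \<Rightarrow> ('t \<Rightarrow> 't \<Rightarrow> complex) \<Rightarrow> 't \<Rightarrow> 't \<Rightarrow> complex" where
  "kcomp \<mu> A B s t = (LINT u|\<mu>. A s u * B u t)"

definition ktrace :: "'t measure \<Rightarrow> ('t \<Rightarrow> 't \<Rightarrow> complex) \<Rightarrow> complex" where
  "ktrace \<mu> A = (LINT t|\<mu>. A t t)"

definition weight :: "'t measure \<Rightarrow> ('t \<Rightarrow> real) \<Rightarrow> bool" where
  "weight \<mu> w \<longleftrightarrow> w \<in> borel_measurable \<mu> \<and> (\<forall>t. 0 \<le> w t) \<and> integrable \<mu> (\<lambda>t. (w t)\<^sup>2)"

text \<open>The bound is imposed at every pair of points, not almost everywhere: it has to control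
  the diagonal, which may be a null set of the product measure.\<close>

definition dom_kernel :: "'t measure \<Rightarrow> ('t \<Rightarrow> real) \<Rightarrow> real \<Rightarrow> ('t \<Rightarrow> 't \<Rightarrow> complex) \<Rightarrow> bool" where
  "dom_kernel \<mu> w K A \<longleftrightarrow> 0 \<le> K \<and> (\<lambda>(s, t). A s t) \<in> borel_measurable (\<mu> \<Otimes>\<^sub>M \<mu>) \<and>
     (\<forall>s\<in>space \<mu>. \<forall>t\<in>space \<mu>. cmod (A s t) \<le> K * (w s * w t))"

lemma dom_kernelD:
  assumes "dom_kernel \<mu> w K A" "s \<in> space \<mu>" "t \<in> space \<mu>"
  shows "cmod (A s t) \<le> K * (w s * w t)"
  using assms by (simp add: dom_kernel_def)

lemma dom_kernel_mono:
  assumes "dom_kernel \<mu> w K A" "K \<le> K'" "weight \<mu> w"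
  shows "dom_kernel \<mu> w K' A"
proof -
  have "K * (w s * w t) \<le> K' * (w s * w t)" for s t
    using assms by (intro mult_right_mono) (auto simp: weight_def)
  then show ?thesis using assms unfolding dom_kernel_def by (meson order_trans)
qed

lemma dom_kernel_measurable:
  assumes "dom_kernel \<mu> w K A" and [measurable]: "f \<in> measurable N \<mu>" "g \<in> measurable N \<mu>"
  shows "(\<lambda>x. A (f x) (g x)) \<in> borel_measurable N"
proof -
  have "(\<lambda>x. (f x, g x)) \<in> measurable N (\<mu> \<Otimes>\<^sub>M \<mu>)" by measurable
  from measurable_compose[OF this, of "\<lambda>(s, t). A s t" borel] show ?thesis
    using assms(1) unfolding dom_kernel_def by simp
qed

lemma dom_kernel_prod_bound:
  assumes "weight \<mu> w" "dom_kernel \<mu> w K A" "dom_kernel \<mu> w K' B"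
    and "s \<in> space \<mu>" "t \<in> space \<mu>" "u \<in> space \<mu>" "v \<in> space \<mu>"
  shows "cmod (A s u * B v t) \<le> K * K' * (w s * w t) * (w u * w v)"
proof -
  have "cmod (A s u * B v t) \<le> (K * (w s * w u)) * (K' * (w v * w t))"
    unfolding norm_mult using assms by (intro mult_mono) (auto simp: dom_kernel_def weight_def)
  then show ?thesis by (simp add: algebra_simps)
qed

locale sfm = sigma_finite_measure \<mu> for \<mu> :: "'t measure"
begin

sublocale pair: pair_sigma_finite \<mu> \<mu> ..

lemma kcomp_integrable:
  assumes "weight \<mu> w" "dom_kernel \<mu> w K A" "dom_kernel \<mu> w K' B" "s \<in> space \<mu>" "t \<in> space \<mu>"
  shows "integrable \<mu> (\<lambda>u. A s u * B u t)"
proof (rule Bochner_Integration.integrable_bound)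
  show "integrable \<mu> (\<lambda>u. K * K' * (w s * w t) * (w u)\<^sup>2)"
    using assms(1) by (simp add: weight_def)
  show "(\<lambda>u. A s u * B u t) \<in> borel_measurable \<mu>"
    using assms by (intro borel_measurable_times dom_kernel_measurable[OF assms(2)] dom_kernel_measurable[OF assms(3)]) auto
  show "AE u in \<mu>. norm (A s u * B u t) \<le> norm (K * K' * (w s * w t) * (w u)\<^sup>2)"
    using dom_kernel_prod_bound[OF assms] by (intro AE_I2) (auto simp: power2_eq_square intro: order_trans[OF _ abs_ge_self])
qed

text \<open>The weight is preserved and only the constant changes, so all powers of a kernel stay in
  the same class.\<close>

lemma dom_kernel_kcomp:
  assumes w: "weight \<mu> w" and A: "dom_kernel \<mu> w K A" and B: "dom_kernel \<mu> w K' B"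
  shows "dom_kernel \<mu> w (K * K' * (LINT u|\<mu>. (w u)\<^sup>2)) (kcomp \<mu> A B)"
  unfolding dom_kernel_def
proof (intro conjI ballI)
  have [measurable]: "w \<in> borel_measurable \<mu>" using w by (simp add: weight_def)
  have "(\<lambda>(x, u). A (fst x) u * B u (snd x)) \<in> borel_measurable ((\<mu> \<Otimes>\<^sub>M \<mu>) \<Otimes>\<^sub>M \<mu>)"
    unfolding split_beta'
    by (intro borel_measurable_times dom_kernel_measurable[OF A] dom_kernel_measurable[OF B]) measurable
  from borel_measurable_lebesgue_integral[OF this]
  show "(\<lambda>(s, t). kcomp \<mu> A B s t) \<in> borel_measurable (\<mu> \<Otimes>\<^sub>M \<mu>)"
    by (simp add: kcomp_def split_beta')
  show "0 \<le> K * K' * (LINT u|\<mu>. (w u)\<^sup>2)"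
    using A B by (auto simp: dom_kernel_def)
  fix s t assume st: "s \<in> space \<mu>" "t \<in> space \<mu>"
  have "cmod (kcomp \<mu> A B s t) \<le> (LINT u|\<mu>. cmod (A s u * B u t))"
    unfolding kcomp_def by (rule integral_norm_bound)
  also have "\<dots> \<le> (LINT u|\<mu>. K * K' * (w s * w t) * (w u)\<^sup>2)"
    using dom_kernel_prod_bound[OF w A B st] kcomp_integrable[OF w A B st] w
    by (intro integral_mono) (auto simp: power2_eq_square weight_def)
  finally show "cmod (kcomp \<mu> A B s t) \<le> K * K' * (LINT u|\<mu>. (w u)\<^sup>2) * (w s * w t)"
    by (simp add: algebra_simps)
qed

lemma ktrace_integrable:
  assumes "weight \<mu> w" "dom_kernel \<mu> w K A"
  shows "integrable \<mu> (\<lambda>t. A t t)"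
proof (rule Bochner_Integration.integrable_bound)
  show "integrable \<mu> (\<lambda>t. K * (w t)\<^sup>2)"
    using assms(1) by (simp add: weight_def)
  show "(\<lambda>t. A t t) \<in> borel_measurable \<mu>"
    by (intro dom_kernel_measurable[OF assms(2)]) auto
  show "AE t in \<mu>. norm (A t t) \<le> norm (K * (w t)\<^sup>2)"
    using assms by (intro AE_I2) (auto simp: dom_kernel_def power2_eq_square intro: order_trans[OF _ abs_ge_self])
qed

text \<open>Around a cycle of length two each point occurs twice, so the integrand is at most
  \<open>K * K'\<close> times the product of the two squared weights. This justifies Fubini for
  traces and associativity.\<close>

lemma dom_kernel_pair_integrable:
  assumes w: "weight \<mu> w" and A: "dom_kernel \<mu> w K A" and B: "dom_kernel \<mu> w K' B"
  shows "integrable (\<mu> \<Otimes>\<^sub>M \<mu>) (\<lambda>(s, t). A s t * B t s)"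
proof (rule pair.Fubini_integrable)
  have [measurable]: "w \<in> borel_measurable \<mu>" using w by (simp add: weight_def)
  show "(\<lambda>(s, t). A s t * B t s) \<in> borel_measurable (\<mu> \<Otimes>\<^sub>M \<mu>)"
    unfolding split_beta'
    by (intro borel_measurable_times dom_kernel_measurable[OF A] dom_kernel_measurable[OF B]) measurable
  show "AE s in \<mu>. integrable \<mu> (\<lambda>t. case (s, t) of (s, t) \<Rightarrow> A s t * B t s)"
    using kcomp_integrable[OF w A B] by (intro AE_I2) auto
  show "integrable \<mu> (\<lambda>s. LINT t|\<mu>. norm (case (s, t) of (s, t) \<Rightarrow> A s t * B t s))"
  proof (rule Bochner_Integration.integrable_bound)
    show "integrable \<mu> (\<lambda>s. K * K' * (LINT u|\<mu>. (w u)\<^sup>2) * (w s)\<^sup>2)"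
      using w by (simp add: weight_def)
    have "(\<lambda>(s, t). norm (A s t * B t s)) \<in> borel_measurable (\<mu> \<Otimes>\<^sub>M \<mu>)"
      unfolding split_beta'
      by (intro borel_measurable_norm borel_measurable_times dom_kernel_measurable[OF A] dom_kernel_measurable[OF B] measurable_compose[OF _ borel_measurable_norm]) measurable
    from borel_measurable_lebesgue_integral[OF this]
    show "(\<lambda>s. LINT t|\<mu>. norm (case (s, t) of (s, t) \<Rightarrow> A s t * B t s)) \<in> borel_measurable \<mu>"
      by simp
    show "AE s in \<mu>. norm (LINT t|\<mu>. norm (case (s, t) of (s, t) \<Rightarrow> A s t * B t s))
        \<le> norm (K * K' * (LINT u|\<mu>. (w u)\<^sup>2) * (w s)\<^sup>2)"
    proof (rule AE_I2)
      fix s assume s: "s \<in> space \<mu>"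
      have "(LINT t|\<mu>. cmod (A s t * B t s)) \<le> (LINT t|\<mu>. K * K' * (w s * w s) * (w t)\<^sup>2)"
        using dom_kernel_prod_bound[OF w A B s s] kcomp_integrable[OF w A B s s] w
        by (intro integral_mono) (auto simp: power2_eq_square weight_def)
      also have "\<dots> \<le> norm (K * K' * (LINT u|\<mu>. (w u)\<^sup>2) * (w s)\<^sup>2)"
        unfolding integral_mult_right_zero power2_eq_square[of "w s"] by (simp add: algebra_simps)
      finally show "norm (LINT t|\<mu>. norm (case (s, t) of (s, t) \<Rightarrow> A s t * B t s))
          \<le> norm (K * K' * (LINT u|\<mu>. (w u)\<^sup>2) * (w s)\<^sup>2)"
        by simp
    qed
  qed
qed

lemma ktrace_kcomp_commute:
  assumes w: "weight \<mu> w" and A: "dom_kernel \<mu> w K A" and B: "dom_kernel \<mu> w K' B"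
  shows "ktrace \<mu> (kcomp \<mu> A B) = ktrace \<mu> (kcomp \<mu> B A)"
  using pair.Fubini_integral[OF dom_kernel_pair_integrable[OF w A B]]
  by (simp add: ktrace_def kcomp_def mult.commute)

lemma kcomp_assoc:
  assumes w: "weight \<mu> w" and A: "dom_kernel \<mu> w K A" and B: "dom_kernel \<mu> w K' B" and C: "dom_kernel \<mu> w K'' C"
    and s: "s \<in> space \<mu>" and t: "t \<in> space \<mu>"
  shows "kcomp \<mu> (kcomp \<mu> A B) C s t = kcomp \<mu> A (kcomp \<mu> B C) s t"
proof -
  have [measurable]: "w \<in> borel_measurable \<mu>" using w by (simp add: weight_def)
  \<comment> \<open>With \<open>s\<close> and \<open>t\<close> frozen, the two outer factors form a
    kernel in \<open>(u, v)\<close> with the same weight and constant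
    \<open>K * K'' * (w s * w t)\<close>; associativity then becomes the two-fold exchange already
    available.\<close>
  let ?A = "\<lambda>u v. A s v * C u t"
  have A': "dom_kernel \<mu> w (K * K'' * (w s * w t)) ?A"
    unfolding dom_kernel_def
  proof (intro conjI ballI)
    show "0 \<le> K * K'' * (w s * w t)" using A C w by (auto simp: dom_kernel_def weight_def)
    show "(\<lambda>(u, v). A s v * C u t) \<in> borel_measurable (\<mu> \<Otimes>\<^sub>M \<mu>)"
      unfolding split_beta' using s t
      by (intro borel_measurable_times dom_kernel_measurable[OF A] dom_kernel_measurable[OF C]) measurable
    show "cmod (A s v * C u t) \<le> K * K'' * (w s * w t) * (w u * w v)" if "u \<in> space \<mu>" "v \<in> space \<mu>" for u v
      using dom_kernel_prod_bound[OF w A C s t that(2,1)] by (simp add: mult.commute)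
  qed
  have "kcomp \<mu> (kcomp \<mu> A B) C s t = (LINT u|\<mu>. LINT v|\<mu>. A s v * C u t * B v u)"
    unfolding kcomp_def
    by (intro Bochner_Integration.integral_cong refl) (simp add: algebra_simps flip: integral_mult_left_zero integral_mult_right_zero)
  also have "\<dots> = (LINT v|\<mu>. LINT u|\<mu>. A s v * C u t * B v u)"
    using pair.Fubini_integral[OF dom_kernel_pair_integrable[OF w A' B]] by simp
  also have "\<dots> = kcomp \<mu> A (kcomp \<mu> B C) s t"
    unfolding kcomp_def
    by (intro Bochner_Integration.integral_cong refl) (simp add: algebra_simps flip: integral_mult_left_zero integral_mult_right_zero)
  finally show ?thesis .
qed

end

subsection \<open>Convergence of dominated kernels\<close>

text \<open>Convergence of the squared norms is included because it is what turns the weights into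
  admissible majorants for \<open>integral_pratt_convergence\<close>.\<close>

definition weight_tendsto :: "'t measure \<Rightarrow> (nat \<Rightarrow> 't \<Rightarrow> real) \<Rightarrow> ('t \<Rightarrow> real) \<Rightarrow> bool" where
  "weight_tendsto \<mu> w w' \<longleftrightarrow> (\<forall>n. weight \<mu> (w n)) \<and> weight \<mu> w' \<and>
     (AE t in \<mu>. (\<lambda>n. w n t) \<longlonglongrightarrow> w' t) \<and>
     (\<lambda>n. LINT t|\<mu>. (w n t)\<^sup>2) \<longlonglongrightarrow> (LINT t|\<mu>. (w' t)\<^sup>2)"

text \<open>The constant \<open>K\<close> is common to all \<open>n\<close>. Rows and columns are
  both required, since a composition integrates a row of the first kernel against a column of the
  second, and in this form the property is inherited by compositions.\<close>

definition kernel_tendsto ::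
  "'t measure \<Rightarrow> (nat \<Rightarrow> 't \<Rightarrow> real) \<Rightarrow> ('t \<Rightarrow> real) \<Rightarrow> (nat \<Rightarrow> 't \<Rightarrow> 't \<Rightarrow> complex) \<Rightarrow> ('t \<Rightarrow> 't \<Rightarrow> complex) \<Rightarrow> bool"
where
  "kernel_tendsto \<mu> w w' A A' \<longleftrightarrow>
     (\<exists>K. (\<forall>n. dom_kernel \<mu> (w n) K (A n)) \<and> dom_kernel \<mu> w' K A') \<and>
     (AE s in \<mu>. AE t in \<mu>. (\<lambda>n. A n s t) \<longlonglongrightarrow> A' s t) \<and>
     (AE s in \<mu>. AE t in \<mu>. (\<lambda>n. A n t s) \<longlonglongrightarrow> A' t s)"

context sfm
begin

lemma kcomp_tendsto_pointwise:
  assumes w: "weight_tendsto \<mu> w w'"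
    and A: "\<And>n. dom_kernel \<mu> (w n) K (A n)" "dom_kernel \<mu> w' K A'"
    and B: "\<And>n. dom_kernel \<mu> (w n) K' (B n)" "dom_kernel \<mu> w' K' B'"
    and st: "s \<in> space \<mu>" "t \<in> space \<mu>"
    and ws: "(\<lambda>n. w n s) \<longlonglongrightarrow> w' s" and wt: "(\<lambda>n. w n t) \<longlonglongrightarrow> w' t"
    and As: "AE u in \<mu>. (\<lambda>n. A n s u) \<longlonglongrightarrow> A' s u" and Bt: "AE u in \<mu>. (\<lambda>n. B n u t) \<longlonglongrightarrow> B' u t"
  shows "(\<lambda>n. kcomp \<mu> (A n) (B n) s t) \<longlonglongrightarrow> kcomp \<mu> A' B' s t"
  unfolding kcomp_def
proof (rule integral_pratt_convergence[where g = "\<lambda>n u. K * K' * (w n s * w n t) * (w n u)\<^sup>2"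
      and g' = "\<lambda>u. K * K' * (w' s * w' t) * (w' u)\<^sup>2"])
  have wn: "weight \<mu> (w n)" "weight \<mu> w'" for n using w by (auto simp: weight_tendsto_def)
  show "(\<lambda>u. A n s u * B n u t) \<in> borel_measurable \<mu>" for n
    using kcomp_integrable[OF wn(1) A(1) B(1) st] by auto
  show "(\<lambda>u. A' s u * B' u t) \<in> borel_measurable \<mu>"
    using kcomp_integrable[OF wn(2) A(2) B(2) st] by auto
  show "integrable \<mu> (\<lambda>u. K * K' * (w n s * w n t) * (w n u)\<^sup>2)" for n
    using wn(1)[of n] by (simp add: weight_def)
  show "integrable \<mu> (\<lambda>u. K * K' * (w' s * w' t) * (w' u)\<^sup>2)"
    using wn(2) by (simp add: weight_def)
  show "AE u in \<mu>. (\<lambda>n. A n s u * B n u t) \<longlonglongrightarrow> A' s u * B' u t"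
    using As Bt by eventually_elim (rule tendsto_mult)
  have "AE u in \<mu>. (\<lambda>n. w n u) \<longlonglongrightarrow> w' u" using w by (simp add: weight_tendsto_def)
  then show "AE u in \<mu>. (\<lambda>n. K * K' * (w n s * w n t) * (w n u)\<^sup>2) \<longlonglongrightarrow> K * K' * (w' s * w' t) * (w' u)\<^sup>2"
    by eventually_elim (intro tendsto_intros ws wt)
  show "norm (A n s u * B n u t) \<le> K * K' * (w n s * w n t) * (w n u)\<^sup>2" if "u \<in> space \<mu>" for n u
    using dom_kernel_prod_bound[OF wn(1) A(1) B(1) st that that] by (simp add: power2_eq_square)
  have "(\<lambda>n. LINT t|\<mu>. (w n t)\<^sup>2) \<longlonglongrightarrow> (LINT t|\<mu>. (w' t)\<^sup>2)" using w by (simp add: weight_tendsto_def)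
  then show "(\<lambda>n. LINT u|\<mu>. K * K' * (w n s * w n t) * (w n u)\<^sup>2) \<longlonglongrightarrow> (LINT u|\<mu>. K * K' * (w' s * w' t) * (w' u)\<^sup>2)"
    unfolding integral_mult_right_zero by (intro tendsto_intros ws wt)
qed

lemma kernel_tendsto_kcomp:
  assumes w: "weight_tendsto \<mu> w w'" and A: "kernel_tendsto \<mu> w w' A A'" and B: "kernel_tendsto \<mu> w w' B B'"
  shows "kernel_tendsto \<mu> w w' (\<lambda>n. kcomp \<mu> (A n) (B n)) (kcomp \<mu> A' B')"
proof -
  have wn: "weight \<mu> (w n)" "weight \<mu> w'" for n using w by (auto simp: weight_tendsto_def)
  obtain K where K: "\<And>n. dom_kernel \<mu> (w n) K (A n)" "dom_kernel \<mu> w' K A'"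
    using A by (auto simp: kernel_tendsto_def)
  obtain K' where K': "\<And>n. dom_kernel \<mu> (w n) K' (B n)" "dom_kernel \<mu> w' K' B'"
    using B by (auto simp: kernel_tendsto_def)
  have lim: "(\<lambda>n. LINT t|\<mu>. (w n t)\<^sup>2) \<longlonglongrightarrow> (LINT t|\<mu>. (w' t)\<^sup>2)" using w by (simp add: weight_tendsto_def)
  \<comment> \<open>Convergent norms are bounded, which yields a domination constant independent of
    \<open>n\<close>; the limit kernel is included through the maximum \<open>b'\<close>.\<close>
  from convergent_imp_Bseq[OF convergentI[OF lim]]
  obtain b where b: "\<And>n. norm (LINT t|\<mu>. (w n t)\<^sup>2) \<le> b" by (auto simp: Bseq_def)
  define b' where "b' = max b (LINT t|\<mu>. (w' t)\<^sup>2)"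
  have nonneg: "0 \<le> K * K'" using K(2) K'(2) by (simp add: dom_kernel_def)
  have "dom_kernel \<mu> (w n) (K * K' * b') (kcomp \<mu> (A n) (B n))" for n
  proof (rule dom_kernel_mono[OF dom_kernel_kcomp[OF wn(1) K(1) K'(1)] _ wn(1)])
    show "K * K' * (LINT u|\<mu>. (w n u)\<^sup>2) \<le> K * K' * b'"
      using nonneg b[of n] by (intro mult_left_mono) (auto simp: b'_def)
  qed
  moreover have "dom_kernel \<mu> w' (K * K' * b') (kcomp \<mu> A' B')"
  proof (rule dom_kernel_mono[OF dom_kernel_kcomp[OF wn(2) K(2) K'(2)] _ wn(2)])
    show "K * K' * (LINT u|\<mu>. (w' u)\<^sup>2) \<le> K * K' * b'"
      using nonneg by (intro mult_left_mono) (auto simp: b'_def)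
  qed
  moreover have wc: "AE s in \<mu>. (\<lambda>n. w n s) \<longlonglongrightarrow> w' s" using w by (simp add: weight_tendsto_def)
  have A1: "AE s in \<mu>. AE u in \<mu>. (\<lambda>n. A n s u) \<longlonglongrightarrow> A' s u"
    using A by (auto simp: kernel_tendsto_def)
  have B2: "AE s in \<mu>. AE u in \<mu>. (\<lambda>n. B n u s) \<longlonglongrightarrow> B' u s"
    using B by (auto simp: kernel_tendsto_def)
  have "AE s in \<mu>. AE t in \<mu>. (\<lambda>n. kcomp \<mu> (A n) (B n) s t) \<longlonglongrightarrow> kcomp \<mu> A' B' s t"
    using A1 wc AE_space
  proof eventually_elim
    case s: (elim s)
    show ?case
      using B2 wc AE_space
    proof eventually_elim
      case t: (elim t)
      show ?case by (rule kcomp_tendsto_pointwise[OF w K K' s(3) t(3) s(2) t(2) s(1) t(1)])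
    qed
  qed
  moreover have "AE s in \<mu>. AE t in \<mu>. (\<lambda>n. kcomp \<mu> (A n) (B n) t s) \<longlonglongrightarrow> kcomp \<mu> A' B' t s"
    using B2 wc AE_space
  proof eventually_elim
    case s: (elim s)
    show ?case
      using A1 wc AE_space
    proof eventually_elim
      case t: (elim t)
      show ?case by (rule kcomp_tendsto_pointwise[OF w K K' t(3) s(3) t(2) s(2) t(1) s(1)])
    qed
  qed
  ultimately show ?thesis unfolding kernel_tendsto_def by blast
qed

text \<open>Diagonal convergence is a premise of its own, because almost everywhere convergence of
  rows and columns can miss the diagonal.\<close>

lemma ktrace_tendsto:
  assumes w: "weight_tendsto \<mu> w w'" and A: "\<And>n. dom_kernel \<mu> (w n) K (A n)" "dom_kernel \<mu> w' K A'"
    and lim: "AE t in \<mu>. (\<lambda>n. A n t t) \<longlonglongrightarrow> A' t t"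
  shows "(\<lambda>n. ktrace \<mu> (A n)) \<longlonglongrightarrow> ktrace \<mu> A'"
  unfolding ktrace_def
proof (rule integral_pratt_convergence[where g = "\<lambda>n t. K * (w n t)\<^sup>2" and g' = "\<lambda>t. K * (w' t)\<^sup>2"])
  have wn: "weight \<mu> (w n)" "weight \<mu> w'" for n using w by (auto simp: weight_tendsto_def)
  show "(\<lambda>t. A n t t) \<in> borel_measurable \<mu>" for n using ktrace_integrable[OF wn(1) A(1)] by auto
  show "(\<lambda>t. A' t t) \<in> borel_measurable \<mu>" using ktrace_integrable[OF wn(2) A(2)] by auto
  show "integrable \<mu> (\<lambda>t. K * (w n t)\<^sup>2)" for n using wn(1)[of n] by (simp add: weight_def)
  show "integrable \<mu> (\<lambda>t. K * (w' t)\<^sup>2)" using wn(2) by (simp add: weight_def)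
  have "AE t in \<mu>. (\<lambda>n. w n t) \<longlonglongrightarrow> w' t" using w by (simp add: weight_tendsto_def)
  then show "AE t in \<mu>. (\<lambda>n. K * (w n t)\<^sup>2) \<longlonglongrightarrow> K * (w' t)\<^sup>2"
    by eventually_elim (intro tendsto_intros)
  show "norm (A n t t) \<le> K * (w n t)\<^sup>2" if "t \<in> space \<mu>" for n t
    using A(1)[of n] that by (simp add: dom_kernel_def power2_eq_square)
  have "(\<lambda>n. LINT t|\<mu>. (w n t)\<^sup>2) \<longlonglongrightarrow> (LINT t|\<mu>. (w' t)\<^sup>2)" using w by (simp add: weight_tendsto_def)
  then show "(\<lambda>n. LINT t|\<mu>. K * (w n t)\<^sup>2) \<longlonglongrightarrow> (LINT t|\<mu>. K * (w' t)\<^sup>2)"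
    unfolding integral_mult_right_zero by (intro tendsto_intros)
qed (rule lim)

text \<open>For a composition the diagonal takes care of itself: the value at \<open>(s, s)\<close>
  uses only the row and the column through \<open>s\<close>, and these converge for almost every
  \<open>s\<close>.\<close>

lemma ktrace_kcomp_tendsto:
  assumes w: "weight_tendsto \<mu> w w'" and A: "kernel_tendsto \<mu> w w' A A'" and B: "kernel_tendsto \<mu> w w' B B'"
  shows "(\<lambda>n. ktrace \<mu> (kcomp \<mu> (A n) (B n))) \<longlonglongrightarrow> ktrace \<mu> (kcomp \<mu> A' B')"
proof -
  obtain K where K: "\<And>n. dom_kernel \<mu> (w n) K (A n)" "dom_kernel \<mu> w' K A'"
    using A by (auto simp: kernel_tendsto_def)
  obtain K' where K': "\<And>n. dom_kernel \<mu> (w n) K' (B n)" "dom_kernel \<mu> w' K' B'"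
    using B by (auto simp: kernel_tendsto_def)
  obtain L where L: "\<And>n. dom_kernel \<mu> (w n) L (kcomp \<mu> (A n) (B n))" "dom_kernel \<mu> w' L (kcomp \<mu> A' B')"
    using kernel_tendsto_kcomp[OF w A B] by (auto simp: kernel_tendsto_def)
  have wc: "AE s in \<mu>. (\<lambda>n. w n s) \<longlonglongrightarrow> w' s" using w by (simp add: weight_tendsto_def)
  have A1: "AE s in \<mu>. AE u in \<mu>. (\<lambda>n. A n s u) \<longlonglongrightarrow> A' s u"
    using A by (auto simp: kernel_tendsto_def)
  have B2: "AE s in \<mu>. AE u in \<mu>. (\<lambda>n. B n u s) \<longlonglongrightarrow> B' u s"
    using B by (auto simp: kernel_tendsto_def)
  show ?thesis
  proof (rule ktrace_tendsto[OF w L])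
    show "AE s in \<mu>. (\<lambda>n. kcomp \<mu> (A n) (B n) s s) \<longlonglongrightarrow> kcomp \<mu> A' B' s s"
      using A1 B2 wc AE_space
      by eventually_elim (rule kcomp_tendsto_pointwise[OF w K K'])
  qed
qed

end

subsection \<open>The Hartley transform of a kernel\<close>

text \<open>If \<open>G\<close> is a field with covariance kernel \<open>A\<close> and \<open>G (\<sigma> t) = cnj (G t)\<close>, then \<open>hartley \<sigma> A\<close> is
  the covariance kernel of the real field \<open>Re G + Im G\<close>.\<close>

definition hartley :: "('t \<Rightarrow> 't) \<Rightarrow> ('t \<Rightarrow> 't \<Rightarrow> complex) \<Rightarrow> 't \<Rightarrow> 't \<Rightarrow> complex" where
  "hartley \<sigma> A s t = (A s t + A (\<sigma> s) (\<sigma> t)) / 2 + \<i> / 2 * (A (\<sigma> s) t - A s (\<sigma> t))"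

lemma (in sfm) weight_product_integrable:
  fixes a b :: "'t \<Rightarrow> complex"
  assumes w: "weight \<mu> w" and [measurable]: "a \<in> borel_measurable \<mu>" "b \<in> borel_measurable \<mu>"
    and a: "\<And>u. u \<in> space \<mu> \<Longrightarrow> cmod (a u) \<le> k * w u" and b: "\<And>u. u \<in> space \<mu> \<Longrightarrow> cmod (b u) \<le> l * w u"
  shows "integrable \<mu> (\<lambda>u. a u * b u)"
proof (rule Bochner_Integration.integrable_bound)
  show "integrable \<mu> (\<lambda>u. k * l * (w u)\<^sup>2)" using w by (simp add: weight_def)
  show "AE u in \<mu>. norm (a u * b u) \<le> norm (k * l * (w u)\<^sup>2)"
  proof (rule AE_I2)
    fix u assume u: "u \<in> space \<mu>"
    have "norm (a u * b u) \<le> (k * w u) * (l * w u)"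
      unfolding norm_mult using a[OF u] b[OF u] by (intro mult_mono) (auto intro: order_trans[OF norm_ge_zero])
    also have "\<dots> \<le> norm (k * l * (w u)\<^sup>2)" by (simp add: power2_eq_square algebra_simps)
    finally show "norm (a u * b u) \<le> norm (k * l * (w u)\<^sup>2)" .
  qed
qed simp

locale symmetric_sfm = sfm \<mu> for \<mu> :: "'t measure" +
  fixes \<sigma> :: "'t \<Rightarrow> 't" and w :: "'t \<Rightarrow> real"
  assumes \<sigma>[measurable]: "\<sigma> \<in> measurable \<mu> \<mu>" and distr_\<sigma>: "distr \<mu> \<mu> \<sigma> = \<mu>"
    and \<sigma>_\<sigma>: "\<And>t. t \<in> space \<mu> \<Longrightarrow> \<sigma> (\<sigma> t) = t"
    and w: "weight \<mu> w" and w_\<sigma>: "\<And>t. t \<in> space \<mu> \<Longrightarrow> w (\<sigma> t) = w t"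
begin

lemma \<sigma>_space: "t \<in> space \<mu> \<Longrightarrow> \<sigma> t \<in> space \<mu>"
  using measurable_space[OF \<sigma>] .

lemma w_measurable[measurable]: "w \<in> borel_measurable \<mu>"
  using w by (simp add: weight_def)

lemma integral_reflect:
  fixes f :: "'t \<Rightarrow> 'b::{banach, second_countable_topology}"
  assumes "f \<in> borel_measurable \<mu>"
  shows "(LINT t|\<mu>. f (\<sigma> t)) = (LINT t|\<mu>. f t)"
  using integral_distr[OF \<sigma> assms] by (simp add: distr_\<sigma>)

lemma integrable_reflect:
  fixes f :: "'t \<Rightarrow> 'b::{banach, second_countable_topology}"
  assumes "integrable \<mu> f"
  shows "integrable \<mu> (\<lambda>t. f (\<sigma> t))"
  using integrable_distr_eq[OF \<sigma>, of f] assms by (simp add: distr_\<sigma>)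

lemma dom_kernel_hartley:
  assumes A: "dom_kernel \<mu> w K A"
  shows "dom_kernel \<mu> w (2 * K) (hartley \<sigma> A)"
  unfolding dom_kernel_def
proof (intro conjI ballI)
  have "(\<lambda>x. hartley \<sigma> A (fst x) (snd x)) \<in> borel_measurable (\<mu> \<Otimes>\<^sub>M \<mu>)"
    unfolding hartley_def
    by (intro borel_measurable_add borel_measurable_diff borel_measurable_times borel_measurable_divide
        borel_measurable_const dom_kernel_measurable[OF A]) measurable
  then show "(\<lambda>(s, t). hartley \<sigma> A s t) \<in> borel_measurable (\<mu> \<Otimes>\<^sub>M \<mu>)" by (simp add: split_beta')
  fix s t assume st: "s \<in> space \<mu>" "t \<in> space \<mu>"
  have *: "cmod (A x y) \<le> K * (w s * w t)" if "x \<in> {s, \<sigma> s}" "y \<in> {t, \<sigma> t}" for x y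
    using dom_kernelD[OF A, of x y] st that \<sigma>_space w_\<sigma> by auto
  have "cmod (hartley \<sigma> A s t) \<le> (cmod (A s t) + cmod (A (\<sigma> s) (\<sigma> t))) / 2 + 1 / 2 * (cmod (A (\<sigma> s) t) + cmod (A s (\<sigma> t)))"
    unfolding hartley_def
    by (intro order_trans[OF norm_triangle_ineq] add_mono) (auto simp: norm_divide norm_mult norm_triangle_ineq norm_triangle_ineq4)
  also have "\<dots> \<le> 2 * K * (w s * w t)"
  proof -
    have "cmod (A s t) \<le> K * (w s * w t)" "cmod (A (\<sigma> s) (\<sigma> t)) \<le> K * (w s * w t)"
      "cmod (A (\<sigma> s) t) \<le> K * (w s * w t)" "cmod (A s (\<sigma> t)) \<le> K * (w s * w t)"
      by (rule *; simp)+
    moreover have "(a + b) / 2 + 1 / 2 * (c + e) \<le> 2 * x" if "a \<le> x" "b \<le> x" "c \<le> x" "e \<le> x" for a b c e x :: real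
      using that by (simp add: field_simps)
    ultimately show ?thesis unfolding mult.assoc[of 2] by blast
  qed
  finally show "cmod (hartley \<sigma> A s t) \<le> 2 * K * (w s * w t)" .
qed (use A in \<open>simp add: dom_kernel_def\<close>)

text \<open>Let \<open>R\<close> be the reflection and \<open>U\<close> the operator \<alpha> I +
  cnj \<alpha> R, with adjoint cnj \<alpha> I + \<alpha> R. The claim is that \<open>U\<close> is
  unitary: the modulus of \<alpha> squared is one half, so the two direct terms add up to one, and
  the square of \<alpha> is purely imaginary, so the mixed terms cancel.\<close>

lemma integral_hartley_product:
  fixes a b :: "'t \<Rightarrow> complex"
  defines "\<alpha> \<equiv> (1 - \<i>) / 2"
  assumes [measurable]: "a \<in> borel_measurable \<mu>" "b \<in> borel_measurable \<mu>"
    and a: "\<And>u. u \<in> space \<mu> \<Longrightarrow> cmod (a u) \<le> k * w u" and b: "\<And>u. u \<in> space \<mu> \<Longrightarrow> cmod (b u) \<le> l * w u"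
  shows "(LINT u|\<mu>. (cnj \<alpha> * a u + \<alpha> * a (\<sigma> u)) * (\<alpha> * b u + cnj \<alpha> * b (\<sigma> u))) = (LINT u|\<mu>. a u * b u)"
proof -
  have \<sigma>a: "cmod (a (\<sigma> u)) \<le> k * w u" and \<sigma>b: "cmod (b (\<sigma> u)) \<le> l * w u" if "u \<in> space \<mu>" for u
    using a[OF \<sigma>_space[OF that]] b[OF \<sigma>_space[OF that]] w_\<sigma>[OF that] by auto
  have int: "integrable \<mu> (\<lambda>u. a u * b u)" "integrable \<mu> (\<lambda>u. a (\<sigma> u) * b u)"
    "integrable \<mu> (\<lambda>u. a u * b (\<sigma> u))" "integrable \<mu> (\<lambda>u. a (\<sigma> u) * b (\<sigma> u))"
    by (auto intro!: weight_product_integrable[OF w, where k = k and l = l] a b \<sigma>a \<sigma>b)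
  have 1: "(LINT u|\<mu>. a (\<sigma> u) * b (\<sigma> u)) = (LINT u|\<mu>. a u * b u)"
    by (rule integral_reflect) measurable
  have "(LINT u|\<mu>. a (\<sigma> u) * b u) = (LINT u|\<mu>. a (\<sigma> u) * b (\<sigma> (\<sigma> u)))"
    by (intro Bochner_Integration.integral_cong refl) (simp add: \<sigma>_\<sigma>)
  also have "\<dots> = (LINT u|\<mu>. a u * b (\<sigma> u))"
    by (rule integral_reflect) measurable
  finally have 2: "(LINT u|\<mu>. a (\<sigma> u) * b u) = (LINT u|\<mu>. a u * b (\<sigma> u))" .
  have "(LINT u|\<mu>. (cnj \<alpha> * a u + \<alpha> * a (\<sigma> u)) * (\<alpha> * b u + cnj \<alpha> * b (\<sigma> u)))
    = (LINT u|\<mu>. (\<alpha> * cnj \<alpha>) * (a u * b u) + (cnj \<alpha>)\<^sup>2 * (a u * b (\<sigma> u)) + \<alpha>\<^sup>2 * (a (\<sigma> u) * b u) + (\<alpha> * cnj \<alpha>) * (a (\<sigma> u) * b (\<sigma> u)))"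
    by (simp add: algebra_simps power2_eq_square)
  also have "\<dots> = (\<alpha> * cnj \<alpha>) * (LINT u|\<mu>. a u * b u) + (cnj \<alpha>)\<^sup>2 * (LINT u|\<mu>. a u * b (\<sigma> u))
     + \<alpha>\<^sup>2 * (LINT u|\<mu>. a (\<sigma> u) * b u) + (\<alpha> * cnj \<alpha>) * (LINT u|\<mu>. a (\<sigma> u) * b (\<sigma> u))"
    using int by simp
  also have "\<dots> = 2 * (\<alpha> * cnj \<alpha>) * (LINT u|\<mu>. a u * b u) + (\<alpha>\<^sup>2 + (cnj \<alpha>)\<^sup>2) * (LINT u|\<mu>. a u * b (\<sigma> u))"
    unfolding 1 2 by (simp add: algebra_simps)
  also have "2 * (\<alpha> * cnj \<alpha>) = 1"
    by (simp add: \<alpha>_def complex_eq_iff)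
  also have "\<alpha>\<^sup>2 + (cnj \<alpha>)\<^sup>2 = 0"
    by (simp add: \<alpha>_def power2_eq_square complex_eq_iff)
  finally show ?thesis by simp
qed

text \<open>\<open>hartley\<close> is conjugation of the integral operator by the unitary
  \<open>U\<close> of the preceding lemma, and conjugation is multiplicative.\<close>

lemma kcomp_hartley:
  assumes A: "dom_kernel \<mu> w K A" and B: "dom_kernel \<mu> w K' B" and st: "s \<in> space \<mu>" "t \<in> space \<mu>"
  shows "kcomp \<mu> (hartley \<sigma> A) (hartley \<sigma> B) s t = hartley \<sigma> (kcomp \<mu> A B) s t"
proof -
  define \<alpha> where "\<alpha> = (1 - \<i>) / 2"
  \<comment> \<open>\<open>a\<close> is the row at \<open>s\<close> after the transform in the first
    variable, \<open>b\<close> the column at \<open>t\<close> after the transform in the second. The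
    transforms in the inner variable \<open>u\<close> are the ones that cancel.\<close>
  define a where "a u = \<alpha> * A s u + cnj \<alpha> * A (\<sigma> s) u" for u
  define b where "b u = cnj \<alpha> * B u t + \<alpha> * B u (\<sigma> t)" for u
  have \<alpha>: "\<alpha> * cnj \<alpha> = 1 / 2" "\<alpha> * \<alpha> = - \<i> / 2" "cnj \<alpha> * cnj \<alpha> = \<i> / 2"
    by (auto simp: \<alpha>_def complex_eq_iff)
  have "cmod \<alpha> \<le> 1"
    using norm_triangle_ineq4[of 1 \<i>] by (simp add: \<alpha>_def norm_divide)
  have hA: "hartley \<sigma> A s u = cnj \<alpha> * a u + \<alpha> * a (\<sigma> u)" for u
  proof -
    have "cnj \<alpha> * a u + \<alpha> * a (\<sigma> u) = (\<alpha> * cnj \<alpha>) * (A s u + A (\<sigma> s) (\<sigma> u)) + (cnj \<alpha> * cnj \<alpha>) * A (\<sigma> s) u + (\<alpha> * \<alpha>) * A s (\<sigma> u)"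
      by (simp add: a_def algebra_simps)
    then show ?thesis unfolding \<alpha> hartley_def by (simp add: algebra_simps)
  qed
  have hB: "hartley \<sigma> B u t = \<alpha> * b u + cnj \<alpha> * b (\<sigma> u)" for u
  proof -
    have "\<alpha> * b u + cnj \<alpha> * b (\<sigma> u) = (\<alpha> * cnj \<alpha>) * (B u t + B (\<sigma> u) (\<sigma> t)) + (cnj \<alpha> * cnj \<alpha>) * B (\<sigma> u) t + (\<alpha> * \<alpha>) * B u (\<sigma> t)"
      by (simp add: b_def algebra_simps)
    then show ?thesis unfolding \<alpha> hartley_def by (simp add: algebra_simps)
  qed
  have st': "\<sigma> s \<in> space \<mu>" "\<sigma> t \<in> space \<mu>" using st \<sigma>_space by auto
  have [measurable]: "a \<in> borel_measurable \<mu>" "b \<in> borel_measurable \<mu>"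
    using st st' unfolding a_def[abs_def] b_def[abs_def]
    by (auto intro!: borel_measurable_add borel_measurable_times dom_kernel_measurable[OF A] dom_kernel_measurable[OF B])
  have norm2: "cmod (x * p + y * q) \<le> 2 * r" if "cmod x \<le> 1" "cmod y \<le> 1" "cmod p \<le> r" "cmod q \<le> r" for x y p q r
  proof -
    have "cmod x * cmod p \<le> 1 * r" "cmod y * cmod q \<le> 1 * r"
      using that by (intro mult_mono; auto intro: order_trans[OF norm_ge_zero])+
    then show ?thesis using norm_triangle_ineq[of "x * p" "y * q"] by (simp add: norm_mult)
  qed
  have a: "cmod (a u) \<le> 2 * (K * w s) * w u" and b: "cmod (b u) \<le> 2 * (K' * w t) * w u" if u: "u \<in> space \<mu>" for u
  proof -
    have "cmod (A s u) \<le> K * w s * w u" "cmod (A (\<sigma> s) u) \<le> K * w s * w u"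
      "cmod (B u t) \<le> K' * w t * w u" "cmod (B u (\<sigma> t)) \<le> K' * w t * w u"
      using dom_kernelD[OF A st(1) u] dom_kernelD[OF A st'(1) u] dom_kernelD[OF B u st(2)] dom_kernelD[OF B u st'(2)]
        w_\<sigma>[OF st(1)] w_\<sigma>[OF st(2)] by (simp_all add: mult_ac)
    then show "cmod (a u) \<le> 2 * (K * w s) * w u" "cmod (b u) \<le> 2 * (K' * w t) * w u"
      using norm2 \<open>cmod \<alpha> \<le> 1\<close> by (auto simp: a_def b_def mult.assoc)
  qed
  have "kcomp \<mu> (hartley \<sigma> A) (hartley \<sigma> B) s t = (LINT u|\<mu>. a u * b u)"
    unfolding kcomp_def hA hB \<alpha>_def
    by (rule integral_hartley_product[OF _ _ a b]) measurable
  also have "\<dots> = (LINT u|\<mu>. (\<alpha> * cnj \<alpha>) * (A s u * B u t) + (\<alpha> * \<alpha>) * (A s u * B u (\<sigma> t))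
      + (cnj \<alpha> * cnj \<alpha>) * (A (\<sigma> s) u * B u t) + (\<alpha> * cnj \<alpha>) * (A (\<sigma> s) u * B u (\<sigma> t)))"
    by (simp add: a_def b_def algebra_simps)
  also have "\<dots> = (\<alpha> * cnj \<alpha>) * kcomp \<mu> A B s t + (\<alpha> * \<alpha>) * kcomp \<mu> A B s (\<sigma> t)
      + (cnj \<alpha> * cnj \<alpha>) * kcomp \<mu> A B (\<sigma> s) t + (\<alpha> * cnj \<alpha>) * kcomp \<mu> A B (\<sigma> s) (\<sigma> t)"
    unfolding kcomp_def using kcomp_integrable[OF w A B] st st' by simp
  also have "\<dots> = hartley \<sigma> (kcomp \<mu> A B) s t"
    unfolding \<alpha> hartley_def by (simp add: algebra_simps)
  finally show ?thesis .
qed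

text \<open>The two direct terms have equal integrals and the two mixed terms cancel, each time by
  the substitution of \<open>\<sigma> t\<close> for \<open>t\<close>.\<close>

lemma ktrace_hartley:
  assumes A: "dom_kernel \<mu> w K A"
  shows "ktrace \<mu> (hartley \<sigma> A) = ktrace \<mu> A"
proof -
  have [measurable]: "(\<lambda>t. A t t) \<in> borel_measurable \<mu>" "(\<lambda>t. A (\<sigma> t) t) \<in> borel_measurable \<mu>" "(\<lambda>t. A t (\<sigma> t)) \<in> borel_measurable \<mu>"
    by (rule dom_kernel_measurable[OF A]; measurable)+
  have int: "integrable \<mu> (\<lambda>t. A (\<sigma> t) t)"
  proof (rule Bochner_Integration.integrable_bound)
    show "integrable \<mu> (\<lambda>t. K * (w t)\<^sup>2)" using w by (simp add: weight_def)
    show "AE t in \<mu>. norm (A (\<sigma> t) t) \<le> norm (K * (w t)\<^sup>2)"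
      using A \<sigma>_space w_\<sigma>
      by (intro AE_I2) (fastforce simp: dom_kernel_def power2_eq_square intro: order_trans[OF _ abs_ge_self])
  qed simp
  have flip: "A t (\<sigma> t) = A (\<sigma> (\<sigma> t)) (\<sigma> t)" if "t \<in> space \<mu>" for t
    using that by (simp add: \<sigma>_\<sigma>)
  have int': "integrable \<mu> (\<lambda>t. A t (\<sigma> t))"
    using integrable_reflect[OF int] by (rule Bochner_Integration.integrable_cong[THEN iffD1, rotated 2]) (auto simp: flip)
  have eq: "(LINT t|\<mu>. A t (\<sigma> t)) = (LINT t|\<mu>. A (\<sigma> t) t)"
  proof -
    have "(LINT t|\<mu>. A t (\<sigma> t)) = (LINT t|\<mu>. A (\<sigma> (\<sigma> t)) (\<sigma> t))"
      by (intro Bochner_Integration.integral_cong refl flip)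
    also have "\<dots> = (LINT t|\<mu>. A (\<sigma> t) t)"
      by (rule integral_reflect) measurable
    finally show ?thesis .
  qed
  have "ktrace \<mu> (hartley \<sigma> A) = ((LINT t|\<mu>. A t t) + (LINT t|\<mu>. A (\<sigma> t) (\<sigma> t))) / 2
      + \<i> / 2 * ((LINT t|\<mu>. A (\<sigma> t) t) - (LINT t|\<mu>. A t (\<sigma> t)))"
    unfolding ktrace_def hartley_def
    using int int' ktrace_integrable[OF w A] integrable_reflect[OF ktrace_integrable[OF w A]] by simp
  also have "(LINT t|\<mu>. A (\<sigma> t) (\<sigma> t)) = (LINT t|\<mu>. A t t)"
    by (rule integral_reflect) measurable
  finally show ?thesis by (simp add: eq ktrace_def)
qed

end

subsection \<open>Product kernels\<close>

definition prod_kernel :: "'i set \<Rightarrow> ('i \<Rightarrow> 't \<Rightarrow> 't \<Rightarrow> complex) \<Rightarrow> ('i \<Rightarrow> 't) \<Rightarrow> ('i \<Rightarrow> 't) \<Rightarrow> complex" where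
  "prod_kernel S A s t = (\<Prod>i\<in>S. A i (s i) (t i))"

context product_sigma_finite
begin

lemma weight_prod:
  assumes "finite S" "\<And>i. i \<in> S \<Longrightarrow> weight (M i) (w i)"
  shows "weight (Pi\<^sub>M S M) (\<lambda>t. \<Prod>i\<in>S. w i (t i))"
  unfolding weight_def
proof (intro conjI allI)
  show "(\<lambda>t. \<Prod>i\<in>S. w i (t i)) \<in> borel_measurable (Pi\<^sub>M S M)"
    using assms(2) by (intro borel_measurable_prod measurable_compose[OF measurable_component_singleton]) (auto simp: weight_def)
  show "0 \<le> (\<Prod>i\<in>S. w i (t i))" for t
    using assms(2) by (intro prod_nonneg) (auto simp: weight_def)
  show "integrable (Pi\<^sub>M S M) (\<lambda>t. (\<Prod>i\<in>S. w i (t i))\<^sup>2)"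
    using assms product_integrable_prod[of S "\<lambda>i t. (w i t)\<^sup>2"] by (simp add: weight_def prod_power_distrib)
qed

lemma dom_kernel_prod:
  assumes "finite S" and w: "\<And>i. i \<in> S \<Longrightarrow> weight (M i) (w i)" and A: "\<And>i. i \<in> S \<Longrightarrow> dom_kernel (M i) (w i) (K i) (A i)"
  shows "dom_kernel (Pi\<^sub>M S M) (\<lambda>t. \<Prod>i\<in>S. w i (t i)) (\<Prod>i\<in>S. K i) (prod_kernel S A)"
  unfolding dom_kernel_def
proof (intro conjI ballI)
  show "0 \<le> (\<Prod>i\<in>S. K i)" using A by (intro prod_nonneg) (auto simp: dom_kernel_def)
  show "(\<lambda>(s, t). prod_kernel S A s t) \<in> borel_measurable (Pi\<^sub>M S M \<Otimes>\<^sub>M Pi\<^sub>M S M)"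
    unfolding prod_kernel_def split_beta'
    by (intro borel_measurable_prod dom_kernel_measurable[OF A] measurable_compose[OF measurable_fst]
        measurable_compose[OF measurable_snd] measurable_component_singleton) auto
  fix s t assume st: "s \<in> space (Pi\<^sub>M S M)" "t \<in> space (Pi\<^sub>M S M)"
  have "cmod (prod_kernel S A s t) = (\<Prod>i\<in>S. cmod (A i (s i) (t i)))"
    by (simp add: prod_kernel_def prod_norm)
  also have "\<dots> \<le> (\<Prod>i\<in>S. K i * (w i (s i) * w i (t i)))"
    using A st by (intro prod_mono) (auto simp: dom_kernel_def space_PiM PiE_iff)
  finally show "cmod (prod_kernel S A s t) \<le> (\<Prod>i\<in>S. K i) * ((\<Prod>i\<in>S. w i (s i)) * (\<Prod>i\<in>S. w i (t i)))"
    by (simp add: prod.distrib)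
qed

lemma sfm_component: "sfm (M i)"
  by (simp add: sfm_def sigma_finite_measures)

lemma kcomp_prod:
  assumes "finite S" and w: "\<And>i. i \<in> S \<Longrightarrow> weight (M i) (w i)"
    and A: "\<And>i. i \<in> S \<Longrightarrow> dom_kernel (M i) (w i) (K i) (A i)"
    and B: "\<And>i. i \<in> S \<Longrightarrow> dom_kernel (M i) (w i) (K' i) (B i)"
    and st: "s \<in> space (Pi\<^sub>M S M)" "t \<in> space (Pi\<^sub>M S M)"
  shows "kcomp (Pi\<^sub>M S M) (prod_kernel S A) (prod_kernel S B) s t = prod_kernel S (\<lambda>i. kcomp (M i) (A i) (B i)) s t"
proof -
  have "kcomp (Pi\<^sub>M S M) (prod_kernel S A) (prod_kernel S B) s t
    = (LINT u|Pi\<^sub>M S M. (\<Prod>i\<in>S. A i (s i) (u i) * B i (u i) (t i)))"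
    by (simp add: kcomp_def prod_kernel_def prod.distrib)
  also have "\<dots> = (\<Prod>i\<in>S. LINT u|M i. A i (s i) u * B i u (t i))"
    using assms(1) st
    by (intro product_integral_prod sfm.kcomp_integrable[OF sfm_component w A B]) (auto simp: space_PiM)
  finally show ?thesis by (simp add: prod_kernel_def kcomp_def)
qed

lemma ktrace_prod:
  assumes "finite S" and w: "\<And>i. i \<in> S \<Longrightarrow> weight (M i) (w i)"
    and A: "\<And>i. i \<in> S \<Longrightarrow> dom_kernel (M i) (w i) (K i) (A i)"
  shows "ktrace (Pi\<^sub>M S M) (prod_kernel S A) = (\<Prod>i\<in>S. ktrace (M i) (A i))"
  unfolding ktrace_def prod_kernel_def
  by (intro product_integral_prod assms(1) sfm.ktrace_integrable[OF sfm_component w A])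

end

section \<open>Moments of Gaussian families\<close>

text \<open>An iterated finite difference of the \<open>k\<close>-th power with steps
  \<open>y j\<close>. Each new element takes one more difference and lowers the degree by one, which
  is why the base point \<open>x\<close> and the exponent must vary in the induction.\<close>

lemma sum_alternating_subset_powers:
  fixes y :: "'i \<Rightarrow> real"
  assumes "finite A" "k \<le> card A"
  shows "(\<Sum>T\<in>Pow A. (- 1) ^ card (A - T) * (x + (\<Sum>j\<in>T. y j)) ^ k) =
    (if k = card A then fact k * (\<Prod>j\<in>A. y j) else 0)"
  using assms
proof (induction A arbitrary: k x rule: finite_induct)
  case empty
  then show ?case by simp
next
  case (insert a A)
  let ?s = "\<lambda>T. (- 1 :: real) ^ card (A - T)"
  have inj: "inj_on (insert a) (Pow A)"
    using insert.hyps by (auto simp: inj_on_def)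
  have fin: "finite T" if "T \<in> Pow A" for T
    using that insert.hyps finite_subset by auto
  have sgn1: "(- 1 :: real) ^ card (insert a A - T) = - ?s T" if "T \<in> Pow A" for T
  proof -
    have "insert a A - T = insert a (A - T)" using that insert.hyps by auto
    then show ?thesis using insert.hyps by simp
  qed
  have sgn2: "(- 1 :: real) ^ card (A - insert a T) = ?s T" if "T \<in> Pow A" for T
  proof -
    have "A - insert a T = A - T" using that insert.hyps by auto
    then show ?thesis by simp
  qed
  have sum2: "(\<Sum>j\<in>insert a T. y j) = y a + (\<Sum>j\<in>T. y j)" if "T \<in> Pow A" for T
    using that insert.hyps fin[OF that] by (subst sum.insert) auto
  have "(\<Sum>T\<in>Pow (insert a A). (- 1) ^ card (insert a A - T) * (x + (\<Sum>j\<in>T. y j)) ^ k)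
    = (\<Sum>T\<in>Pow A. (- 1) ^ card (insert a A - T) * (x + (\<Sum>j\<in>T. y j)) ^ k)
    + (\<Sum>T\<in>insert a ` Pow A. (- 1) ^ card (insert a A - T) * (x + (\<Sum>j\<in>T. y j)) ^ k)"
    unfolding Pow_insert using insert.hyps by (subst sum.union_disjoint) auto
  also have "\<dots> = (\<Sum>T\<in>Pow A. ?s T * ((x + (\<Sum>j\<in>T. y j)) + y a) ^ k) - (\<Sum>T\<in>Pow A. ?s T * (x + (\<Sum>j\<in>T. y j)) ^ k)"
    unfolding sum.reindex[OF inj] by (simp add: sgn1 sgn2 sum2 sum_negf algebra_simps)
  \<comment> \<open>The difference in direction \<open>y a\<close> cancels the top term
    \<open>i = k\<close> of the binomial expansion, so only exponents below \<open>k\<close>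
    remain.\<close>
  also have "\<dots> = (\<Sum>T\<in>Pow A. ?s T * (\<Sum>i<k. (k choose i) * (x + (\<Sum>j\<in>T. y j)) ^ i * y a ^ (k - i)))"
    unfolding sum_subtractf[symmetric] binomial_ring lessThan_Suc_atMost[symmetric]
    by (simp add: algebra_simps)
  also have "\<dots> = (\<Sum>i<k. (k choose i) * y a ^ (k - i) * (\<Sum>T\<in>Pow A. ?s T * (x + (\<Sum>j\<in>T. y j)) ^ i))"
    unfolding sum_distrib_left by (subst sum.swap) (simp add: algebra_simps)
  also have "\<dots> = (\<Sum>i<k. (k choose i) * y a ^ (k - i) * (if i = card A then fact i * (\<Prod>j\<in>A. y j) else 0))"
    using insert.prems insert.hyps by (intro sum.cong refl) (subst insert.IH, auto)
  also have "\<dots> = (if card A < k then (k choose card A) * y a ^ (k - card A) * (fact (card A) * (\<Prod>j\<in>A. y j)) else 0)"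
    by (subst if_distrib[where f = "(*) _"]) (simp add: if_distrib sum.delta cong: if_cong)
  also have "\<dots> = (if k = card (insert a A) then fact k * (\<Prod>j\<in>insert a A. y j) else 0)"
    using insert.prems insert.hyps by auto
  finally show ?case .
qed

text \<open>Stated as a recursion in the second moment rather than through a variance parameter, so
  that normal laws and the degenerate law at zero obey one formula.\<close>

lemma (in prob_space) gaussian_rv_moments:
  assumes g: "gaussian_rv M Y" and mean: "expectation Y = 0"
  shows "integrable M (\<lambda>\<omega>. Y \<omega> ^ k)"
    and "expectation (\<lambda>\<omega>. Y \<omega> ^ (k + 2)) = (k + 1) * expectation (\<lambda>\<omega>. (Y \<omega>)\<^sup>2) * expectation (\<lambda>\<omega>. Y \<omega> ^ k)"
proof -
  have [measurable]: "Y \<in> borel_measurable M" using g by (simp add: gaussian_rv_def)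
  from g consider (normal) m s where "0 < s" "distributed M lborel Y (normal_density m s)"
    | (const) c where "AE \<omega> in M. Y \<omega> = c"
    by (auto simp: gaussian_rv_def)
  then have "integrable M (\<lambda>\<omega>. Y \<omega> ^ k) \<and>
    expectation (\<lambda>\<omega>. Y \<omega> ^ (k + 2)) = (k + 1) * expectation (\<lambda>\<omega>. (Y \<omega>)\<^sup>2) * expectation (\<lambda>\<omega>. Y \<omega> ^ k)"
  proof cases
    case normal
    then have "m = 0" using normal_distributed_expectation mean by metis
    with normal have s: "0 < s" and D: "distributed M lborel Y (normal_density 0 s)" by auto
    have E: "expectation (\<lambda>\<omega>. Y \<omega> ^ n) = (LINT x|lborel. normal_density 0 s x * x ^ n)" for n
      by (rule distributed_integral[OF D, symmetric]) auto
    have "integrable M (\<lambda>\<omega>. Y \<omega> ^ k)"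
      using integrable_normal_moment[OF s, of 0 k] distributed_integrable[OF D, of "\<lambda>x. x ^ k"] by simp
    moreover have even: "expectation (\<lambda>\<omega>. Y \<omega> ^ (2 * n)) = fact (2 * n) / ((2 / s\<^sup>2) ^ n * fact n)" for n
      using integral_normal_moment_even[OF s, of 0 n] by (simp add: E)
    have odd: "expectation (\<lambda>\<omega>. Y \<omega> ^ (2 * n + 1)) = 0" for n
      using integral_normal_moment_odd[OF s, of 0 n] unfolding E by simp
    have "expectation (\<lambda>\<omega>. Y \<omega> ^ (k + 2)) = (k + 1) * expectation (\<lambda>\<omega>. (Y \<omega>)\<^sup>2) * expectation (\<lambda>\<omega>. Y \<omega> ^ k)"
    proof (cases "even k")
      case True
      then obtain n where n: "k = 2 * n" by (elim evenE)
      have f: "(fact (2 * (n + 1)) :: real) = (2 * real n + 2) * (2 * real n + 1) * fact (2 * n)"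
        "(fact (n + 1) :: real) = (real n + 1) * fact n"
        by (simp_all add: algebra_simps)
      have alg: "(2 * r + 2) * (2 * r + 1) * a / (p * (2 / s\<^sup>2) * ((r + 1) * b)) = (2 * r + 1) * s\<^sup>2 * (a / (p * b))"
        if "0 < p" "0 < b" "0 \<le> r" for a p b r :: real
        using that s by (simp add: divide_simps)
      have "expectation (\<lambda>\<omega>. Y \<omega> ^ (2 * (n + 1))) = (2 * real n + 1) * s\<^sup>2 * expectation (\<lambda>\<omega>. Y \<omega> ^ (2 * n))"
        unfolding even f power_add power_one_right using s by (intro alg) auto
      moreover have "expectation (\<lambda>\<omega>. (Y \<omega>)\<^sup>2) = s\<^sup>2"
        using even[of 1] s by simp
      ultimately show ?thesis by (simp add: n)
    next
      case False
      then obtain n where n: "k = 2 * n + 1" by (elim oddE)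
      show ?thesis using odd[of "n + 1"] odd[of n] by (simp add: n)
    qed
    ultimately show ?thesis by blast
  next
    case const
    have pw: "AE \<omega> in M. Y \<omega> ^ n = c ^ n" for n using const by eventually_elim simp
    have E: "expectation (\<lambda>\<omega>. Y \<omega> ^ n) = c ^ n" for n
      using integral_cong_AE[OF _ _ pw[of n]] by (simp add: prob_space)
    have "c = 0" using E[of 1] mean by simp
    moreover have "integrable M (\<lambda>\<omega>. Y \<omega> ^ k)"
      using integrable_cong_AE[OF _ _ pw[of k]] by simp
    moreover have "expectation (\<lambda>\<omega>. Y \<omega> ^ (k + 2)) = (k + 1) * expectation (\<lambda>\<omega>. (Y \<omega>)\<^sup>2) * expectation (\<lambda>\<omega>. Y \<omega> ^ k)"
      unfolding E \<open>c = 0\<close> by simp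
    ultimately show ?thesis by blast
  qed
  then show "integrable M (\<lambda>\<omega>. Y \<omega> ^ k)"
    "expectation (\<lambda>\<omega>. Y \<omega> ^ (k + 2)) = (k + 1) * expectation (\<lambda>\<omega>. (Y \<omega>)\<^sup>2) * expectation (\<lambda>\<omega>. Y \<omega> ^ k)"
    by auto
qed

text \<open>Joint Gaussianity in the style of Cramer and Wold: every member is Gaussian and linear
  combinations stay inside. Degenerate joint laws are thereby included.\<close>

locale gaussian_space = prob_space +
  fixes V :: "('a \<Rightarrow> real) set"
  assumes gaussian: "Y \<in> V \<Longrightarrow> gaussian_rv M Y"
    and mean: "Y \<in> V \<Longrightarrow> expectation Y = 0"
    and lincomb: "Y \<in> V \<Longrightarrow> Z \<in> V \<Longrightarrow> (\<lambda>\<omega>. a * Y \<omega> + b * Z \<omega>) \<in> V"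
begin

lemma V_measurable: "Y \<in> V \<Longrightarrow> Y \<in> borel_measurable M"
  using gaussian by (simp add: gaussian_rv_def)

lemma integrable_power: "Y \<in> V \<Longrightarrow> integrable M (\<lambda>\<omega>. Y \<omega> ^ k)"
  by (intro gaussian_rv_moments gaussian mean)

lemma sum_in_V:
  assumes "finite T" "T \<noteq> {}" "\<And>j. j \<in> T \<Longrightarrow> y j \<in> V"
  shows "(\<lambda>\<omega>. \<Sum>j\<in>T. y j \<omega>) \<in> V"
  using assms
proof (induction T rule: finite_ne_induct)
  case (insert x F)
  then have "(\<lambda>\<omega>. 1 * y x \<omega> + 1 * (\<Sum>j\<in>F. y j \<omega>)) \<in> V" by (intro lincomb) auto
  then show ?case using insert by simp
qed simp

lemma integrable_two_powers:
  assumes "Y \<in> V" "Z \<in> V"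
  shows "integrable M (\<lambda>\<omega>. Z \<omega> ^ i * Y \<omega> ^ j)"
proof (rule Bochner_Integration.integrable_bound)
  show "(\<lambda>\<omega>. Z \<omega> ^ i * Y \<omega> ^ j) \<in> borel_measurable M"
    by (intro borel_measurable_times borel_measurable_power V_measurable assms)
  show "integrable M (\<lambda>\<omega>. \<bar>Z \<omega> ^ (i + j)\<bar> + \<bar>Y \<omega> ^ (i + j)\<bar>)"
    using assms by (intro Bochner_Integration.integrable_add integrable_abs integrable_power)
  show "AE \<omega> in M. norm (Z \<omega> ^ i * Y \<omega> ^ j) \<le> norm (\<bar>Z \<omega> ^ (i + j)\<bar> + \<bar>Y \<omega> ^ (i + j)\<bar>)"
  proof (intro AE_I2)
    fix \<omega>
    define m where "m = max \<bar>Z \<omega>\<bar> \<bar>Y \<omega>\<bar>"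
    have "\<bar>Z \<omega>\<bar> ^ i * \<bar>Y \<omega>\<bar> ^ j \<le> m ^ i * m ^ j"
      by (intro mult_mono power_mono) (auto simp: m_def)
    also have "\<dots> = m ^ (i + j)" by (simp add: power_add)
    also have "\<dots> \<le> \<bar>Z \<omega>\<bar> ^ (i + j) + \<bar>Y \<omega>\<bar> ^ (i + j)"
      by (auto simp: m_def max_def)
    finally show "norm (Z \<omega> ^ i * Y \<omega> ^ j) \<le> norm (\<bar>Z \<omega> ^ (i + j)\<bar> + \<bar>Y \<omega> ^ (i + j)\<bar>)"
      by (simp add: abs_mult power_abs)
  qed
qed

text \<open>By the binomial theorem the expectation is a polynomial in \<open>s\<close>, so its
  derivative at zero is the linear coefficient and no derivative has to be moved under an
  integral.\<close>

lemma moment_has_derivative: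
  assumes "Y \<in> V" "Z \<in> V"
  shows "((\<lambda>s. expectation (\<lambda>\<omega>. (Y \<omega> + s * Z \<omega>) ^ m)) has_real_derivative
     m * expectation (\<lambda>\<omega>. Z \<omega> * Y \<omega> ^ (m - 1))) (at 0)"
proof -
  define c where "c i = (m choose i) * expectation (\<lambda>\<omega>. Z \<omega> ^ i * Y \<omega> ^ (m - i))" for i
  have "expectation (\<lambda>\<omega>. (Y \<omega> + s * Z \<omega>) ^ m) = (\<Sum>i\<le>m. c i * s ^ i)" for s
  proof -
    have "expectation (\<lambda>\<omega>. (Y \<omega> + s * Z \<omega>) ^ m)
      = expectation (\<lambda>\<omega>. \<Sum>i\<le>m. (m choose i) * s ^ i * (Z \<omega> ^ i * Y \<omega> ^ (m - i)))"
      by (subst add.commute) (simp add: binomial_ring power_mult_distrib mult_ac)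
    also have "\<dots> = (\<Sum>i\<le>m. c i * s ^ i)"
      by (subst Bochner_Integration.integral_sum)
         (simp_all add: integrable_two_powers[OF assms] c_def mult.assoc mult.commute[of _ "s ^ _"])
    finally show ?thesis .
  qed
  moreover have "((\<lambda>s. \<Sum>i\<le>m. c i * s ^ i) has_real_derivative (\<Sum>i\<le>m. c i * (i * 0 ^ (i - 1)))) (at 0)"
    by (auto intro!: derivative_eq_intros simp: mult_ac)
  moreover have "(\<Sum>i\<le>m. c i * (real i * 0 ^ (i - 1))) = m * expectation (\<lambda>\<omega>. Z \<omega> * Y \<omega> ^ (m - 1))"
  proof -
    have "(\<Sum>i\<le>m. c i * (real i * 0 ^ (i - 1))) = (\<Sum>i\<le>m. if i = 1 then c 1 else 0)"
      by (intro sum.cong refl) (auto simp: power_0_left)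
    then show ?thesis by (cases m) (auto simp: c_def)
  qed
  ultimately show ?thesis by simp
qed

text \<open>The moment recursion holds for every \<open>Y + s Z\<close>, as these stay in
  \<open>V\<close>. Its derivative at \<open>s = 0\<close> relates the mixed moment of order
  \<open>k + 1\<close> to the one of order \<open>k - 1\<close>, which the induction hypothesis
  evaluates.\<close>

lemma stein_identity:
  assumes Y: "Y \<in> V" and Z: "Z \<in> V"
  shows "expectation (\<lambda>\<omega>. Z \<omega> * Y \<omega> ^ Suc k) =
    Suc k * expectation (\<lambda>\<omega>. Z \<omega> * Y \<omega>) * expectation (\<lambda>\<omega>. Y \<omega> ^ k)"
proof (induction k rule: less_induct)
  case (less k)
  define E where "E m = expectation (\<lambda>\<omega>. Y \<omega> ^ m)" for m
  define F where "F m = expectation (\<lambda>\<omega>. Z \<omega> * Y \<omega> ^ m)" for m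
  have rec: "E (m + 2) = (m + 1) * E 2 * E m" for m
    unfolding E_def using gaussian_rv_moments(2)[OF gaussian[OF Y] mean[OF Y], of m] by simp
  have in_V: "(\<lambda>\<omega>. Y \<omega> + s * Z \<omega>) \<in> V" for s
    using lincomb[OF Y Z, of 1 s] by simp
  have D: "((\<lambda>s. expectation (\<lambda>\<omega>. (Y \<omega> + s * Z \<omega>) ^ m)) has_real_derivative m * F (m - 1)) (at 0)" for m
    unfolding F_def by (rule moment_has_derivative[OF Y Z])
  have "expectation (\<lambda>\<omega>. (Y \<omega> + s * Z \<omega>) ^ (k + 2))
      = (k + 1) * expectation (\<lambda>\<omega>. (Y \<omega> + s * Z \<omega>)\<^sup>2) * expectation (\<lambda>\<omega>. (Y \<omega> + s * Z \<omega>) ^ k)" for s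
    using gaussian_rv_moments(2)[OF gaussian[OF in_V] mean[OF in_V], of s k] by simp
  then have eq: "(\<lambda>s. expectation (\<lambda>\<omega>. (Y \<omega> + s * Z \<omega>) ^ (k + 2)))
      = (\<lambda>s. (k + 1) * expectation (\<lambda>\<omega>. (Y \<omega> + s * Z \<omega>)\<^sup>2) * expectation (\<lambda>\<omega>. (Y \<omega> + s * Z \<omega>) ^ k))"
    by (rule ext)
  have "((\<lambda>s. (k + 1) * (expectation (\<lambda>\<omega>. (Y \<omega> + s * Z \<omega>)\<^sup>2) * expectation (\<lambda>\<omega>. (Y \<omega> + s * Z \<omega>) ^ k)))
     has_real_derivative (k + 1) * ((2 * F (2 - 1)) * E k + (k * F (k - 1)) * E 2)) (at 0)"
    using DERIV_mult[OF D[of 2] D[of k]] by (intro DERIV_cmult) (simp add: E_def)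
  with D[of "k + 2"] have main: "(k + 2) * F (k + 1) = (k + 1) * (2 * F 1 * E k + k * F (k - 1) * E 2)"
    unfolding eq mult.assoc[of "real (k + 1)" "expectation _"]
    using DERIV_unique by (fastforce simp: mult.assoc)
  \<comment> \<open>For \<open>k\<close> at least 2 the induction hypothesis at \<open>k - 2\<close>
    and the recursion for \<open>E k\<close> give this. For \<open>k = 1\<close> both sides vanish
    since \<open>Y\<close> and \<open>Z\<close> are centred.\<close>
  have "k * F (k - 1) * E 2 = k * F 1 * E k"
  proof (cases "k < 2")
    case True
    have "F 0 = 0" "E 1 = 0" using mean Y Z by (auto simp: F_def E_def)
    moreover have "k = 0 \<or> k = 1" using True by auto
    ultimately show ?thesis by auto
  next
    case False
    define j where "j = k - 2"
    have j: "k = j + 2" using False by (simp add: j_def)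
    have "F (j + 1) = (j + 1) * F 1 * E j" using less.IH[of j] by (simp add: F_def E_def j)
    then show ?thesis using rec[of j] by (simp add: j)
  qed
  then have "(k + 2) * F (k + 1) = (k + 1) * (2 * F 1 * E k + k * F 1 * E k)"
    using main by (simp only:)
  then have "(k + 2) * F (k + 1) = (k + 2) * ((k + 1) * F 1 * E k)"
    by (simp add: algebra_simps)
  then have "F (k + 1) = (k + 1) * F 1 * E k" by (simp only: mult_cancel_left) simp
  then show ?case by (simp add: F_def E_def)
qed

lemma prod_polarization:
  fixes y :: "'i \<Rightarrow> real"
  assumes "finite A"
  shows "(\<Prod>j\<in>A. y j) = (\<Sum>T\<in>Pow A. (- 1) ^ card (A - T) / fact (card A) * (x + (\<Sum>j\<in>T. y j)) ^ card A)"
  using sum_alternating_subset_powers[OF assms order_refl, of x y]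
  by (simp add: sum_divide_distrib[symmetric])

text \<open>Polarization writes the product as a combination of powers of sums, reducing the claim
  to products of powers of two members of \<open>V\<close>.\<close>

lemma integrable_mult_prod:
  assumes "finite A" "Z \<in> V" "\<And>j. j \<in> A \<Longrightarrow> y j \<in> V"
  shows "integrable M (\<lambda>\<omega>. Z \<omega> * (\<Prod>j\<in>A. y j \<omega>))"
proof -
  have "integrable M (\<lambda>\<omega>. Z \<omega> * (0 + (\<Sum>j\<in>T. y j \<omega>)) ^ card A)" if "T \<in> Pow A" for T
  proof (cases "T = {}")
    case True
    then show ?thesis using integrable_power[OF assms(2), of 1] by (cases "card A") auto
  next
    case False
    have "(\<lambda>\<omega>. \<Sum>j\<in>T. y j \<omega>) \<in> V"
      using that assms False finite_subset by (intro sum_in_V) auto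
    from integrable_two_powers[OF this assms(2), of 1 "card A"] show ?thesis by simp
  qed
  then have "integrable M (\<lambda>\<omega>. \<Sum>T\<in>Pow A. (- 1) ^ card (A - T) / fact (card A) * (Z \<omega> * (0 + (\<Sum>j\<in>T. y j \<omega>)) ^ card A))"
    by (intro Bochner_Integration.integrable_sum integrable_mult_right) auto
  then show ?thesis
    by (subst prod_polarization[OF assms(1), of _ 0]) (simp add: sum_distrib_left mult_ac)
qed

lemma integrable_prod:
  assumes "finite A" "\<And>j. j \<in> A \<Longrightarrow> y j \<in> V"
  shows "integrable M (\<lambda>\<omega>. \<Prod>j\<in>A. y j \<omega>)"
proof (cases "A = {}")
  case False
  then obtain a where a: "a \<in> A" by auto
  have "integrable M (\<lambda>\<omega>. y a \<omega> * (\<Prod>j\<in>A - {a}. y j \<omega>))"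
    using assms a by (intro integrable_mult_prod) auto
  then show ?thesis using a assms by (simp add: prod.remove)
qed simp

text \<open>Polarization turns the product into powers of subset sums, the Stein identity extracts
  one covariance from each power, and polarization read backwards reassembles the remaining
  product.\<close>

theorem isserlis:
  assumes A: "finite A" and Z: "Z \<in> V" and y: "\<And>j. j \<in> A \<Longrightarrow> y j \<in> V"
  shows "expectation (\<lambda>\<omega>. Z \<omega> * (\<Prod>j\<in>A. y j \<omega>)) =
    (\<Sum>j\<in>A. expectation (\<lambda>\<omega>. Z \<omega> * y j \<omega>) * expectation (\<lambda>\<omega>. \<Prod>l\<in>A - {j}. y l \<omega>))"
proof (cases "A = {}")
  case True
  then show ?thesis using mean[OF Z] by simp
next
  case False
  then obtain k where k: "card A = Suc k" using A by (metis card_eq_0_iff not0_implies_Suc)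
  let ?sgn = "\<lambda>T. (- 1 :: real) ^ card (A - T)"
  let ?y = "\<lambda>T \<omega>. \<Sum>j\<in>T. y j \<omega>"
  let ?P = "Pow A - {{}}"
  have fin: "finite T" if "T \<in> Pow A" for T using that A finite_subset by auto
  have yV: "?y T \<in> V" if "T \<in> ?P" for T
    using that y fin by (intro sum_in_V) auto
  have "fact (Suc k) * expectation (\<lambda>\<omega>. Z \<omega> * (\<Prod>j\<in>A. y j \<omega>))
    = expectation (\<lambda>\<omega>. Z \<omega> * (\<Sum>T\<in>Pow A. ?sgn T * (0 + ?y T \<omega>) ^ Suc k))"
    using sum_alternating_subset_powers[OF A order_refl, of 0 "\<lambda>j. y j _"] k
    by (simp add: mult_ac flip: integral_mult_right_zero)
  \<comment> \<open>The empty subset contributes a positive power of zero; dropping it keeps every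
    subset sum inside \<open>V\<close>.\<close>
  also have "\<dots> = expectation (\<lambda>\<omega>. \<Sum>T\<in>?P. ?sgn T * (Z \<omega> * ?y T \<omega> ^ Suc k))"
    using A by (simp add: sum_distrib_left sum.remove[of "Pow A" "{}"] mult_ac)
  also have "\<dots> = (\<Sum>T\<in>?P. ?sgn T * expectation (\<lambda>\<omega>. Z \<omega> * ?y T \<omega> ^ Suc k))"
    using integrable_two_powers[OF yV Z, of _ 1 "Suc k"]
    by (subst Bochner_Integration.integral_sum) auto
  also have "\<dots> = (\<Sum>T\<in>?P. \<Sum>j\<in>T. Suc k * (expectation (\<lambda>\<omega>. Z \<omega> * y j \<omega>) * (?sgn T * expectation (\<lambda>\<omega>. ?y T \<omega> ^ k))))"
  proof (intro sum.cong refl)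
    fix T assume T: "T \<in> ?P"
    have "expectation (\<lambda>\<omega>. Z \<omega> * ?y T \<omega>) = (\<Sum>j\<in>T. expectation (\<lambda>\<omega>. Z \<omega> * y j \<omega>))"
      unfolding sum_distrib_left using T y integrable_two_powers[OF _ Z, of _ 1 1]
      by (subst Bochner_Integration.integral_sum) auto
    then show "?sgn T * expectation (\<lambda>\<omega>. Z \<omega> * ?y T \<omega> ^ Suc k)
      = (\<Sum>j\<in>T. Suc k * (expectation (\<lambda>\<omega>. Z \<omega> * y j \<omega>) * (?sgn T * expectation (\<lambda>\<omega>. ?y T \<omega> ^ k))))"
      unfolding stein_identity[OF yV[OF T] Z] by (simp add: sum_distrib_left sum_distrib_right mult_ac)
  qed
  also have "\<dots> = (\<Sum>T\<in>Pow A. \<Sum>j\<in>T. Suc k * (expectation (\<lambda>\<omega>. Z \<omega> * y j \<omega>) * (?sgn T * expectation (\<lambda>\<omega>. ?y T \<omega> ^ k))))"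
    using A by (simp add: sum.remove[of "Pow A" "{}"])
  \<comment> \<open>The sum over pairs of a subset and one of its elements is reordered so that the
    element comes first.\<close>
  also have "\<dots> = (\<Sum>j\<in>A. \<Sum>T\<in>{T\<in>Pow A. j \<in> T}. Suc k * (expectation (\<lambda>\<omega>. Z \<omega> * y j \<omega>) * (?sgn T * expectation (\<lambda>\<omega>. ?y T \<omega> ^ k))))"
  proof -
    have "(\<Sum>T\<in>Pow A. \<Sum>j\<in>T. g T j) = (\<Sum>T\<in>Pow A. \<Sum>j\<in>{j\<in>A. j \<in> T}. g T j)" for g :: "'b set \<Rightarrow> 'b \<Rightarrow> real"
      by (intro sum.cong refl) auto
    then show ?thesis using A by (simp add: sum.swap_restrict)
  qed
  also have "\<dots> = (\<Sum>j\<in>A. Suc k * (expectation (\<lambda>\<omega>. Z \<omega> * y j \<omega>) * (fact k * expectation (\<lambda>\<omega>. \<Prod>l\<in>A - {j}. y l \<omega>))))"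
  proof (intro sum.cong refl)
    fix j assume j: "j \<in> A"
    let ?B = "A - {j}"
    have B: "finite ?B" "card ?B = k" using A j k by auto
    \<comment> \<open>Subsets containing \<open>j\<close> correspond to subsets of
      \<open>?B\<close>, with the base point of the alternating sum shifted from zero to
      \<open>y j\<close>. Since \<open>?B\<close> has exactly \<open>k\<close> elements, the sum of
      \<open>k\<close>-th powers collapses to \<open>fact k\<close> times the product.\<close>
    have img: "{T\<in>Pow A. j \<in> T} = insert j ` Pow ?B"
      using j by (auto simp: image_iff intro!: bexI[of _ "_ - {j}"])
    have inj: "inj_on (insert j) (Pow ?B)" by (auto simp: inj_on_def)
    have sgn: "?sgn (insert j T) = (- 1) ^ card (?B - T)" for T
      by (rule arg_cong[where f = "\<lambda>S. (- 1) ^ card S"]) auto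
    have sy: "?y (insert j T) \<omega> = y j \<omega> + ?y T \<omega>" if "T \<in> Pow ?B" for T \<omega>
      using that fin by (subst sum.insert) (auto intro: finite_subset[OF _ A])
    have int: "integrable M (\<lambda>\<omega>. (y j \<omega> + ?y T \<omega>) ^ k)" if "T \<in> Pow ?B" for T
    proof -
      have "?y (insert j T) \<in> V" using that j by (intro yV) auto
      from integrable_power[OF this, of k] show ?thesis by (simp only: sy[OF that])
    qed
    have "(\<Sum>T\<in>{T\<in>Pow A. j \<in> T}. ?sgn T * expectation (\<lambda>\<omega>. ?y T \<omega> ^ k))
      = (\<Sum>T\<in>Pow ?B. (- 1) ^ card (?B - T) * expectation (\<lambda>\<omega>. (y j \<omega> + ?y T \<omega>) ^ k))"
      unfolding img sum.reindex[OF inj] by (intro sum.cong refl) (simp only: comp_def sgn sy)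
    also have "\<dots> = expectation (\<lambda>\<omega>. \<Sum>T\<in>Pow ?B. (- 1) ^ card (?B - T) * (y j \<omega> + ?y T \<omega>) ^ k)"
      using int by (subst Bochner_Integration.integral_sum) auto
    also have "\<dots> = fact k * expectation (\<lambda>\<omega>. \<Prod>l\<in>?B. y l \<omega>)"
      using sum_alternating_subset_powers[of ?B k "y j _" "\<lambda>l. y l _"] B by simp
    finally show "(\<Sum>T\<in>{T\<in>Pow A. j \<in> T}. Suc k * (expectation (\<lambda>\<omega>. Z \<omega> * y j \<omega>) * (?sgn T * expectation (\<lambda>\<omega>. ?y T \<omega> ^ k))))
      = Suc k * (expectation (\<lambda>\<omega>. Z \<omega> * y j \<omega>) * (fact k * expectation (\<lambda>\<omega>. \<Prod>l\<in>?B. y l \<omega>)))"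
      by (simp add: sum_distrib_left[symmetric])
  qed
  also have "\<dots> = fact (Suc k) * (\<Sum>j\<in>A. expectation (\<lambda>\<omega>. Z \<omega> * y j \<omega>) * expectation (\<lambda>\<omega>. \<Prod>l\<in>A - {j}. y l \<omega>))"
    by (simp add: sum_distrib_left mult_ac)
  finally show ?thesis by (simp only: mult_cancel_left) simp
qed

end

text \<open>Squares become products over a doubled index set, so the bounds for products indexed by
  sets also cover repeated factors.\<close>

lemma prod_times_bool:
  fixes f :: "'i \<Rightarrow> real"
  shows "(\<Prod>p\<in>B \<times> (UNIV :: bool set). f (fst p)) = (\<Prod>j\<in>B. (f j)\<^sup>2)"
proof -
  have "(\<Prod>p\<in>B \<times> (UNIV :: bool set). f (fst p)) = (\<Prod>(j, b)\<in>B \<times> (UNIV :: bool set). f j)"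
    by (simp add: split_beta')
  also have "\<dots> = (\<Prod>j\<in>B. \<Prod>b\<in>(UNIV :: bool set). f j)"
    by (rule prod.cartesian_product[symmetric])
  finally show ?thesis by (simp add: UNIV_bool power2_eq_square)
qed

section \<open>Bounds and exact low-order moments of centred squares\<close>

context gaussian_space
begin

definition cov :: "('a \<Rightarrow> real) \<Rightarrow> ('a \<Rightarrow> real) \<Rightarrow> real" where
  "cov Y Z = expectation (\<lambda>\<omega>. Y \<omega> * Z \<omega>)"

lemma cov_commute: "cov Y Z = cov Z Y"
  by (simp add: cov_def mult.commute)

text \<open>Each use of \<open>isserlis\<close> removes two factors and offers
  \<open>card A - 1\<close> partners; the factorial is a crude bound for the resulting number of
  pairings.\<close>

lemma abs_expectation_prod_le:
  assumes "finite A" "\<And>j. j \<in> A \<Longrightarrow> y j \<in> V" "\<And>j. j \<in> A \<Longrightarrow> 0 \<le> u j"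
    and "\<And>j l. j \<in> A \<Longrightarrow> l \<in> A \<Longrightarrow> \<bar>cov (y j) (y l)\<bar> \<le> u j * u l"
  shows "\<bar>expectation (\<lambda>\<omega>. \<Prod>j\<in>A. y j \<omega>)\<bar> \<le> fact (card A) * (\<Prod>j\<in>A. u j)"
  using assms
proof (induction "card A" arbitrary: A rule: less_induct)
  case less
  show ?case
  proof (cases "A = {}")
    case True
    then show ?thesis by (simp add: prob_space)
  next
    case False
    then obtain a where a: "a \<in> A" by auto
    let ?B = "A - {a}"
    have B: "finite ?B" "card A = Suc (card ?B)"
      using less.prems a card.remove[of A a] by auto
    have "\<bar>expectation (\<lambda>\<omega>. \<Prod>j\<in>A. y j \<omega>)\<bar> = \<bar>expectation (\<lambda>\<omega>. y a \<omega> * (\<Prod>j\<in>?B. y j \<omega>))\<bar>"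
      using less.prems(1) a by (simp add: prod.remove)
    also have "\<dots> = \<bar>\<Sum>j\<in>?B. cov (y a) (y j) * expectation (\<lambda>\<omega>. \<Prod>l\<in>?B - {j}. y l \<omega>)\<bar>"
      unfolding cov_def using less.prems a by (subst isserlis) auto
    also have "\<dots> \<le> (\<Sum>j\<in>?B. (u a * u j) * (fact (card (?B - {j})) * (\<Prod>l\<in>?B - {j}. u l)))"
    proof (intro order_trans[OF sum_abs] sum_mono)
      fix j assume j: "j \<in> ?B"
      have "card (?B - {j}) < card A"
        using less.prems(1) a j by (intro psubset_card_mono) auto
      then have "\<bar>expectation (\<lambda>\<omega>. \<Prod>l\<in>?B - {j}. y l \<omega>)\<bar> \<le> fact (card (?B - {j})) * (\<Prod>l\<in>?B - {j}. u l)"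
        using less.prems by (intro less.hyps) auto
      then show "\<bar>cov (y a) (y j) * expectation (\<lambda>\<omega>. \<Prod>l\<in>?B - {j}. y l \<omega>)\<bar>
          \<le> (u a * u j) * (fact (card (?B - {j})) * (\<Prod>l\<in>?B - {j}. u l))"
        unfolding abs_mult using less.prems a j by (intro mult_mono) auto
    qed
    also have "\<dots> = (\<Sum>j\<in>?B. fact (card ?B - 1) * (\<Prod>l\<in>A. u l))"
    proof (intro sum.cong refl)
      fix j assume j: "j \<in> ?B"
      have "(\<Prod>l\<in>A. u l) = u a * (u j * (\<Prod>l\<in>?B - {j}. u l))"
        using less.prems(1) a j by (simp add: prod.remove[of A a] prod.remove[of ?B j])
      then show "(u a * u j) * (fact (card (?B - {j})) * (\<Prod>l\<in>?B - {j}. u l)) = fact (card ?B - 1) * (\<Prod>l\<in>A. u l)"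
        using j by simp
    qed
    also have "\<dots> = real (card ?B) * fact (card ?B - 1) * (\<Prod>l\<in>A. u l)" by simp
    also have "\<dots> \<le> fact (card A) * (\<Prod>l\<in>A. u l)"
    proof (intro mult_right_mono prod_nonneg ballI)
      have "real (card ?B) * fact (card ?B - 1) \<le> fact (card ?B)"
        by (cases "card ?B") (auto simp: fact_reduce)
      also have "\<dots> \<le> fact (card A)" by (intro fact_mono) (use B in simp)
      finally show "real (card ?B) * fact (card ?B - 1) \<le> fact (card A)" .
    qed (use less.prems in auto)
    finally show ?thesis .
  qed
qed

lemma integrable_prod_squares:
  assumes "finite B" "\<And>j. j \<in> B \<Longrightarrow> y j \<in> V"
  shows "integrable M (\<lambda>\<omega>. \<Prod>j\<in>B. (y j \<omega>)\<^sup>2)"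
proof -
  have "integrable M (\<lambda>\<omega>. \<Prod>p\<in>B \<times> (UNIV :: bool set). y (fst p) \<omega>)"
    using assms by (intro integrable_prod) auto
  then show ?thesis by (simp only: prod_times_bool[of "\<lambda>j. y j _"])
qed

lemma expectation_prod_squares_le:
  assumes "finite B" "\<And>j. j \<in> B \<Longrightarrow> y j \<in> V" "\<And>j. j \<in> B \<Longrightarrow> 0 \<le> u j"
    and "\<And>j l. j \<in> B \<Longrightarrow> l \<in> B \<Longrightarrow> \<bar>cov (y j) (y l)\<bar> \<le> u j * u l"
  shows "expectation (\<lambda>\<omega>. \<Prod>j\<in>B. (y j \<omega>)\<^sup>2) \<le> fact (2 * card B) * (\<Prod>j\<in>B. (u j)\<^sup>2)"
proof -
  have "\<bar>expectation (\<lambda>\<omega>. \<Prod>p\<in>B \<times> (UNIV :: bool set). y (fst p) \<omega>)\<bar>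
    \<le> fact (card (B \<times> (UNIV :: bool set))) * (\<Prod>p\<in>B \<times> (UNIV :: bool set). u (fst p))"
    using assms by (intro abs_expectation_prod_le) auto
  moreover have "card (B \<times> (UNIV :: bool set)) = 2 * card B"
    by (simp add: card_cartesian_product)
  ultimately show ?thesis by (simp add: prod_times_bool[of "\<lambda>j. y j _"] prod_times_bool[of u])
qed

text \<open>Each factor is at most \<open>(y j \<omega>)\<^sup>2 + (u j)\<^sup>2\<close>. Expanding
  the product gives \<open>2 ^ card A\<close> terms, each bounded through at most
  \<open>2 * card A\<close> Gaussian factors; hence the constants. The bound factors over the
  indices, as the later Fubini arguments require.\<close>

lemma centered_squares_integrable_bound:
  assumes A: "finite A" and y: "\<And>j. j \<in> A \<Longrightarrow> y j \<in> V" and u: "\<And>j. j \<in> A \<Longrightarrow> 0 \<le> u j"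
    and c: "\<And>j l. j \<in> A \<Longrightarrow> l \<in> A \<Longrightarrow> \<bar>cov (y j) (y l)\<bar> \<le> u j * u l"
  shows "integrable M (\<lambda>\<omega>. \<Prod>j\<in>A. (y j \<omega>)\<^sup>2 - cov (y j) (y j))" (is ?int)
    and "expectation (\<lambda>\<omega>. \<bar>\<Prod>j\<in>A. (y j \<omega>)\<^sup>2 - cov (y j) (y j)\<bar>) \<le> 2 ^ card A * fact (2 * card A) * (\<Prod>j\<in>A. (u j)\<^sup>2)" (is ?bound)
proof -
  let ?f = "\<lambda>\<omega>. \<Prod>j\<in>A. (y j \<omega>)\<^sup>2 + (u j)\<^sup>2"
  have expand: "?f \<omega> = (\<Sum>B\<in>Pow A. (\<Prod>j\<in>B. (y j \<omega>)\<^sup>2) * (\<Prod>j\<in>A - B. (u j)\<^sup>2))" for \<omega>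
    by (rule prod_add[OF A])
  have int: "integrable M (\<lambda>\<omega>. \<Prod>j\<in>B. (y j \<omega>)\<^sup>2)" if "B \<in> Pow A" for B
    using that A y finite_subset by (intro integrable_prod_squares) auto
  have intf: "integrable M ?f"
    unfolding expand using int by (intro Bochner_Integration.integrable_sum integrable_mult_left) auto
  have [measurable]: "y j \<in> borel_measurable M" if "j \<in> A" for j
    using V_measurable y that by auto
  have meas: "(\<lambda>\<omega>. \<Prod>j\<in>A. (y j \<omega>)\<^sup>2 - cov (y j) (y j)) \<in> borel_measurable M"
    by (intro borel_measurable_prod) simp
  have le: "\<bar>\<Prod>j\<in>A. (y j \<omega>)\<^sup>2 - cov (y j) (y j)\<bar> \<le> ?f \<omega>" for \<omega>
    unfolding abs_prod
  proof (intro prod_mono conjI)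
    fix j assume j: "j \<in> A"
    show "\<bar>(y j \<omega>)\<^sup>2 - cov (y j) (y j)\<bar> \<le> (y j \<omega>)\<^sup>2 + (u j)\<^sup>2"
      using c[OF j j] abs_triangle_ineq4[of "(y j \<omega>)\<^sup>2" "cov (y j) (y j)"] by (simp add: power2_eq_square)
  qed simp
  show int': ?int
    by (rule Bochner_Integration.integrable_bound[OF intf meas]) (use le in \<open>auto intro: order_trans[OF _ abs_ge_self]\<close>)
  have "expectation (\<lambda>\<omega>. \<bar>\<Prod>j\<in>A. (y j \<omega>)\<^sup>2 - cov (y j) (y j)\<bar>) \<le> expectation ?f"
    using int' intf le by (intro integral_mono) auto
  also have "\<dots> = (\<Sum>B\<in>Pow A. expectation (\<lambda>\<omega>. \<Prod>j\<in>B. (y j \<omega>)\<^sup>2) * (\<Prod>j\<in>A - B. (u j)\<^sup>2))"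
    unfolding expand using int by (subst Bochner_Integration.integral_sum) auto
  also have "\<dots> \<le> (\<Sum>B\<in>Pow A. fact (2 * card A) * (\<Prod>j\<in>A. (u j)\<^sup>2))"
  proof (intro sum_mono)
    fix B assume B: "B \<in> Pow A"
    have "expectation (\<lambda>\<omega>. \<Prod>j\<in>B. (y j \<omega>)\<^sup>2) \<le> fact (2 * card B) * (\<Prod>j\<in>B. (u j)\<^sup>2)"
    proof (rule expectation_prod_squares_le)
      show "finite B" using B A finite_subset by auto
      show "\<bar>cov (y j) (y l)\<bar> \<le> u j * u l" if "j \<in> B" "l \<in> B" for j l
        using B that by (intro c) auto
    qed (use B y u in auto)
    also have "\<dots> \<le> fact (2 * card A) * (\<Prod>j\<in>B. (u j)\<^sup>2)"
      using B A by (intro mult_right_mono fact_mono prod_nonneg mult_left_mono card_mono) auto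
    finally have "expectation (\<lambda>\<omega>. \<Prod>j\<in>B. (y j \<omega>)\<^sup>2) * (\<Prod>j\<in>A - B. (u j)\<^sup>2)
        \<le> fact (2 * card A) * (\<Prod>j\<in>B. (u j)\<^sup>2) * (\<Prod>j\<in>A - B. (u j)\<^sup>2)"
      by (intro mult_right_mono prod_nonneg) auto
    also have "\<dots> = fact (2 * card A) * (\<Prod>j\<in>A. (u j)\<^sup>2)"
      using B A prod.subset_diff[of B A "\<lambda>j. (u j)\<^sup>2"] by (simp add: mult_ac)
    finally show "expectation (\<lambda>\<omega>. \<Prod>j\<in>B. (y j \<omega>)\<^sup>2) * (\<Prod>j\<in>A - B. (u j)\<^sup>2) \<le> fact (2 * card A) * (\<Prod>j\<in>A. (u j)\<^sup>2)" .
  qed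
  also have "\<dots> = 2 ^ card A * fact (2 * card A) * (\<Prod>j\<in>A. (u j)\<^sup>2)"
    by (simp add: card_Pow A)
  finally show ?bound .
qed

text \<open>Lists make the pairing recursion executable by rewriting, and they allow repeated
  factors.\<close>

definition moment :: "('a \<Rightarrow> real) list \<Rightarrow> real" where
  "moment ys = expectation (\<lambda>\<omega>. \<Prod>y\<leftarrow>ys. y \<omega>)"

lemma prod_list_nth: "(\<Prod>y\<leftarrow>ys. y \<omega>) = (\<Prod>j<length ys. (ys ! j) \<omega>)" for \<omega> :: 'a and ys :: "('a \<Rightarrow> real) list"
  by (simp add: prod.list_conv_set_nth atLeast0LessThan)

lemma integrable_prod_list: "set ys \<subseteq> V \<Longrightarrow> integrable M (\<lambda>\<omega>. \<Prod>y\<leftarrow>ys. y \<omega>)"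
  unfolding prod_list_nth by (intro integrable_prod) auto

lemma moment_Nil: "moment [] = 1"
  by (simp add: moment_def prob_space)

lemma moment_Cons:
  assumes "z \<in> V" "set ys \<subseteq> V"
  shows "moment (z # ys) = (\<Sum>j<length ys. cov z (ys ! j) * moment (take j ys @ drop (Suc j) ys))"
proof -
  have "(\<Prod>l\<in>{..<length ys} - {j}. (ys ! l) \<omega>) = (\<Prod>y\<leftarrow>take j ys @ drop (Suc j) ys. y \<omega>)"
    if j: "j < length ys" for j \<omega>
  proof -
    have split: "{..<length ys} - {j} = {..<j} \<union> {0 + Suc j..<(length ys - Suc j) + Suc j}" using j by auto
    have "(\<Prod>l\<in>{..<length ys} - {j}. (ys ! l) \<omega>)
      = (\<Prod>l<j. (ys ! l) \<omega>) * (\<Prod>l\<in>{0 + Suc j..<(length ys - Suc j) + Suc j}. (ys ! l) \<omega>)"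
      unfolding split by (rule prod.union_disjoint) auto
    also have "\<dots> = (\<Prod>y\<leftarrow>take j ys @ drop (Suc j) ys. y \<omega>)"
      using j unfolding prod.shift_bounds_nat_ivl by (simp add: prod_list_nth atLeast0LessThan add.commute)
    finally show ?thesis .
  qed
  then show ?thesis
    unfolding moment_def cov_def using isserlis[of "{..<length ys}" z "(!) ys"] assms
    by (simp add: prod_list_nth[of _ ys] subset_iff)
qed

text \<open>Centring removes every pairing in which the two copies of a variable meet each other.
  The remaining pairings link the variables into cycles; here a single cycle of length two arises in
  two ways.\<close>

lemma expectation_centered_squares2:
  assumes V: "a \<in> V" "b \<in> V"
  shows "expectation (\<lambda>\<omega>. ((a \<omega>)\<^sup>2 - cov a a) * ((b \<omega>)\<^sup>2 - cov b b)) = 2 * (cov a b)\<^sup>2"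
proof -
  let ?p = "\<lambda>ys \<omega>. \<Prod>y\<leftarrow>ys. y \<omega>"
  have "expectation (\<lambda>\<omega>. ((a \<omega>)\<^sup>2 - cov a a) * ((b \<omega>)\<^sup>2 - cov b b))
    = expectation (\<lambda>\<omega>. ?p [a, a, b, b] \<omega> - cov b b * ?p [a, a] \<omega> - cov a a * ?p [b, b] \<omega> + cov a a * cov b b)"
    by (intro Bochner_Integration.integral_cong refl) (simp add: algebra_simps power2_eq_square)
  also have "\<dots> = moment [a, a, b, b] - cov b b * moment [a, a] - cov a a * moment [b, b] + cov a a * cov b b"
    unfolding moment_def using V
    by (simp add: integrable_prod_list prob_space del: list.map prod_list.Cons)
  finally show ?thesis using V by (simp add: moment_Cons moment_Nil power2_eq_square)
qed

lemma expectation_centered_squares3: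
  assumes V: "a \<in> V" "b \<in> V" "c \<in> V"
  shows "expectation (\<lambda>\<omega>. ((a \<omega>)\<^sup>2 - cov a a) * ((b \<omega>)\<^sup>2 - cov b b) * ((c \<omega>)\<^sup>2 - cov c c)) = 8 * (cov a b * cov b c * cov c a)"
proof -
  let ?p = "\<lambda>ys \<omega>. \<Prod>y\<leftarrow>ys. y \<omega>"
  have "expectation (\<lambda>\<omega>. ((a \<omega>)\<^sup>2 - cov a a) * ((b \<omega>)\<^sup>2 - cov b b) * ((c \<omega>)\<^sup>2 - cov c c))
    = expectation (\<lambda>\<omega>. ?p [a, a, b, b, c, c] \<omega> - cov c c * ?p [a, a, b, b] \<omega>
      - cov b b * ?p [a, a, c, c] \<omega> - cov a a * ?p [b, b, c, c] \<omega>
      + cov b b * cov c c * ?p [a, a] \<omega> + cov a a * cov c c * ?p [b, b] \<omega> + cov a a * cov b b * ?p [c, c] \<omega>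
      - cov a a * cov b b * cov c c)"
    by (intro Bochner_Integration.integral_cong refl) (simp add: algebra_simps power2_eq_square)
  also have "\<dots> = moment [a, a, b, b, c, c] - cov c c * moment [a, a, b, b]
      - cov b b * moment [a, a, c, c] - cov a a * moment [b, b, c, c]
      + cov b b * cov c c * moment [a, a] + cov a a * cov c c * moment [b, b] + cov a a * cov b b * moment [c, c]
      - cov a a * cov b b * cov c c"
    unfolding moment_def using V
    by (simp add: integrable_prod_list prob_space del: list.map prod_list.Cons)
  finally show ?thesis
    using V by (simp add: moment_Cons moment_Nil cov_commute[of b a] cov_commute[of c a] cov_commute[of c b])
      (simp add: algebra_simps)
qed

text \<open>The surviving pairings form either two disjoint cycles of length two (three choices,
  weight \<open>2 * 2\<close>) or one cycle through all four variables (three choices, weight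
  \<open>2 ^ 4\<close>).\<close>

lemma expectation_centered_squares4:
  assumes V: "a \<in> V" "b \<in> V" "c \<in> V" "d \<in> V"
  shows "expectation (\<lambda>\<omega>. ((a \<omega>)\<^sup>2 - cov a a) * ((b \<omega>)\<^sup>2 - cov b b) * ((c \<omega>)\<^sup>2 - cov c c) * ((d \<omega>)\<^sup>2 - cov d d)) =
    4 * ((cov a b)\<^sup>2 * (cov c d)\<^sup>2 + (cov a c)\<^sup>2 * (cov b d)\<^sup>2 + (cov a d)\<^sup>2 * (cov b c)\<^sup>2) +
    16 * (cov a b * cov b c * cov c d * cov d a + cov a b * cov b d * cov d c * cov c a + cov a c * cov c b * cov b d * cov d a)"
proof -
  let ?p = "\<lambda>ys \<omega>. \<Prod>y\<leftarrow>ys. y \<omega>"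
  have "expectation (\<lambda>\<omega>. ((a \<omega>)\<^sup>2 - cov a a) * ((b \<omega>)\<^sup>2 - cov b b) * ((c \<omega>)\<^sup>2 - cov c c) * ((d \<omega>)\<^sup>2 - cov d d))
    = expectation (\<lambda>\<omega>. ?p [a, a, b, b, c, c, d, d] \<omega>
      - cov d d * ?p [a, a, b, b, c, c] \<omega> - cov c c * ?p [a, a, b, b, d, d] \<omega>
      - cov b b * ?p [a, a, c, c, d, d] \<omega> - cov a a * ?p [b, b, c, c, d, d] \<omega>
      + cov c c * cov d d * ?p [a, a, b, b] \<omega> + cov b b * cov d d * ?p [a, a, c, c] \<omega>
      + cov b b * cov c c * ?p [a, a, d, d] \<omega> + cov a a * cov d d * ?p [b, b, c, c] \<omega>
      + cov a a * cov c c * ?p [b, b, d, d] \<omega> + cov a a * cov b b * ?p [c, c, d, d] \<omega>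
      - cov b b * cov c c * cov d d * ?p [a, a] \<omega> - cov a a * cov c c * cov d d * ?p [b, b] \<omega>
      - cov a a * cov b b * cov d d * ?p [c, c] \<omega> - cov a a * cov b b * cov c c * ?p [d, d] \<omega>
      + cov a a * cov b b * cov c c * cov d d)"
    by (intro Bochner_Integration.integral_cong refl) (simp add: algebra_simps power2_eq_square)
  also have "\<dots> = moment [a, a, b, b, c, c, d, d]
      - cov d d * moment [a, a, b, b, c, c] - cov c c * moment [a, a, b, b, d, d]
      - cov b b * moment [a, a, c, c, d, d] - cov a a * moment [b, b, c, c, d, d]
      + cov c c * cov d d * moment [a, a, b, b] + cov b b * cov d d * moment [a, a, c, c]
      + cov b b * cov c c * moment [a, a, d, d] + cov a a * cov d d * moment [b, b, c, c]
      + cov a a * cov c c * moment [b, b, d, d] + cov a a * cov b b * moment [c, c, d, d]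
      - cov b b * cov c c * cov d d * moment [a, a] - cov a a * cov c c * cov d d * moment [b, b]
      - cov a a * cov b b * cov d d * moment [c, c] - cov a a * cov b b * cov c c * moment [d, d]
      + cov a a * cov b b * cov c c * cov d d"
    unfolding moment_def using V
    by (simp add: integrable_prod_list prob_space del: list.map prod_list.Cons)
  finally show ?thesis
    using V by (simp add: moment_Cons moment_Nil cov_commute[of b a] cov_commute[of c a] cov_commute[of c b]
        cov_commute[of d a] cov_commute[of d b] cov_commute[of d c])
      (simp add: algebra_simps power2_eq_square)
qed

lemma integrable_cov: "a \<in> V \<Longrightarrow> b \<in> V \<Longrightarrow> integrable M (\<lambda>\<omega>. a \<omega> * b \<omega>)"
  using integrable_two_powers[of b a 1 1] by simp

end

section \<open>Traces of powers of the doubly centred distance matrix\<close>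

lemma sum_swap_left:
  fixes f :: "'i \<Rightarrow> real"
  shows "(\<Sum>k\<in>K. \<Sum>j\<in>J. f j * g j k) = (\<Sum>j\<in>J. f j * (\<Sum>k\<in>K. g j k))"
  by (subst sum.swap) (simp add: sum_distrib_left)

locale sym_array =
  fixes N :: nat and b :: "nat \<Rightarrow> nat \<Rightarrow> real"
  assumes N: "0 < N" and sym: "b l k = b k l" and nonneg: "0 \<le> b l k"
begin

definition \<beta> where "\<beta> l = (\<Sum>k<N. b l k) / N"
definition T where "T = (\<Sum>l<N. \<beta> l)"
text \<open>Minus the doubly centred array: \<open>\<beta>\<close> holds the row means and
  \<open>T / N\<close> is the grand mean.\<close>

definition a where "a l k = \<beta> l + \<beta> k - T / N - b l k"
text \<open>With \<open>P = I - J / N\<close>, \<open>J\<close> the all-ones matrix, this is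
  \<open>- b P\<close>, whereas \<open>a\<close> is \<open>- P b P\<close>. As \<open>P\<close> is
  idempotent and the trace cyclic, powers of both have the same trace, and \<open>c\<close> has half
  as many terms to expand.\<close>

definition c where "c l k = \<beta> l - b l k"
definition b2 where "b2 l k = (\<Sum>j<N. b l j * b j k)"
definition \<gamma> where "\<gamma> l = (\<Sum>k<N. b l k * \<beta> k)"
definition a2 where "a2 l k = (\<Sum>j<N. a l j * a j k)"
definition c2 where "c2 l k = (\<Sum>j<N. c l j * c j k)"

lemma row_b: "(\<Sum>k<N. b l k) = N * \<beta> l" "(\<Sum>k<N. b k l) = N * \<beta> l"
  using N sym by (simp_all add: \<beta>_def)

lemma row_c: "(\<Sum>k<N. c l k) = 0"
  by (simp add: c_def sum_subtractf row_b)

lemma row_a: "(\<Sum>k<N. a l k) = 0"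
  using N by (simp add: a_def sum_subtractf sum.distrib row_b T_def[symmetric])

lemma a_c: "a l k = c l k + (\<beta> k - T / N)"
  by (simp add: a_def c_def)

lemma row_c2: "(\<Sum>k<N. c2 l k) = 0"
  unfolding c2_def by (subst sum.swap) (simp add: row_c flip: sum_distrib_left)

lemma b2_sym: "b2 l k = b2 k l"
  unfolding b2_def by (intro sum.cong refl) (simp add: sym mult.commute)

lemma row_b2: "(\<Sum>k<N. b2 l k) = N * \<gamma> l" "(\<Sum>k<N. b2 k l) = N * \<gamma> l"
proof -
  show "(\<Sum>k<N. b2 l k) = N * \<gamma> l"
    unfolding b2_def \<gamma>_def sum_swap_left by (simp add: row_b sum_distrib_left mult_ac)
  then show "(\<Sum>k<N. b2 k l) = N * \<gamma> l" by (simp add: b2_sym[of _ l])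
qed

lemma sum_\<gamma>: "(\<Sum>l<N. \<gamma> l) = N * (\<Sum>l<N. (\<beta> l)\<^sup>2)"
  unfolding \<gamma>_def by (subst sum.swap) (simp add: sum_distrib_left power2_eq_square row_b mult_ac flip: sum_distrib_right)

lemma b2_\<beta>: "(\<Sum>k<N. b2 l k * \<beta> k) = (\<Sum>j<N. b l j * \<gamma> j)"
  unfolding b2_def \<gamma>_def sum_distrib_right sum_distrib_left by (subst sum.swap) (simp add: mult_ac)

lemma b2_\<beta>_sum: "(\<Sum>l<N. \<Sum>j<N. b l j * \<gamma> j) = N * (\<Sum>l<N. \<beta> l * \<gamma> l)"
  by (subst sum.swap) (simp add: row_b sum_distrib_left mult_ac flip: sum_distrib_right)

lemma \<beta>_b2_\<beta>: "(\<Sum>l<N. \<beta> l * (\<Sum>j<N. b l j * \<gamma> j)) = (\<Sum>l<N. (\<gamma> l)\<^sup>2)"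
proof -
  have "(\<Sum>l<N. \<beta> l * (\<Sum>j<N. b l j * \<gamma> j)) = (\<Sum>j<N. \<Sum>l<N. (b j l * \<beta> l) * \<gamma> j)"
    unfolding sum_distrib_left by (subst sum.swap) (simp add: mult_ac sym)
  then show ?thesis by (simp add: \<gamma>_def[symmetric] power2_eq_square flip: sum_distrib_right)
qed

lemma b2_\<gamma>_sum: "(\<Sum>l<N. \<Sum>k<N. b2 l k * \<gamma> k) = N * (\<Sum>l<N. (\<gamma> l)\<^sup>2)"
  using sum_swap_left[of \<gamma> "\<lambda>k l. b2 l k" "{..<N}" "{..<N}"]
  by (simp add: row_b2 sum_distrib_left power2_eq_square mult_ac)

lemma sum_a_mult: "(\<Sum>k<N. a l k * (f k + w)) = (\<Sum>k<N. a l k * f k)"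
  by (simp add: distrib_left sum.distrib row_a flip: sum_distrib_right)

lemma a2_c: "a2 l k = (\<Sum>j<N. a l j * c j k)"
  unfolding a2_def a_c[of _ k] by (rule sum_a_mult)

text \<open>The squares of \<open>a\<close> and \<open>c\<close> differ by a term in the column
  index alone that sums to zero; vanishing row sums then make it disappear from all traces.\<close>

definition v where "v k = (\<Sum>j<N. (\<beta> j - T / N) * c j k)"

lemma a2_c2: "a2 l k = c2 l k + v k"
  unfolding a2_c c2_def v_def by (simp add: a_c distrib_right sum.distrib)

lemma sum_v: "(\<Sum>k<N. v k) = 0"
  unfolding v_def by (subst sum.swap) (simp add: row_c flip: sum_distrib_left)

lemma trace_a2: "(\<Sum>l<N. \<Sum>k<N. a l k * a k l) = (\<Sum>l<N. \<Sum>k<N. c l k * c k l)"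
proof -
  have "(\<Sum>l<N. \<Sum>k<N. a l k * a k l) = (\<Sum>l<N. a2 l l)" by (simp add: a2_def)
  also have "\<dots> = (\<Sum>l<N. c2 l l)" by (simp add: a2_c2 sum.distrib sum_v)
  finally show ?thesis by (simp add: c2_def)
qed

lemma trace_a3: "(\<Sum>l<N. \<Sum>k<N. a2 l k * a k l) = (\<Sum>l<N. \<Sum>k<N. c2 l k * c k l)"
proof -
  have "(\<Sum>l<N. \<Sum>k<N. a2 l k * a k l) = (\<Sum>l<N. \<Sum>k<N. c2 l k * a k l) + (\<Sum>k<N. v k * (\<Sum>l<N. a k l))"
    by (simp add: a2_c2 distrib_right sum.distrib sum_swap_left)
  also have "\<dots> = (\<Sum>l<N. (\<Sum>k<N. c2 l k * c k l) + (\<Sum>k<N. c2 l k) * (\<beta> l - T / N))"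
    unfolding row_a by (simp add: a_c distrib_left sum.distrib sum_distrib_right)
  finally show ?thesis by (simp add: row_c2)
qed

lemma trace_a4: "(\<Sum>l<N. \<Sum>k<N. a2 l k * a2 k l) = (\<Sum>l<N. \<Sum>k<N. c2 l k * c2 k l)"
proof -
  have "(\<Sum>l<N. \<Sum>k<N. a2 l k * a2 k l)
    = (\<Sum>l<N. \<Sum>k<N. c2 l k * c2 k l + c2 l k * v l + v k * c2 k l + v k * v l)"
    by (simp add: a2_c2 algebra_simps)
  also have "\<dots> = (\<Sum>l<N. \<Sum>k<N. c2 l k * c2 k l) + (\<Sum>l<N. (\<Sum>k<N. c2 l k) * v l)
      + (\<Sum>k<N. v k * (\<Sum>l<N. c2 k l)) + (\<Sum>k<N. v k) * (\<Sum>l<N. v l)"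
    by (simp add: sum.distrib sum_distrib_left sum_distrib_right sum.swap[of "\<lambda>l k. v k * c2 k l"] sum.swap[of "\<lambda>l k. v k * v l"])
  finally show ?thesis by (simp add: row_c2 sum_v)
qed

lemma trace_c2: "(\<Sum>l<N. \<Sum>k<N. c l k * c k l) =
  (\<Sum>l<N. \<Sum>k<N. (b l k)\<^sup>2) - 2 * N * (\<Sum>l<N. (\<beta> l)\<^sup>2) + T\<^sup>2"
proof -
  have "(\<Sum>k<N. c l k * c k l) = \<beta> l * T - N * (\<beta> l)\<^sup>2 - \<gamma> l + (\<Sum>k<N. (b l k)\<^sup>2)" for l
  proof -
    have "(\<Sum>k<N. c l k * c k l) = (\<Sum>k<N. \<beta> l * \<beta> k - \<beta> l * b l k - b l k * \<beta> k + (b l k)\<^sup>2)"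
      by (intro sum.cong refl) (simp add: c_def sym[of _ l] algebra_simps power2_eq_square)
    also have "\<dots> = \<beta> l * T - \<beta> l * (\<Sum>k<N. b l k) - \<gamma> l + (\<Sum>k<N. (b l k)\<^sup>2)"
      by (simp add: sum.distrib sum_subtractf T_def \<gamma>_def sum_distrib_left)
    finally show ?thesis by (simp add: row_b power2_eq_square algebra_simps)
  qed
  then have "(\<Sum>l<N. \<Sum>k<N. c l k * c k l) = (\<Sum>l<N. \<beta> l * T) - (\<Sum>l<N. N * (\<beta> l)\<^sup>2) - (\<Sum>l<N. \<gamma> l) + (\<Sum>l<N. \<Sum>k<N. (b l k)\<^sup>2)"
    by (simp add: sum.distrib sum_subtractf)
  then show ?thesis
    by (simp add: sum_\<gamma> T_def[symmetric] power2_eq_square flip: sum_distrib_left sum_distrib_right)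
qed

lemma c2_eq: "c2 l k = \<beta> l * T - N * \<beta> l * \<beta> k - \<gamma> l + b2 l k"
proof -
  have "c2 l k = (\<Sum>j<N. \<beta> l * \<beta> j - \<beta> l * b j k - b l j * \<beta> j + b l j * b j k)"
    unfolding c2_def c_def by (intro sum.cong refl) (simp add: algebra_simps)
  also have "\<dots> = \<beta> l * T - \<beta> l * (\<Sum>j<N. b j k) - \<gamma> l + b2 l k"
    by (simp add: sum.distrib sum_subtractf T_def \<gamma>_def b2_def sum_distrib_left)
  finally show ?thesis by (simp add: row_b)
qed

lemma trace_c3: "(\<Sum>l<N. \<Sum>k<N. c2 l k * c k l) =
  - (\<Sum>l<N. \<Sum>k<N. b2 l k * b l k) + 3 * N * (\<Sum>l<N. \<beta> l * \<gamma> l) - 3 * N * (\<Sum>l<N. (\<beta> l)\<^sup>2) * T + T ^ 3"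
proof -
  let ?\<sigma> = "\<Sum>l<N. (\<beta> l)\<^sup>2" and ?\<kappa> = "\<Sum>l<N. \<beta> l * \<gamma> l"
  have row: "(\<Sum>k<N. c2 l k * c k l) = T\<^sup>2 * \<beta> l - T * \<gamma> l - N * T * (\<beta> l)\<^sup>2 - N * ?\<sigma> * \<beta> l + 2 * N * (\<beta> l * \<gamma> l)
     + (\<Sum>j<N. b l j * \<gamma> j) - (\<Sum>k<N. b2 l k * b l k)" for l
  proof -
    let ?p = "\<beta> l * T - \<gamma> l" and ?n = "N * \<beta> l"
    have "(\<Sum>k<N. c2 l k * c k l) = (\<Sum>k<N. ?p * \<beta> k - ?p * b l k - ?n * (\<beta> k)\<^sup>2 + ?n * (b l k * \<beta> k) + b2 l k * \<beta> k - b2 l k * b l k)"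
      by (intro sum.cong refl) (simp add: c2_eq c_def sym[of _ l] algebra_simps power2_eq_square)
    also have "\<dots> = ?p * T - ?p * (\<Sum>k<N. b l k) - ?n * ?\<sigma> + ?n * \<gamma> l + (\<Sum>k<N. b2 l k * \<beta> k) - (\<Sum>k<N. b2 l k * b l k)"
      unfolding sum.distrib sum_subtractf sum_distrib_left[symmetric] T_def[symmetric] \<gamma>_def[symmetric] ..
    finally show ?thesis by (simp add: row_b b2_\<beta>) (simp add: algebra_simps power2_eq_square)
  qed
  have "(\<Sum>l<N. \<Sum>k<N. c2 l k * c k l) = T\<^sup>2 * T - T * (\<Sum>l<N. \<gamma> l) - N * T * ?\<sigma> - N * ?\<sigma> * T + 2 * N * ?\<kappa>
     + (\<Sum>l<N. \<Sum>j<N. b l j * \<gamma> j) - (\<Sum>l<N. \<Sum>k<N. b2 l k * b l k)"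
    unfolding row sum.distrib sum_subtractf sum_distrib_left[symmetric] T_def[symmetric] ..
  then show ?thesis by (simp add: b2_\<beta>_sum sum_\<gamma> algebra_simps power2_eq_square power3_eq_cube)
qed

lemma trace_c4: "(\<Sum>l<N. \<Sum>k<N. c2 l k * c2 k l) =
  (\<Sum>l<N. \<Sum>k<N. (b2 l k)\<^sup>2) - 4 * N * (\<Sum>l<N. (\<gamma> l)\<^sup>2) + 4 * N * (\<Sum>l<N. \<beta> l * \<gamma> l) * T
  + 2 * (N * (\<Sum>l<N. (\<beta> l)\<^sup>2))\<^sup>2 - 4 * N * (\<Sum>l<N. (\<beta> l)\<^sup>2) * T\<^sup>2 + T ^ 4"
proof -
  let ?\<sigma> = "\<Sum>l<N. (\<beta> l)\<^sup>2" and ?\<kappa> = "\<Sum>l<N. \<beta> l * \<gamma> l" and ?\<Gamma> = "\<Sum>l<N. (\<gamma> l)\<^sup>2"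
  let ?d = "\<lambda>l. \<Sum>j<N. b l j * \<gamma> j"
  have row: "(\<Sum>k<N. c2 l k * c2 k l) = (T ^ 3 - N * ?\<sigma> * T - N * ?\<sigma> * T + N * ?\<kappa>) * \<beta> l + (N * ?\<sigma> - T\<^sup>2) * \<gamma> l
     + (N\<^sup>2 * ?\<sigma> - N * T\<^sup>2) * (\<beta> l)\<^sup>2 + 2 * N * T * (\<beta> l * \<gamma> l) - N * (\<gamma> l)\<^sup>2 + T * ?d l - 2 * N * (\<beta> l * ?d l)
     - (\<Sum>k<N. b2 l k * \<gamma> k) + (\<Sum>k<N. (b2 l k)\<^sup>2)" for l
  proof -
    let ?p = "\<beta> l * T - \<gamma> l" and ?n = "N * \<beta> l" and ?t = "T - N * \<beta> l"
    have "(\<Sum>k<N. c2 l k * c2 k l) = (\<Sum>k<N. ?p * ?t * \<beta> k - ?p * \<gamma> k + ?p * b2 l k - ?n * ?t * (\<beta> k)\<^sup>2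
        + ?n * (\<beta> k * \<gamma> k) + (?t - ?n) * (b2 l k * \<beta> k) - b2 l k * \<gamma> k + (b2 l k)\<^sup>2)"
      by (intro sum.cong refl) (simp add: c2_eq b2_sym[of _ l] algebra_simps power2_eq_square)
    also have "\<dots> = ?p * ?t * T - ?p * (\<Sum>k<N. \<gamma> k) + ?p * (\<Sum>k<N. b2 l k) - ?n * ?t * ?\<sigma>
        + ?n * ?\<kappa> + (?t - ?n) * (\<Sum>k<N. b2 l k * \<beta> k) - (\<Sum>k<N. b2 l k * \<gamma> k) + (\<Sum>k<N. (b2 l k)\<^sup>2)"
      unfolding sum.distrib sum_subtractf sum_distrib_left[symmetric] T_def[symmetric] ..
    finally show ?thesis
      by (simp add: row_b2 b2_\<beta> sum_\<gamma>) (simp add: algebra_simps power2_eq_square power3_eq_cube)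
  qed
  have "(\<Sum>l<N. \<Sum>k<N. c2 l k * c2 k l) = (T ^ 3 - N * ?\<sigma> * T - N * ?\<sigma> * T + N * ?\<kappa>) * T + (N * ?\<sigma> - T\<^sup>2) * (\<Sum>l<N. \<gamma> l)
     + (N\<^sup>2 * ?\<sigma> - N * T\<^sup>2) * ?\<sigma> + 2 * N * T * ?\<kappa> - N * ?\<Gamma> + T * (\<Sum>l<N. ?d l) - 2 * N * (\<Sum>l<N. \<beta> l * ?d l)
     - (\<Sum>l<N. \<Sum>k<N. b2 l k * \<gamma> k) + (\<Sum>l<N. \<Sum>k<N. (b2 l k)\<^sup>2)"
    unfolding row sum.distrib sum_subtractf sum_distrib_left[symmetric] T_def[symmetric] ..
  then show ?thesis
    by (simp add: b2_\<beta>_sum sum_\<gamma> \<beta>_b2_\<beta> b2_\<gamma>_sum) (simp add: algebra_simps power2_eq_square power3_eq_cube power4_eq_xxxx)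
qed

section \<open>The matrix expressions in the estimators as traces\<close>

definition B where "B = Matrix.mat N N (\<lambda>(l, k). b l k)"

lemma B_carrier: "B \<in> carrier_mat N N"
  by (simp add: B_def)

lemma abs_sum_nonneg:
  assumes "\<And>l k. l < N \<Longrightarrow> k < N \<Longrightarrow> 0 \<le> f l k"
  shows "abs_sum (Matrix.mat N N (\<lambda>(l, k). f l k)) = (\<Sum>l<N. \<Sum>k<N. f l k)"
  using assms by (simp add: abs_sum_def)

lemma mat_mult_B: "Matrix.mat N N (\<lambda>(l, k). f l k) * B = Matrix.mat N N (\<lambda>(l, k). \<Sum>j<N. f l j * b j k)"
  by (rule eq_matI) (auto simp: B_def scalar_prod_def atLeast0LessThan)

lemma B_pow:
  "B ^\<^sub>m 2 = Matrix.mat N N (\<lambda>(l, k). b2 l k)"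
  "B ^\<^sub>m 3 = Matrix.mat N N (\<lambda>(l, k). \<Sum>j<N. b2 l j * b j k)"
  "B ^\<^sub>m 4 = Matrix.mat N N (\<lambda>(l, k). \<Sum>i<N. (\<Sum>j<N. b2 l j * b j i) * b i k)" (is ?A)
proof -
  show 2: "B ^\<^sub>m 2 = Matrix.mat N N (\<lambda>(l, k). b2 l k)"
    using mat_mult_B[of b] B_carrier by (simp add: numeral_2_eq_2 b2_def B_def[symmetric])
  then show 3: "B ^\<^sub>m 3 = Matrix.mat N N (\<lambda>(l, k). \<Sum>j<N. b2 l j * b j k)"
    by (simp add: eval_nat_numeral mat_mult_B)
  then show ?A
    by (simp add: eval_nat_numeral mat_mult_B)
qed

lemma b2_nonneg: "0 \<le> b2 l k"
  unfolding b2_def using nonneg by (intro sum_nonneg mult_nonneg_nonneg)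

lemma b3_nonneg: "0 \<le> (\<Sum>j<N. b2 l j * b j k)"
  using nonneg b2_nonneg by (intro sum_nonneg mult_nonneg_nonneg)

lemma abs_sum_B: "abs_sum B = N * T"
  unfolding B_def using nonneg by (subst abs_sum_nonneg) (auto simp: row_b T_def sum_distrib_left)

lemma abs_sum_B2: "abs_sum (B ^\<^sub>m 2) = N\<^sup>2 * (\<Sum>l<N. (\<beta> l)\<^sup>2)"
  unfolding B_pow using b2_nonneg
  by (subst abs_sum_nonneg) (simp_all add: row_b2 sum_\<gamma> power2_eq_square flip: sum_distrib_left)

lemma b3_sum: "(\<Sum>k<N. \<Sum>j<N. b2 l j * b j k) = N * (\<Sum>k<N. b2 l k * \<beta> k)"
  unfolding sum_swap_left by (simp add: row_b sum_distrib_left mult_ac)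

lemma abs_sum_B3: "abs_sum (B ^\<^sub>m 3) = N\<^sup>2 * (\<Sum>l<N. \<beta> l * \<gamma> l)"
  unfolding B_pow using b3_nonneg
  by (subst abs_sum_nonneg) (simp_all add: b3_sum b2_\<beta> b2_\<beta>_sum power2_eq_square flip: sum_distrib_left)

lemma abs_sum_B4: "abs_sum (B ^\<^sub>m 4) = N\<^sup>2 * (\<Sum>l<N. (\<gamma> l)\<^sup>2)"
proof -
  have "(\<Sum>k<N. \<Sum>i<N. (\<Sum>j<N. b2 l j * b j i) * b i k) = N * (\<Sum>j<N. b2 l j * \<gamma> j)" for l
  proof -
    have "(\<Sum>k<N. \<Sum>i<N. (\<Sum>j<N. b2 l j * b j i) * b i k) = (\<Sum>i<N. (\<Sum>j<N. b2 l j * b j i) * (N * \<beta> i))"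
      by (subst sum.swap) (simp add: row_b flip: sum_distrib_left)
    also have "\<dots> = (\<Sum>j<N. \<Sum>i<N. N * (b2 l j * (b j i * \<beta> i)))"
      unfolding sum_distrib_right by (subst sum.swap) (simp add: mult_ac)
    finally show ?thesis by (simp add: \<gamma>_def sum_distrib_left)
  qed
  moreover have "abs_sum (B ^\<^sub>m 4) = (\<Sum>l<N. \<Sum>k<N. \<Sum>i<N. (\<Sum>j<N. b2 l j * b j i) * b i k)"
    unfolding B_pow by (intro abs_sum_nonneg sum_nonneg mult_nonneg_nonneg b2_nonneg nonneg)
  ultimately show ?thesis by (simp add: b2_\<gamma>_sum power2_eq_square flip: sum_distrib_left)
qed

lemma hadamard_B: "Matrix.mat N N (\<lambda>(l, k). f l k) \<circ>\<^sub>H B = Matrix.mat N N (\<lambda>(l, k). f l k * b l k)"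
  by (rule eq_matI) (auto simp: hadamard_def B_def)

text \<open>The second summand is the diagonal of \<open>b\<close>, arbitrary in this abstract
  setting; for distance matrices it vanishes because \<open>psi\<close> is zero at the
  origin.\<close>

lemma mu1_eq: "mu1 N B = 1 / N * (\<Sum>l<N. a l l) + 1 / N * (\<Sum>l<N. b l l)"
proof -
  have "(\<Sum>l<N. a l l) = T - (\<Sum>l<N. b l l)"
    using N by (simp add: a_def sum_subtractf sum.distrib T_def[symmetric] flip: sum_distrib_left)
  then show ?thesis
    using N by (simp add: mu1_def abs_sum_B power2_eq_square diff_divide_distrib)
qed

lemma mu2_eq: "mu2 N B = 1 / N ^ 2 * (\<Sum>l<N. \<Sum>k<N. a l k * a k l)"
proof -
  have "abs_sum (B \<circ>\<^sub>H B) = (\<Sum>l<N. \<Sum>k<N. (b l k)\<^sup>2)"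
    using hadamard_B[of b] nonneg by (simp add: B_def[symmetric] abs_sum_nonneg power2_eq_square)
  then show ?thesis
    unfolding mu2_def abs_sum_B abs_sum_B2 trace_a2 trace_c2 using N
    by (simp add: field_simps power2_eq_square power3_eq_cube power4_eq_xxxx)
qed

lemma mu3_eq: "mu3 N B = 1 / N ^ 3 * (\<Sum>l<N. \<Sum>k<N. a2 l k * a k l)"
proof -
  have "abs_sum (B ^\<^sub>m 2 \<circ>\<^sub>H B) = (\<Sum>l<N. \<Sum>k<N. b2 l k * b l k)"
    unfolding B_pow hadamard_B using nonneg b2_nonneg by (intro abs_sum_nonneg) simp
  then show ?thesis
    unfolding mu3_def abs_sum_B abs_sum_B2 abs_sum_B3 trace_a3 trace_c3 using N
    by (simp add: field_simps eval_nat_numeral)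
qed

lemma mu4_eq: "mu4 N B = 1 / N ^ 4 * (\<Sum>l<N. \<Sum>k<N. a2 l k * a2 k l)"
proof -
  have "abs_sum (B ^\<^sub>m 3 \<circ>\<^sub>H B) = (\<Sum>l<N. \<Sum>k<N. (\<Sum>j<N. b2 l j * b j k) * b l k)"
    unfolding B_pow hadamard_B using nonneg b3_nonneg by (intro abs_sum_nonneg) simp
  \<comment> \<open>By symmetry the Hadamard sum of the cube with \<open>B\<close> is the trace of
    the fourth power, which regroups into a sum of squared entries of the square.\<close>
  also have "\<dots> = (\<Sum>l<N. \<Sum>j<N. \<Sum>k<N. b2 l j * (b l k * b k j))"
    unfolding sum_distrib_right
  proof (rule sum.cong[OF refl])
    fix l
    have *: "b2 l j * b j k * b l k = b2 l j * (b l k * b k j)" for j k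
      using sym[of j k] by simp
    have "(\<Sum>k<N. \<Sum>j<N. b2 l j * b j k * b l k) = (\<Sum>j<N. \<Sum>k<N. b2 l j * b j k * b l k)"
      by (rule sum.swap)
    then show "(\<Sum>k<N. \<Sum>j<N. b2 l j * b j k * b l k) = (\<Sum>j<N. \<Sum>k<N. b2 l j * (b l k * b k j))"
      by (simp only: *)
  qed
  also have "\<dots> = (\<Sum>l<N. \<Sum>k<N. (b2 l k)\<^sup>2)"
    by (simp add: b2_def[symmetric] power2_eq_square flip: sum_distrib_left)
  finally show ?thesis
    unfolding mu4_def abs_sum_B abs_sum_B2 abs_sum_B3 abs_sum_B4 trace_a4 trace_c4 using N
    by (simp add: field_simps eval_nat_numeral)
qed

end

section \<open>Empirical characteristic functions\<close>

lemma sum_rotate: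
  "(\<Sum>k\<in>K. \<Sum>l\<in>L. \<Sum>j\<in>J. g k l j) = (\<Sum>j\<in>J. \<Sum>k\<in>K. \<Sum>l\<in>L. g k l j)"
proof -
  have "(\<Sum>k\<in>K. \<Sum>l\<in>L. \<Sum>j\<in>J. g k l j) = (\<Sum>k\<in>K. \<Sum>j\<in>J. \<Sum>l\<in>L. g k l j)"
    by (rule sum.cong[OF refl]) (rule sum.swap)
  also have "\<dots> = (\<Sum>j\<in>J. \<Sum>k\<in>K. \<Sum>l\<in>L. g k l j)"
    by (rule sum.swap)
  finally show ?thesis .
qed

locale levy_measure =
  fixes d :: nat and \<rho> :: "(nat \<Rightarrow> real) measure"
  assumes admissible: "admissible_measure d \<rho>"
begin

lemma sets_\<rho>: "sets \<rho> = sets (euclid_borel d)"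
  using admissible by (simp add: admissible_measure_def)

lemma sigma_finite_\<rho>: "sigma_finite_measure \<rho>"
  using admissible by (simp add: admissible_measure_def)

sublocale sfm \<rho>
  using admissible by (simp add: admissible_measure_def sfm_def)

lemma coordinate_measurable: "(\<lambda>t. t j) \<in> borel_measurable (euclid_borel d)"
  unfolding euclid_borel_def by (intro measurable_restrict_space1 measurable_product_coordinates)

lemma dotp_measurable:
  assumes "f \<in> measurable N (euclid_borel d)" "g \<in> measurable N (euclid_borel d)"
  shows "(\<lambda>x. dotp d (f x) (g x)) \<in> borel_measurable N"
  unfolding dotp_def
  by (intro borel_measurable_sum borel_measurable_times measurable_compose[OF _ coordinate_measurable] assms)

lemma measurable_\<rho>: "measurable N \<rho> = measurable N (euclid_borel d)"
  by (rule measurable_cong_sets) (simp_all add: sets_\<rho>)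

lemma dotp_const_measurable[measurable]: "dotp d x \<in> borel_measurable \<rho>"
proof -
  have "(\<lambda>t. t j) \<in> borel_measurable \<rho>" for j
    using coordinate_measurable by (simp cong: measurable_cong_sets add: sets_\<rho>)
  then show ?thesis
    unfolding dotp_def by (intro borel_measurable_sum borel_measurable_times borel_measurable_const)
qed

lemma dotp_diff: "dotp d x (s - t) = dotp d x s - dotp d x t" "dotp d (x - y) t = dotp d x t - dotp d y t"
  by (simp_all add: dotp_def algebra_simps sum_subtractf)

lemma dotp_uminus: "dotp d x (- t) = - dotp d x t"
  by (simp add: dotp_def sum_negf)

lemma uminus_measurable[measurable]: "uminus \<in> measurable \<rho> \<rho>"
proof -
  have "uminus \<in> measurable (borel :: (nat \<Rightarrow> real) measure) borel"
  proof (rule measurable_coordinatewise_then_product)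
    fix i
    have "(\<lambda>x. - (x i)) \<in> borel_measurable (borel :: (nat \<Rightarrow> real) measure)"
      by (intro borel_measurable_uminus measurable_product_coordinates)
    then show "(\<lambda>x. (- x) i) \<in> borel_measurable (borel :: (nat \<Rightarrow> real) measure)" by simp
  qed
  then have "uminus \<in> measurable (euclid_borel d) (euclid_borel d)"
    unfolding euclid_borel_def
    by (intro measurable_restrict_space3) (auto simp: topspace_Euclidean_space)
  then show ?thesis by (simp cong: measurable_cong_sets add: sets_\<rho>)
qed

text \<open>Admissibility states symmetry through images; negation is an involution, so preimages
  are images and reflection becomes a change of variables.\<close>

lemma distr_uminus: "distr \<rho> \<rho> uminus = \<rho>"
proof (rule measure_eqI)
  fix A assume "A \<in> sets (distr \<rho> \<rho> uminus)"
  then have A: "A \<in> sets \<rho>" by simp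
  have "uminus -` A \<inter> space \<rho> = uminus ` A"
  proof -
    have "A \<subseteq> space \<rho>" using A sets.sets_into_space by blast
    then show ?thesis
      using measurable_space[OF uminus_measurable] by (force simp: image_iff)
  qed
  then have "emeasure (distr \<rho> \<rho> uminus) A = emeasure \<rho> (uminus ` A)"
    using A by (simp add: emeasure_distr)
  then show "emeasure (distr \<rho> \<rho> uminus) A = emeasure \<rho> A"
    using admissible A by (simp add: admissible_measure_def)
qed simp

lemma min_norm_integrable: "integrable \<rho> (\<lambda>t. min 1 (dotp d t t))"
proof (rule integrableI_nonneg)
  show "(\<lambda>t. min 1 (dotp d t t)) \<in> borel_measurable \<rho>"
    by (intro borel_measurable_min borel_measurable_const dotp_measurable) (simp_all flip: measurable_\<rho>)
  show "AE t in \<rho>. 0 \<le> min 1 (dotp d t t)"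
    by (intro AE_I2) (auto simp: dotp_def intro!: sum_nonneg)
qed (use admissible in \<open>simp add: admissible_measure_def\<close>)

text \<open>The summand 2 covers large \<open>t\<close>, where the minimum is 1;
  \<open>dotp d x x\<close> covers small \<open>t\<close> through the quadratic bound on the cosine
  and Cauchy-Schwarz.\<close>

lemma one_minus_cos_le:
  "1 - cos (dotp d x t) \<le> (2 + dotp d x x) * min 1 (dotp d t t)"
proof -
  let ?u = "dotp d x t" and ?X = "dotp d x x" and ?Y = "dotp d t t"
  have nonneg: "0 \<le> ?X" "0 \<le> ?Y" by (auto simp: dotp_def intro!: sum_nonneg)
  have "?u\<^sup>2 \<le> ?X * ?Y"
    using Cauchy_Schwarz_ineq_sum[of x t "{..<d}"] by (simp add: dotp_def power2_eq_square)
  moreover have "1 - cos ?u \<le> ?u\<^sup>2 / 2"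
  proof -
    have "(sin (?u / 2))\<^sup>2 \<le> (?u / 2)\<^sup>2"
      using abs_sin_x_le_abs_x[of "?u / 2"] by (rule abs_le_square_iff[THEN iffD1])
    then show ?thesis using cos_double_sin[of "?u / 2"] by (simp add: power_divide)
  qed
  moreover have "1 - cos ?u \<le> 2" using cos_ge_minus_one[of ?u] by linarith
  moreover have XY: "0 \<le> ?X * ?Y" using nonneg by simp
  show ?thesis
  proof (cases "?Y \<le> 1")
    case True
    then have "min 1 ?Y = ?Y" by simp
    then show ?thesis using calculation XY nonneg by (simp only: distrib_right)
  next
    case False
    then have "min 1 ?Y = 1" by simp
    then show ?thesis using calculation XY nonneg by (simp only: distrib_right)
  qed
qed

lemma one_minus_cos_integrable: "integrable \<rho> (\<lambda>t. 1 - cos (dotp d x t))"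
proof (rule Bochner_Integration.integrable_bound)
  show "integrable \<rho> (\<lambda>t. (2 + dotp d x x) * min 1 (dotp d t t))"
    using min_norm_integrable by simp
  show "AE t in \<rho>. norm (1 - cos (dotp d x t)) \<le> norm ((2 + dotp d x x) * min 1 (dotp d t t))"
    using one_minus_cos_le[of x] by (intro AE_I2) (auto intro: order_trans[OF _ abs_ge_self])
qed measurable

lemma psi_nonneg: "0 \<le> psi d \<rho> x"
  unfolding psi_def by (intro integral_nonneg_AE) simp

lemma psi_minus: "psi d \<rho> (x - y) = psi d \<rho> (y - x)"
proof -
  have "dotp d (x - y) t = - dotp d (y - x) t" for t by (simp add: dotp_diff)
  then show ?thesis unfolding psi_def by simp
qed

end

text \<open>The covariance kernel of \<open>t \<mapsto> exp(iX\<cdot>t)\<close> when \<open>f\<close> is the characteristic function of \<open>X\<close>.\<close>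

definition cov_kernel :: "((nat \<Rightarrow> real) \<Rightarrow> complex) \<Rightarrow> (nat \<Rightarrow> real) \<Rightarrow> (nat \<Rightarrow> real) \<Rightarrow> complex" where
  "cov_kernel f s t = f (s - t) - f s * f (- t)"

definition ecf :: "nat \<Rightarrow> nat \<Rightarrow> (nat \<Rightarrow> nat \<Rightarrow> real) \<Rightarrow> (nat \<Rightarrow> real) \<Rightarrow> complex" where
  "ecf N d x t = (\<Sum>l<N. cis (dotp d (x l) t)) / N"

locale sample = levy_measure +
  fixes N :: nat and x :: "nat \<Rightarrow> nat \<Rightarrow> real"
  assumes N: "0 < N"
begin

sublocale sym_array N "\<lambda>l k. psi d \<rho> (x l - x k)"
  by unfold_locales (auto simp: N psi_nonneg psi_minus)

definition f where "f = ecf N d x"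
definition D where "D l t = cis (dotp d (x l) t) - f t"

lemma f_uminus: "f (- t) = cnj (f t)"
  by (simp add: f_def ecf_def dotp_uminus cis_cnj)

lemma D_uminus: "D l (- t) = cnj (D l t)"
  by (simp add: D_def f_uminus dotp_uminus cis_cnj)

lemma f_measurable[measurable]: "f \<in> borel_measurable \<rho>"
  unfolding f_def ecf_def cis_conv_exp by measurable

lemma D_measurable[measurable]: "D l \<in> borel_measurable \<rho>"
  unfolding D_def cis_conv_exp by measurable

lemma D_D_measurable: "(\<lambda>t. cnj (D l t) * D k t) \<in> borel_measurable \<rho>"
proof -
  have "(\<lambda>t. cnj (D l t)) \<in> borel_measurable \<rho>"
    by (intro measurable_compose[OF D_measurable] borel_measurable_continuous_onI continuous_intros)
  then show ?thesis by (intro borel_measurable_times D_measurable)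
qed

text \<open>The empirical covariance of the exponentials: centring by their sample mean
  \<open>f\<close> produces the subtracted product. It exhibits the kernel as one of finite
  rank.\<close>

lemma cov_kernel_eq: "cov_kernel f s t = (\<Sum>l<N. D l s * cnj (D l t)) / N"
proof -
  have Sf: "(\<Sum>l<N. cis (dotp d (x l) u)) = N * f u" for u
    using N by (simp add: f_def ecf_def)
  have "(\<Sum>l<N. D l s * cnj (D l t)) = (\<Sum>l<N. cis (dotp d (x l) (s - t)) - cis (dotp d (x l) s) * cnj (f t)
      - f s * cnj (cis (dotp d (x l) t)) + f s * cnj (f t))"
    by (intro sum.cong refl) (simp add: D_def dotp_diff algebra_simps cis_mult cis_cnj)
  also have "\<dots> = N * f (s - t) - N * f s * cnj (f t) - f s * cnj (N * f t) + N * (f s * cnj (f t))"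
    unfolding sum.distrib sum_subtractf sum_distrib_left[symmetric] sum_distrib_right[symmetric] cnj_sum[symmetric] Sf
    by simp
  finally show ?thesis
    using N by (simp add: cov_kernel_def f_uminus field_simps)
qed

text \<open>Expressed through \<open>1 - cos\<close> because that is what is integrable when
  \<open>\<rho>\<close> is infinite. The constants cancel, the four terms carrying total weight
  zero.\<close>

lemma Re_D_D: "Re (cnj (D l t) * D k t) =
  (\<Sum>j<N. 1 - cos (dotp d (x l - x j) t)) / N + (\<Sum>j<N. 1 - cos (dotp d (x k - x j) t)) / N
  - (\<Sum>i<N. \<Sum>j<N. 1 - cos (dotp d (x i - x j) t)) / N\<^sup>2 - (1 - cos (dotp d (x l - x k) t))"
proof -
  let ?e = "\<lambda>l. cis (dotp d (x l) t)"
  have e: "Re (cnj (?e l) * ?e k) = cos (dotp d (x l - x k) t)" for l k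
    by (simp add: dotp_diff cos_diff)
  have ft: "f t = (\<Sum>j<N. ?e j) / N" by (simp add: f_def ecf_def)
  have 1: "Re (cnj (?e l) * f t) = (\<Sum>j<N. cos (dotp d (x l - x j) t)) / N" for l
    unfolding ft e[symmetric] times_divide_eq_right sum_distrib_left Re_divide_of_nat Re_sum ..
  have 2: "Re (cnj (f t) * ?e k) = (\<Sum>j<N. cos (dotp d (x k - x j) t)) / N"
  proof -
    have "Re (cnj (f t) * ?e k) = Re (cnj (?e k) * f t)" by simp
    then show ?thesis unfolding 1 .
  qed
  have 3: "Re (cnj (f t) * f t) = (\<Sum>i<N. \<Sum>j<N. cos (dotp d (x i - x j) t)) / N\<^sup>2"
  proof -
    have "cnj (f t) * f t = (\<Sum>i<N. \<Sum>j<N. cnj (?e i) * ?e j) / N\<^sup>2"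
      by (simp add: ft sum_product power2_eq_square)
    then have "Re (cnj (f t) * f t) = (\<Sum>i<N. \<Sum>j<N. Re (cnj (?e i) * ?e j)) / N\<^sup>2"
      by (simp only: Re_divide_of_nat Re_sum of_nat_power[symmetric])
    then show ?thesis by (simp only: e of_nat_power)
  qed
  have "Re (cnj (D l t) * D k t) = Re (cnj (?e l) * ?e k) - Re (cnj (?e l) * f t) - Re (cnj (f t) * ?e k) + Re (cnj (f t) * f t)"
    by (simp add: D_def algebra_simps)
  also have "\<dots> = (\<Sum>j<N. 1 - cos (dotp d (x l - x j) t)) / N + (\<Sum>j<N. 1 - cos (dotp d (x k - x j) t)) / N
      - (\<Sum>i<N. \<Sum>j<N. 1 - cos (dotp d (x i - x j) t)) / N\<^sup>2 - (1 - cos (dotp d (x l - x k) t))"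
    unfolding e 1 2 3 using N by (simp add: sum_subtractf field_simps power2_eq_square)
  finally show ?thesis .
qed

lemma D_D_integrable: "integrable \<rho> (\<lambda>t. cnj (D l t) * D k t)"
proof (rule Bochner_Integration.integrable_bound)
  have sq: "integrable \<rho> (\<lambda>t. (cmod (D l t))\<^sup>2)" for l
  proof -
    have "(cmod (D l t))\<^sup>2 = Re (cnj (D l t) * D l t)" for t
      by (metis Re_complex_of_real complex_norm_square mult.commute of_real_power)
    then show ?thesis
      unfolding Re_D_D
      by (simp only:) (intro Bochner_Integration.integrable_add Bochner_Integration.integrable_diff
          Bochner_Integration.integrable_sum integrable_divide_zero one_minus_cos_integrable impI)
  qed
  show "integrable \<rho> (\<lambda>t. (cmod (D l t))\<^sup>2 + (cmod (D k t))\<^sup>2)" using sq by simp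
  show "AE t in \<rho>. norm (cnj (D l t) * D k t) \<le> norm ((cmod (D l t))\<^sup>2 + (cmod (D k t))\<^sup>2)"
  proof (rule AE_I2)
    fix t
    have "2 * (cmod (D l t) * cmod (D k t)) \<le> (cmod (D l t))\<^sup>2 + (cmod (D k t))\<^sup>2"
      using sum_squares_bound[of "cmod (D l t)" "cmod (D k t)"] by simp
    moreover have "0 \<le> cmod (D l t) * cmod (D k t)" by simp
    ultimately show "norm (cnj (D l t) * D k t) \<le> norm ((cmod (D l t))\<^sup>2 + (cmod (D k t))\<^sup>2)"
      unfolding norm_mult complex_mod_cnj real_norm_def by linarith
  qed
qed (rule D_D_measurable)

text \<open>The Gram matrix of the centred exponentials is the negated doubly centred distance
  matrix. The real part follows from \<open>Re_D_D\<close>, the imaginary part vanishes by the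
  symmetry of \<open>\<rho>\<close>.\<close>

lemma integral_D_D: "(LINT t|\<rho>. cnj (D l t) * D k t) = of_real (a l k)"
proof -
  let ?I = "LINT t|\<rho>. cnj (D l t) * D k t"
  \<comment> \<open>Reflection conjugates the integrand, so the integral equals its own
    conjugate.\<close>
  have "?I = (LINT t|distr \<rho> \<rho> uminus. cnj (D l t) * D k t)" by (simp add: distr_uminus)
  also have "\<dots> = (LINT t|\<rho>. cnj (D l (- t)) * D k (- t))"
    by (rule integral_distr[OF uminus_measurable D_D_measurable])
  also have "\<dots> = cnj ?I"
  proof -
    have "cnj ?I = (LINT t|\<rho>. cnj (cnj (D l t) * D k t))"
      by (rule Bochner_Integration.integral_cnj[symmetric])
    then show ?thesis by (simp add: D_uminus)
  qed
  finally have "Im ?I = 0" by (simp add: complex_eq_iff)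
  have "Re ?I = (LINT t|\<rho>. Re (cnj (D l t) * D k t))"
    by (rule integral_Re[OF D_D_integrable, symmetric])
  also have "\<dots> = (\<Sum>j<N. psi d \<rho> (x l - x j)) / N + (\<Sum>j<N. psi d \<rho> (x k - x j)) / N
      - (\<Sum>i<N. \<Sum>j<N. psi d \<rho> (x i - x j)) / N\<^sup>2 - psi d \<rho> (x l - x k)"
  proof -
    have "has_bochner_integral \<rho> (\<lambda>t. 1 - cos (dotp d z t)) (psi d \<rho> z)" for z
      unfolding psi_def by (rule has_bochner_integral_integrable[OF one_minus_cos_integrable])
    then show ?thesis
      unfolding Re_D_D
      by (intro has_bochner_integral_integral_eq has_bochner_integral_add has_bochner_integral_diff
          has_bochner_integral_divide_zero has_bochner_integral_sum)
  qed
  also have "\<dots> = a l k"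
    by (simp add: a_def T_def \<beta>_def power2_eq_square flip: sum_divide_distrib)
  finally show ?thesis using \<open>Im ?I = 0\<close> by (simp add: complex_eq_iff)
qed


section \<open>Finite-rank kernels spanned by the centred exponentials\<close>

definition lincomb_kernel :: "(nat \<Rightarrow> nat \<Rightarrow> real) \<Rightarrow> (nat \<Rightarrow> real) \<Rightarrow> (nat \<Rightarrow> real) \<Rightarrow> complex" where
  "lincomb_kernel m s t = (\<Sum>l<N. \<Sum>k<N. of_real (m l k) * (D l s * cnj (D k t)))"

text \<open>Integrating out the middle variable inserts the Gram matrix: coefficient matrices
  compose as \<open>m a m'\<close>, and kernel algebra turns into matrix algebra.\<close>

lemma kcomp_lincomb:
  "kcomp \<rho> (lincomb_kernel m) (lincomb_kernel m') = lincomb_kernel (\<lambda>l k'. \<Sum>k<N. \<Sum>l'<N. m l k * a k l' * m' l' k')"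
proof (intro ext)
  fix s t
  have int: "integrable \<rho> (\<lambda>u. z * (cnj (D k u) * D l' u))" for z k l'
    using D_D_integrable by simp
  have "kcomp \<rho> (lincomb_kernel m) (lincomb_kernel m') s t
    = (LINT u|\<rho>. (\<Sum>l<N. \<Sum>l'<N. \<Sum>k<N. \<Sum>k'<N. of_real (m l k) * of_real (m' l' k') * D l s * cnj (D k' t) * (cnj (D k u) * D l' u)))"
    unfolding kcomp_def lincomb_kernel_def sum_product
    by (intro Bochner_Integration.integral_cong refl)
       (simp add: sum_distrib_left sum_distrib_right mult_ac)
  also have "\<dots> = (\<Sum>l<N. \<Sum>l'<N. \<Sum>k<N. \<Sum>k'<N. of_real (m l k) * of_real (m' l' k') * D l s * cnj (D k' t) * of_real (a k l'))"
    by (simp add: int integral_D_D)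
  also have "\<dots> = (\<Sum>l<N. \<Sum>k'<N. \<Sum>k<N. \<Sum>l'<N. of_real (m l k) * of_real (m' l' k') * D l s * cnj (D k' t) * of_real (a k l'))"
    by (rule sum.cong[OF refl], subst sum_rotate, rule sum.cong[OF refl]) (rule sum.swap)
  also have "\<dots> = lincomb_kernel (\<lambda>l k'. \<Sum>k<N. \<Sum>l'<N. m l k * a k l' * m' l' k') s t"
    unfolding lincomb_kernel_def by (simp add: sum_distrib_left sum_distrib_right mult_ac)
  finally show "kcomp \<rho> (lincomb_kernel m) (lincomb_kernel m') s t
    = lincomb_kernel (\<lambda>l k'. \<Sum>k<N. \<Sum>l'<N. m l k * a k l' * m' l' k') s t" .
qed

lemma ktrace_lincomb: "ktrace \<rho> (lincomb_kernel m) = of_real (\<Sum>l<N. \<Sum>k<N. m l k * a k l)"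
proof -
  have int: "integrable \<rho> (\<lambda>u. z * (cnj (D k u) * D l' u))" for z k l'
    using D_D_integrable by simp
  have "ktrace \<rho> (lincomb_kernel m) = (LINT t|\<rho>. (\<Sum>l<N. \<Sum>k<N. of_real (m l k) * (cnj (D k t) * D l t)))"
    by (simp add: ktrace_def lincomb_kernel_def mult_ac)
  then show ?thesis by (simp add: int integral_D_D)
qed

text \<open>The identity matrix divided by \<open>N\<close>, which is the coefficient matrix of the
  empirical kernel itself.\<close>

definition one_kernel :: "nat \<Rightarrow> nat \<Rightarrow> real" where
  "one_kernel l k = (if l = k then 1 / N else 0)"

lemma cov_kernel_lincomb: "cov_kernel f = lincomb_kernel one_kernel"
proof (intro ext)
  fix s t
  have "lincomb_kernel one_kernel s t = (\<Sum>l<N. \<Sum>k<N. if l = k then of_real (1 / N) * (D l s * cnj (D k t)) else 0)"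
    unfolding lincomb_kernel_def one_kernel_def by (intro sum.cong refl) simp
  then show "cov_kernel f s t = lincomb_kernel one_kernel s t"
    by (simp add: cov_kernel_eq sum_divide_distrib)
qed

lemma one_kernel_sum:
  "(\<Sum>k<N. one_kernel l k * g k) = (if l < N then g l / N else 0)" (is ?A)
  "(\<Sum>k<N. g k * one_kernel k l) = (if l < N then g l / N else 0)" (is ?B)
proof -
  have "(\<Sum>k<N. one_kernel l k * g k) = (\<Sum>k<N. if l = k then g k / N else 0)"
    by (intro sum.cong refl) (simp add: one_kernel_def)
  then show ?A by simp
  have "(\<Sum>k<N. g k * one_kernel k l) = (\<Sum>k<N. if l = k then g k / N else 0)"
    by (intro sum.cong refl) (simp add: one_kernel_def)
  then show ?B by simp
qed

lemma lincomb_kernel_cong: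
  "(\<And>l k. l < N \<Longrightarrow> k < N \<Longrightarrow> m l k = m' l k) \<Longrightarrow> lincomb_kernel m = lincomb_kernel m'"
  unfolding lincomb_kernel_def by (intro ext sum.cong refl) simp

lemma kcomp_cov_lincomb:
  "kcomp \<rho> (lincomb_kernel m) (cov_kernel f) = lincomb_kernel (\<lambda>l j. 1 / N * (\<Sum>k<N. m l k * a k j))"
  unfolding cov_kernel_lincomb kcomp_lincomb
proof (rule lincomb_kernel_cong)
  fix l j assume "j < N"
  then show "(\<Sum>k<N. \<Sum>l'<N. m l k * a k l' * one_kernel l' j) = 1 / N * (\<Sum>k<N. m l k * a k j)"
    by (simp add: one_kernel_sum sum_divide_distrib)
qed

lemma kcomp_cov_cov: "kcomp \<rho> (cov_kernel f) (cov_kernel f) = lincomb_kernel (\<lambda>l j. 1 / N ^ 2 * a l j)"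
  unfolding cov_kernel_lincomb[symmetric] kcomp_cov_lincomb[of one_kernel, folded cov_kernel_lincomb]
  by (rule lincomb_kernel_cong) (simp add: one_kernel_sum power2_eq_square)

abbreviation "B\<^sub>N \<equiv> dist_mat N d \<rho> x"

lemma B_dist_mat: "B = B\<^sub>N"
  by (simp add: B_def dist_mat_def)

lemma psi_0: "psi d \<rho> 0 = 0"
  by (simp add: psi_def dotp_def)

lemma ktrace_1: "ktrace \<rho> (cov_kernel f) = of_real (mu1 N B\<^sub>N)"
  using mu1_eq by (simp add: cov_kernel_lincomb ktrace_lincomb one_kernel_sum B_dist_mat psi_0 sum_divide_distrib)

lemma ktrace_2: "ktrace \<rho> (kcomp \<rho> (cov_kernel f) (cov_kernel f)) = of_real (mu2 N B\<^sub>N)"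
  using mu2_eq by (simp add: kcomp_cov_cov ktrace_lincomb B_dist_mat sum_divide_distrib)

lemma ktrace_3:
  "ktrace \<rho> (kcomp \<rho> (kcomp \<rho> (cov_kernel f) (cov_kernel f)) (cov_kernel f)) = of_real (mu3 N B\<^sub>N)"
proof -
  have "(\<Sum>l<N. \<Sum>j<N. (1 / N * (\<Sum>k<N. 1 / N ^ 2 * a l k * a k j)) * a j l) = mu3 N B\<^sub>N"
    using mu3_eq by (simp add: B_dist_mat a2_def sum_divide_distrib sum_distrib_left power3_eq_cube power2_eq_square mult_ac)
  then show ?thesis by (simp only: kcomp_cov_cov kcomp_cov_lincomb ktrace_lincomb)
qed

lemma ktrace_4:
  "ktrace \<rho> (kcomp \<rho> (kcomp \<rho> (cov_kernel f) (cov_kernel f)) (kcomp \<rho> (cov_kernel f) (cov_kernel f))) = of_real (mu4 N B\<^sub>N)"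
proof -
  have "(\<Sum>l<N. \<Sum>j<N. (\<Sum>k<N. \<Sum>i<N. (1 / N ^ 2 * a l k) * a k i * (1 / N ^ 2 * a i j)) * a j l)
    = (\<Sum>l<N. \<Sum>j<N. \<Sum>i<N. 1 / N ^ 4 * (a2 l i * (a i j * a j l)))"
  proof (rule sum.cong[OF refl], rule sum.cong[OF refl])
    fix l j
    have "(\<Sum>k<N. \<Sum>i<N. (1 / N ^ 2 * a l k) * a k i * (1 / N ^ 2 * a i j)) * a j l
      = (\<Sum>i<N. \<Sum>k<N. (1 / N ^ 2 * a l k) * a k i * (1 / N ^ 2 * a i j)) * a j l"
      by (subst sum.swap) (rule refl)
    also have "\<dots> = (\<Sum>i<N. 1 / N ^ 4 * (a2 l i * (a i j * a j l)))"
      by (simp add: a2_def sum_distrib_right sum_distrib_left sum_divide_distrib power4_eq_xxxx power2_eq_square mult_ac)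
    finally show "(\<Sum>k<N. \<Sum>i<N. (1 / N ^ 2 * a l k) * a k i * (1 / N ^ 2 * a i j)) * a j l
      = (\<Sum>i<N. 1 / N ^ 4 * (a2 l i * (a i j * a j l)))" .
  qed
  also have "\<dots> = 1 / N ^ 4 * (\<Sum>l<N. \<Sum>i<N. a2 l i * a2 i l)"
  proof -
    have *: "a2 l i * a2 i l = (\<Sum>j<N. a2 l i * (a i j * a j l))" for l i
      by (simp add: a2_def[of i l] sum_distrib_left)
    show ?thesis
      unfolding * sum_distrib_left by (rule sum.cong[OF refl]) (rule sum.swap)
  qed
  also have "\<dots> = mu4 N B\<^sub>N" using mu4_eq by (simp add: B_dist_mat)
  finally show ?thesis by (simp only: kcomp_cov_cov kcomp_lincomb ktrace_lincomb)
qed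

text \<open>Cauchy-Schwarz over the sample reduces the claim to the diagonal
  \<open>1 - |f|\<^sup>2\<close>. This is weakened to \<open>2 * (1 - Re f)\<close>, which is linear
  in the empirical characteristic function, so that its integral is a sample mean.\<close>

lemma cmod_cov_kernel_le: "cmod (cov_kernel f s t) \<le> sqrt (2 * (1 - Re (f s))) * sqrt (2 * (1 - Re (f t)))"
proof -
  have diag: "(\<Sum>l<N. (cmod (D l t))\<^sup>2) \<le> N * (2 * (1 - Re (f t)))" for t
  proof -
    have "of_real (\<Sum>l<N. (cmod (D l t))\<^sup>2) = (\<Sum>l<N. D l t * cnj (D l t))"
      by (simp only: of_real_sum complex_norm_square)
    also have "\<dots> = N * cov_kernel f t t" using N by (simp add: cov_kernel_eq)
    also have "cov_kernel f t t = of_real (1 - (cmod (f t))\<^sup>2)"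
    proof -
      have "f 0 = 1" using N by (simp add: f_def ecf_def dotp_def)
      then show ?thesis by (simp add: cov_kernel_def f_uminus complex_norm_square del: of_real_power)
    qed
    finally have "(\<Sum>l<N. (cmod (D l t))\<^sup>2) = N * (1 - (cmod (f t))\<^sup>2)"
      by (metis (no_types, lifting) of_real_eq_iff of_real_mult of_real_of_nat_eq)
    moreover have "1 - (cmod (f t))\<^sup>2 \<le> 2 * (1 - Re (f t))"
    proof -
      have "0 \<le> (1 - Re (f t))\<^sup>2 + (Im (f t))\<^sup>2" by simp
      then show ?thesis unfolding cmod_power2 by (simp add: power2_diff)
    qed
    ultimately show ?thesis by (simp add: mult_left_mono)
  qed
  have "cmod (cov_kernel f s t) \<le> (\<Sum>l<N. cmod (D l s) * cmod (D l t)) / N"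
    unfolding cov_kernel_eq norm_divide using N
    by (intro divide_mono order_trans[OF norm_sum] sum_mono) (auto simp: norm_mult intro: sum_nonneg)
  also have "\<dots> \<le> sqrt ((\<Sum>l<N. (cmod (D l s))\<^sup>2) * (\<Sum>l<N. (cmod (D l t))\<^sup>2)) / N"
    by (intro divide_right_mono real_le_rsqrt Cauchy_Schwarz_ineq_sum) simp
  also have "\<dots> \<le> sqrt ((N * (2 * (1 - Re (f s)))) * (N * (2 * (1 - Re (f t))))) / N"
    by (intro divide_right_mono real_sqrt_le_mono mult_mono diag order_trans[OF _ diag] sum_nonneg) auto
  also have "\<dots> = sqrt (2 * (1 - Re (f s))) * sqrt (2 * (1 - Re (f t)))"
  proof -
    have "(N * a) * (N * b) = (real N)\<^sup>2 * (a * b)" for a b :: real by (simp add: power2_eq_square)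
    then have "sqrt ((N * a) * (N * b)) = N * (sqrt a * sqrt b)" for a b :: real
      by (simp only: real_sqrt_mult real_sqrt_abs)
    then show ?thesis using N by simp
  qed
  finally show ?thesis .
qed

lemma Re_f_le_1: "Re (f t) \<le> 1"
proof -
  have "Re (f t) = (\<Sum>l<N. cos (dotp d (x l) t)) / N"
    unfolding f_def ecf_def Re_divide_of_nat Re_sum by simp
  also have "\<dots> \<le> (\<Sum>l<N. 1) / N" by (intro divide_right_mono sum_mono) auto
  finally show ?thesis using N by simp
qed

lemma one_minus_Re_f: "has_bochner_integral \<rho> (\<lambda>t. 1 - Re (f t)) ((\<Sum>l<N. psi d \<rho> (x l)) / N)"
proof -
  have "has_bochner_integral \<rho> (\<lambda>t. 1 - cos (dotp d z t)) (psi d \<rho> z)" for z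
    unfolding psi_def by (rule has_bochner_integral_integrable[OF one_minus_cos_integrable])
  then have "has_bochner_integral \<rho> (\<lambda>t. (\<Sum>l<N. 1 - cos (dotp d (x l) t)) / N) ((\<Sum>l<N. psi d \<rho> (x l)) / N)"
    by (intro has_bochner_integral_divide_zero has_bochner_integral_sum)
  moreover have "(\<Sum>l<N. 1 - cos (dotp d (x l) t)) / N = 1 - Re (f t)" for t
    using N unfolding f_def ecf_def Re_divide_of_nat Re_sum by (simp add: sum_subtractf diff_divide_distrib)
  ultimately show ?thesis by simp
qed

end

section \<open>Almost sure convergence of the estimators\<close>

text \<open>Turns null sets depending on \<open>x\<close> into a single null set of
  \<open>y\<close>, outside which convergence holds for almost every \<open>x\<close>.\<close>

lemma (in pair_sigma_finite) AE_tendsto_swap: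
  fixes F :: "nat \<Rightarrow> 'a \<Rightarrow> 'b \<Rightarrow> complex"
  assumes [measurable]: "\<And>n. (\<lambda>(x, y). F n x y) \<in> borel_measurable (M1 \<Otimes>\<^sub>M M2)"
    and [measurable]: "(\<lambda>(x, y). F' x y) \<in> borel_measurable (M1 \<Otimes>\<^sub>M M2)"
    and AE: "\<And>x. x \<in> space M1 \<Longrightarrow> AE y in M2. (\<lambda>n. F n x y) \<longlonglongrightarrow> F' x y"
  shows "AE y in M2. AE x in M1. (\<lambda>n. F n x y) \<longlonglongrightarrow> F' x y"
proof (rule AE_commute[THEN iffD1])
  \<comment> \<open>Countable quantifiers replace the limit, which makes the convergence set visibly
    measurable, as the exchange of the two almost everywhere quantifiers demands.\<close>
  have eq: "(\<lambda>n. F n x y) \<longlonglongrightarrow> F' x y \<longleftrightarrow> (\<forall>k. \<exists>m. \<forall>n\<ge>m. cmod (F n x y - F' x y) < 1 / Suc k)" for x y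
  proof
    assume "(\<lambda>n. F n x y) \<longlonglongrightarrow> F' x y"
    then show "\<forall>k. \<exists>m. \<forall>n\<ge>m. cmod (F n x y - F' x y) < 1 / Suc k"
      by (intro allI LIMSEQ_D) simp_all
  next
    assume *: "\<forall>k. \<exists>m. \<forall>n\<ge>m. cmod (F n x y - F' x y) < 1 / Suc k"
    show "(\<lambda>n. F n x y) \<longlonglongrightarrow> F' x y"
    proof (rule LIMSEQ_I)
      fix r :: real assume "0 < r"
      then obtain k where k: "1 / Suc k < r" using nat_approx_posE by blast
      from * obtain m where m: "\<And>n. m \<le> n \<Longrightarrow> cmod (F n x y - F' x y) < 1 / Suc k" by blast
      show "\<exists>m. \<forall>n\<ge>m. cmod (F n x y - F' x y) < r"
        using order.strict_trans[OF m k] by blast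
    qed
  qed
  show "{p \<in> space (M1 \<Otimes>\<^sub>M M2). (\<lambda>n. F n (fst p) (snd p)) \<longlonglongrightarrow> F' (fst p) (snd p)} \<in> sets (M1 \<Otimes>\<^sub>M M2)"
    unfolding eq by measurable
  show "AE x in M1. AE y in M2. (\<lambda>n. F n x y) \<longlonglongrightarrow> F' x y"
    using AE by (rule AE_I2)
qed

lemma iexp_cis: "iexp r = cis r"
  by (simp add: cis_conv_exp)

locale component = prob_space M + levy_measure d \<rho> for M :: "'w measure" and d \<rho> +
  fixes X :: "'w \<Rightarrow> nat \<Rightarrow> real" and Y :: "nat \<Rightarrow> 'w \<Rightarrow> nat \<Rightarrow> real"
  assumes X: "X \<in> measurable M (euclid_borel d)"
    and psi_X: "(\<integral>\<^sup>+ \<omega>. ennreal (psi d \<rho> (X \<omega>)) \<partial>M) < \<infinity>"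
    and indep: "indep_vars (\<lambda>_. euclid_borel d) Y UNIV"
    and ident: "\<And>l. distr M (euclid_borel d) (Y l) = distr M (euclid_borel d) X"
begin

interpretation M\<rho>: pair_sigma_finite M \<rho> ..
interpretation \<rho>M: pair_sigma_finite \<rho> M ..

lemma Y: "Y l \<in> measurable M (euclid_borel d)"
  using indep by (auto simp: indep_vars_def)

lemma dotp_measurable_\<rho>:
  assumes "F \<in> measurable N (euclid_borel d)" "G \<in> measurable N \<rho>"
  shows "(\<lambda>z. dotp d (F z) (G z)) \<in> borel_measurable N"
  using assms by (intro dotp_measurable) (simp_all add: measurable_\<rho>)

lemma M_integral_measurable:
  fixes g :: "'x \<Rightarrow> 'w \<Rightarrow> complex"
  assumes "(\<lambda>(z, \<omega>). g z \<omega>) \<in> borel_measurable (K \<Otimes>\<^sub>M M)"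
  shows "(\<lambda>z. LINT \<omega>|M. g z \<omega>) \<in> borel_measurable K"
  by (rule sigma_finite_measure.borel_measurable_lebesgue_integral[OF prob_space_imp_sigma_finite[OF prob_space_axioms] assms])

lemma dotp_pair_measurable:
  assumes "Z \<in> measurable M (euclid_borel d)"
  shows "(\<lambda>(\<omega>, t). dotp d (Z \<omega>) t) \<in> borel_measurable (M \<Otimes>\<^sub>M \<rho>)"
  unfolding split_beta' by (intro dotp_measurable_\<rho> measurable_compose[OF measurable_fst assms] measurable_snd)

lemma psi_measurable: "psi d \<rho> \<in> borel_measurable (euclid_borel d)"
proof -
  have "(\<lambda>(x, t). dotp d x t) \<in> borel_measurable (euclid_borel d \<Otimes>\<^sub>M \<rho>)"
    unfolding split_beta'
    by (intro dotp_measurable_\<rho> measurable_fst measurable_snd)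
  then have "(\<lambda>(x, t). 1 - cos (dotp d x t)) \<in> borel_measurable (euclid_borel d \<Otimes>\<^sub>M \<rho>)"
    unfolding split_beta' by measurable
  from borel_measurable_lebesgue_integral[OF this] show ?thesis by (simp add: psi_def[abs_def])
qed

lemma slln_Y:
  fixes \<phi> :: "(nat \<Rightarrow> real) \<Rightarrow> real"
  assumes \<phi>[measurable]: "\<phi> \<in> borel_measurable (euclid_borel d)" and int: "integrable M (\<lambda>\<omega>. \<phi> (X \<omega>))"
  shows "AE \<omega> in M. (\<lambda>N. (\<Sum>l<N. \<phi> (Y l \<omega>)) / N) \<longlonglongrightarrow> expectation (\<lambda>\<omega>. \<phi> (X \<omega>))"
proof -
  note [measurable] = X Y
  have distr: "distr M borel (\<lambda>\<omega>. \<phi> (Y l \<omega>)) = distr M borel (\<lambda>\<omega>. \<phi> (X \<omega>))" for l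
  proof -
    have "distr M borel (\<lambda>\<omega>. \<phi> (Z \<omega>)) = distr (distr M (euclid_borel d) Z) borel \<phi>"
      if "Z \<in> measurable M (euclid_borel d)" for Z
      using that by (subst distr_distr) (auto simp: comp_def)
    then show ?thesis using ident[of l] X Y by metis
  qed
  \<comment> \<open>Integrability and mean depend on the law alone; this carries them from
    \<open>X\<close> to \<open>Y 0\<close>, about which \<open>slln\<close> speaks.\<close>
  have law: "(integrable M (\<lambda>\<omega>. \<phi> (Z \<omega>)) \<longleftrightarrow> integrable (distr M borel (\<lambda>\<omega>. \<phi> (Z \<omega>))) (\<lambda>x. x)) \<and>
      expectation (\<lambda>\<omega>. \<phi> (Z \<omega>)) = (LINT x|distr M borel (\<lambda>\<omega>. \<phi> (Z \<omega>)). x)"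
    if Z: "Z \<in> measurable M (euclid_borel d)" for Z
    using integrable_distr_eq[OF measurable_compose[OF Z \<phi>], of "\<lambda>x. x"] integral_distr[OF measurable_compose[OF Z \<phi>], of "\<lambda>x. x"]
    by simp
  have "integrable M (\<lambda>\<omega>. \<phi> (Y 0 \<omega>)) \<longleftrightarrow> integrable M (\<lambda>\<omega>. \<phi> (X \<omega>))"
    unfolding law[OF Y, THEN conjunct1] law[OF X, THEN conjunct1] distr ..
  moreover have "expectation (\<lambda>\<omega>. \<phi> (Y 0 \<omega>)) = expectation (\<lambda>\<omega>. \<phi> (X \<omega>))"
    unfolding law[OF Y, THEN conjunct2] law[OF X, THEN conjunct2] distr ..
  moreover have "indep_vars (\<lambda>_. borel) (\<lambda>l \<omega>. \<phi> (Y l \<omega>)) UNIV"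
    by (rule indep_vars_compose2[OF indep, where Y = "\<lambda>_. \<phi>"]) simp
  ultimately show ?thesis
    using slln[of "\<lambda>l \<omega>. \<phi> (Y l \<omega>)"] distr int by simp
qed

definition f where "f = char_fun M d X"
text \<open>Indexed by sample size \<open>Suc n\<close>, since \<open>sample\<close> excludes the
  empty sample; the shift is undone when the estimators are reached.\<close>

definition fN where "fN n \<omega> = ecf (Suc n) d (\<lambda>l. Y l \<omega>)"
definition w where "w t = sqrt (2 * (1 - Re (f t)))"
definition wN where "wN n \<omega> t = sqrt (2 * (1 - Re (fN n \<omega> t)))"

lemma cis_integrable: "integrable M (\<lambda>\<omega>. cis (dotp d (X \<omega>) t))"
proof -
  have "(\<lambda>x. dotp d x t) \<in> borel_measurable (euclid_borel d)"
    unfolding dotp_def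
    by (intro borel_measurable_sum borel_measurable_times coordinate_measurable borel_measurable_const)
  from measurable_compose[OF X this] show ?thesis
    unfolding cis_conv_exp by (intro integrable_const_bound[of _ 1]) auto
qed

lemma fN_tendsto: "AE \<omega> in M. (\<lambda>n. fN n \<omega> t) \<longlonglongrightarrow> f t"
proof -
  have [measurable]: "(\<lambda>x. dotp d x t) \<in> borel_measurable (euclid_borel d)"
    unfolding dotp_def
    by (intro borel_measurable_sum borel_measurable_times coordinate_measurable borel_measurable_const)
  have Re: "AE \<omega> in M. (\<lambda>N. (\<Sum>l<N. cos (dotp d (Y l \<omega>) t)) / N) \<longlonglongrightarrow> Re (f t)"
    using slln_Y[of "\<lambda>x. cos (dotp d x t)"] integrable_Re[OF cis_integrable, of t] integral_Re[OF cis_integrable, of t]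
    by (simp add: f_def char_fun_def iexp_cis)
  have Im: "AE \<omega> in M. (\<lambda>N. (\<Sum>l<N. sin (dotp d (Y l \<omega>) t)) / N) \<longlonglongrightarrow> Im (f t)"
    using slln_Y[of "\<lambda>x. sin (dotp d x t)"] integrable_Im[OF cis_integrable, of t] integral_Im[OF cis_integrable, of t]
    by (simp add: f_def char_fun_def iexp_cis)
  show ?thesis
    using Re Im
  proof eventually_elim
    case (elim \<omega>)
    have "(\<lambda>N. ecf N d (\<lambda>l. Y l \<omega>) t) \<longlonglongrightarrow> f t"
      unfolding tendsto_complex_iff ecf_def Re_divide_of_nat Im_divide_of_nat Re_sum Im_sum using elim by simp
    then show ?case unfolding fN_def by (rule LIMSEQ_Suc)
  qed
qed

lemma psi_X_integrable: "integrable M (\<lambda>\<omega>. psi d \<rho> (X \<omega>))"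
  using psi_X psi_nonneg by (intro integrableI_nonneg measurable_compose[OF X psi_measurable]) auto

text \<open>Integrating over \<open>t\<close> first gives \<open>psi d \<rho> (X \<omega>)\<close>,
  so finiteness of its mean is exactly what Fubini needs to identify the integral of
  \<open>1 - Re f\<close>.\<close>

lemma one_minus_cos_pair_integrable: "integrable (M \<Otimes>\<^sub>M \<rho>) (\<lambda>(\<omega>, t). 1 - cos (dotp d (X \<omega>) t))"
proof (rule M\<rho>.Fubini_integrable)
  show "(\<lambda>(\<omega>, t). 1 - cos (dotp d (X \<omega>) t)) \<in> borel_measurable (M \<Otimes>\<^sub>M \<rho>)"
    using dotp_pair_measurable[OF X] unfolding split_beta' by measurable
  show "AE \<omega> in M. integrable \<rho> (\<lambda>t. case (\<omega>, t) of (\<omega>, t) \<Rightarrow> 1 - cos (dotp d (X \<omega>) t))"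
    using one_minus_cos_integrable by simp
  show "integrable M (\<lambda>\<omega>. LINT t|\<rho>. norm (case (\<omega>, t) of (\<omega>, t) \<Rightarrow> 1 - cos (dotp d (X \<omega>) t)))"
    using psi_X_integrable by (simp add: psi_def)
qed

lemma Re_f: "1 - Re (f t) = expectation (\<lambda>\<omega>. 1 - cos (dotp d (X \<omega>) t))"
  using integrable_Re[OF cis_integrable, of t] integral_Re[OF cis_integrable, of t]
  by (simp add: f_def char_fun_def iexp_cis prob_space)

lemma one_minus_Re_f_nonneg: "0 \<le> 1 - Re (f t)"
  unfolding Re_f by (intro integral_nonneg_AE) simp

lemma weight_w: "weight \<rho> w" and w_integral: "(LINT t|\<rho>. (w t)\<^sup>2) = 2 * expectation (\<lambda>\<omega>. psi d \<rho> (X \<omega>))" (is ?A)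
proof -
  have int: "integrable \<rho> (\<lambda>t. 1 - Re (f t))"
    unfolding Re_f using M\<rho>.integrable_snd[OF one_minus_cos_pair_integrable] .
  have w2: "(w t)\<^sup>2 = 2 * (1 - Re (f t))" for t
    using one_minus_Re_f_nonneg by (simp add: w_def)
  have "(\<lambda>t. 1 - Re (f t)) \<in> borel_measurable \<rho>" using int by auto
  then have "w \<in> borel_measurable \<rho>"
    unfolding w_def[abs_def] by measurable
  moreover have "integrable \<rho> (\<lambda>t. (w t)\<^sup>2)"
    unfolding w2 by (intro integrable_mult_right int)
  moreover have "0 \<le> w t" for t using one_minus_Re_f_nonneg[of t] by (simp add: w_def)
  ultimately show "weight \<rho> w" by (simp add: weight_def)
  have "(LINT t|\<rho>. (w t)\<^sup>2) = 2 * (LINT t|\<rho>. 1 - Re (f t))"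
    unfolding w2 by (rule integral_mult_right_zero)
  also have "(LINT t|\<rho>. 1 - Re (f t)) = expectation (\<lambda>\<omega>. psi d \<rho> (X \<omega>))"
    unfolding Re_f psi_def using M\<rho>.Fubini_integral[OF one_minus_cos_pair_integrable] .
  finally show ?A .
qed

lemma sample_Y: "sample d \<rho> (Suc n)"
  by unfold_locales simp

lemma weight_wN: "weight \<rho> (wN n \<omega>)"
  and wN_integral: "(LINT t|\<rho>. (wN n \<omega> t)\<^sup>2) = 2 * ((\<Sum>l<Suc n. psi d \<rho> (Y l \<omega>)) / Suc n)" (is ?A)
proof -
  interpret S: sample d \<rho> "Suc n" "\<lambda>l. Y l \<omega>" by (rule sample_Y)
  have w2: "(wN n \<omega> t)\<^sup>2 = 2 * (1 - Re (fN n \<omega> t))" for t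
    using S.Re_f_le_1[of t] by (simp add: wN_def fN_def S.f_def)
  have hb: "has_bochner_integral \<rho> (\<lambda>t. 1 - Re (fN n \<omega> t)) ((\<Sum>l<Suc n. psi d \<rho> (Y l \<omega>)) / Suc n)"
    using S.one_minus_Re_f unfolding fN_def S.f_def .
  then have int: "integrable \<rho> (\<lambda>t. 1 - Re (fN n \<omega> t))" by (rule integrable.intros)
  have "(\<lambda>t. 1 - Re (fN n \<omega> t)) \<in> borel_measurable \<rho>" using int by auto
  then have "wN n \<omega> \<in> borel_measurable \<rho>"
    unfolding wN_def[abs_def] by measurable
  moreover have "integrable \<rho> (\<lambda>t. (wN n \<omega> t)\<^sup>2)"
    unfolding w2 by (intro integrable_mult_right int)
  moreover have "0 \<le> wN n \<omega> t" for t using S.Re_f_le_1[of t] by (simp add: wN_def fN_def S.f_def)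
  ultimately show "weight \<rho> (wN n \<omega>)" by (simp add: weight_def)
  show ?A
    unfolding w2 integral_mult_right_zero has_bochner_integral_integral_eq[OF hb] ..
qed

lemma cov_kernel_tendsto: "AE \<omega> in M. (\<lambda>n. cov_kernel (fN n \<omega>) s t) \<longlonglongrightarrow> cov_kernel f s t"
  using fN_tendsto[of "s - t"] fN_tendsto[of s] fN_tendsto[of "- t"]
  by eventually_elim (auto simp: cov_kernel_def intro!: tendsto_intros)

lemma fN_kernel_measurable:
  "(\<lambda>((s, t), \<omega>). cov_kernel (fN n \<omega>) s t) \<in> borel_measurable ((\<rho> \<Otimes>\<^sub>M \<rho>) \<Otimes>\<^sub>M M)"
proof -
  have [measurable]: "(\<lambda>p. dotp d (Y l (snd p)) (fst (fst p))) \<in> borel_measurable ((\<rho> \<Otimes>\<^sub>M \<rho>) \<Otimes>\<^sub>M M)"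
    "(\<lambda>p. dotp d (Y l (snd p)) (snd (fst p))) \<in> borel_measurable ((\<rho> \<Otimes>\<^sub>M \<rho>) \<Otimes>\<^sub>M M)" for l
    by (intro dotp_measurable_\<rho> measurable_compose[OF measurable_snd Y] measurable_compose[OF measurable_fst measurable_fst]
        measurable_compose[OF measurable_fst measurable_snd])+
  show ?thesis
    unfolding cov_kernel_def fN_def ecf_def split_beta' dotp_diff dotp_uminus cis_conv_exp by measurable
qed

lemma f_kernel_measurable: "(\<lambda>(s, t). cov_kernel f s t) \<in> borel_measurable (\<rho> \<Otimes>\<^sub>M \<rho>)"
proof -
  have [measurable]: "(\<lambda>p. dotp d (X (snd p)) (fst (fst p))) \<in> borel_measurable ((\<rho> \<Otimes>\<^sub>M \<rho>) \<Otimes>\<^sub>M M)"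
    "(\<lambda>p. dotp d (X (snd p)) (snd (fst p))) \<in> borel_measurable ((\<rho> \<Otimes>\<^sub>M \<rho>) \<Otimes>\<^sub>M M)"
    by (intro dotp_measurable_\<rho> measurable_compose[OF measurable_snd X] measurable_compose[OF measurable_fst measurable_fst]
        measurable_compose[OF measurable_fst measurable_snd])+
  have "(\<lambda>p. LINT \<omega>|M. cis (dotp d (X \<omega>) (fst p) - dotp d (X \<omega>) (snd p))) \<in> borel_measurable (\<rho> \<Otimes>\<^sub>M \<rho>)"
    "(\<lambda>p. LINT \<omega>|M. cis (dotp d (X \<omega>) (fst p))) \<in> borel_measurable (\<rho> \<Otimes>\<^sub>M \<rho>)"
    "(\<lambda>p. LINT \<omega>|M. cis (- dotp d (X \<omega>) (snd p))) \<in> borel_measurable (\<rho> \<Otimes>\<^sub>M \<rho>)"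
    unfolding cis_conv_exp
    by (rule M_integral_measurable; simp add: split_beta')+
  then show ?thesis
    unfolding cov_kernel_def f_def char_fun_def split_beta' dotp_diff dotp_uminus iexp_cis by measurable
qed

lemma dom_kernel_fN: "dom_kernel \<rho> (wN n \<omega>) 1 (cov_kernel (fN n \<omega>))"
proof -
  interpret S: sample d \<rho> "Suc n" "\<lambda>l. Y l \<omega>" by (rule sample_Y)
  have 1: "(\<lambda>p. fN n \<omega> (fst p - snd p)) \<in> borel_measurable (\<rho> \<Otimes>\<^sub>M \<rho>)"
    "(\<lambda>p. fN n \<omega> (fst p)) \<in> borel_measurable (\<rho> \<Otimes>\<^sub>M \<rho>)"
    "(\<lambda>p. fN n \<omega> (- snd p)) \<in> borel_measurable (\<rho> \<Otimes>\<^sub>M \<rho>)"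
    unfolding fN_def ecf_def dotp_diff dotp_uminus cis_conv_exp by measurable
  show ?thesis
    unfolding dom_kernel_def
  proof (intro conjI ballI)
    show "(\<lambda>(s, t). cov_kernel (fN n \<omega>) s t) \<in> borel_measurable (\<rho> \<Otimes>\<^sub>M \<rho>)"
      unfolding cov_kernel_def split_beta' using 1 by measurable
    show "cmod (cov_kernel (fN n \<omega>) s t) \<le> 1 * (wN n \<omega> s * wN n \<omega> t)" for s t
      using S.cmod_cov_kernel_le[of s t] by (simp add: wN_def fN_def S.f_def)
  qed simp
qed

text \<open>The bound is inherited from the samples: it holds for every empirical kernel, and at
  fixed \<open>s\<close> and \<open>t\<close> both sides converge almost surely.\<close>

lemma dom_kernel_f: "dom_kernel \<rho> w 1 (cov_kernel f)"
  unfolding dom_kernel_def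
proof (intro conjI ballI)
  show "(\<lambda>(s, t). cov_kernel f s t) \<in> borel_measurable (\<rho> \<Otimes>\<^sub>M \<rho>)" by (rule f_kernel_measurable)
  fix s t assume st: "s \<in> space \<rho>" "t \<in> space \<rho>"
  have "AE \<omega> in M. cmod (cov_kernel f s t) \<le> 1 * (w s * w t)"
    using cov_kernel_tendsto[of s t] fN_tendsto[of s] fN_tendsto[of t]
  proof eventually_elim
    case (elim \<omega>)
    have wt: "(\<lambda>n. wN n \<omega> u) \<longlonglongrightarrow> w u" if "(\<lambda>n. fN n \<omega> u) \<longlonglongrightarrow> f u" for u
      unfolding wN_def w_def by (intro tendsto_intros that)
    show ?case
    proof (rule tendsto_le[OF _ _ tendsto_norm[OF elim(1)]])
      show "(\<lambda>n. 1 * (wN n \<omega> s * wN n \<omega> t)) \<longlonglongrightarrow> 1 * (w s * w t)"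
        by (intro tendsto_intros wt elim)
      show "\<forall>\<^sub>F n in sequentially. cmod (cov_kernel (fN n \<omega>) s t) \<le> 1 * (wN n \<omega> s * wN n \<omega> t)"
        using dom_kernelD[OF dom_kernel_fN st] by simp
    qed simp
  qed
  \<comment> \<open>The inequality does not mention \<open>\<omega>\<close>, so holding almost
    surely in a probability space it holds outright.\<close>
  then show "cmod (cov_kernel f s t) \<le> 1 * (w s * w t)" by simp
qed simp

lemma f_uminus: "f (- t) = cnj (f t)"
  unfolding f_def char_fun_def iexp_cis dotp_uminus
  by (simp add: cis_cnj[symmetric])

lemma fN_uminus: "fN n \<omega> (- t) = cnj (fN n \<omega> t)"
  by (simp add: fN_def ecf_def dotp_uminus cis_cnj)

lemma w_uminus: "w (- t) = w t"
  by (simp add: w_def f_uminus)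

lemma cov_kernel_f_cnj: "cov_kernel f s t = cnj (cov_kernel f t s)"
  using f_uminus[of "t - s"] by (simp add: cov_kernel_def f_uminus)

lemma cov_kernel_fN_cnj: "cov_kernel (fN n \<omega>) s t = cnj (cov_kernel (fN n \<omega>) t s)"
  using fN_uminus[of n \<omega> "t - s"] by (simp add: cov_kernel_def fN_uminus)

lemma AE_fN_tendsto: "AE \<omega> in M. AE t in \<rho>. (\<lambda>n. fN n \<omega> t) \<longlonglongrightarrow> f t"
proof -
  have [measurable]: "(\<lambda>p. dotp d (Y l (snd p)) (fst p)) \<in> borel_measurable (\<rho> \<Otimes>\<^sub>M M)"
    "(\<lambda>p. dotp d (X (snd p)) (fst p)) \<in> borel_measurable (\<rho> \<Otimes>\<^sub>M M)" for l
    by (intro dotp_measurable_\<rho> measurable_compose[OF measurable_snd Y] measurable_compose[OF measurable_snd X] measurable_fst)+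
  have "(\<lambda>t. LINT \<omega>|M. cis (dotp d (X \<omega>) t)) \<in> borel_measurable \<rho>"
    unfolding cis_conv_exp
    by (rule M_integral_measurable; simp add: split_beta')
  then have [measurable]: "f \<in> borel_measurable \<rho>"
    by (simp add: f_def char_fun_def[abs_def] iexp_cis)
  show ?thesis
  proof (rule \<rho>M.AE_tendsto_swap[where F = "\<lambda>n t \<omega>. fN n \<omega> t" and F' = "\<lambda>t \<omega>. f t"])
    show "(\<lambda>(t, \<omega>). fN n \<omega> t) \<in> borel_measurable (\<rho> \<Otimes>\<^sub>M M)" for n
      unfolding fN_def ecf_def split_beta' cis_conv_exp by measurable
  qed (measurable, rule fN_tendsto)
qed

lemma AE_weight_tendsto: "AE \<omega> in M. weight_tendsto \<rho> (\<lambda>n. wN n \<omega>) w"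
proof -
  have 2: "AE \<omega> in M. (\<lambda>N. (\<Sum>l<N. psi d \<rho> (Y l \<omega>)) / N) \<longlonglongrightarrow> expectation (\<lambda>\<omega>. psi d \<rho> (X \<omega>))"
    by (rule slln_Y[OF psi_measurable psi_X_integrable])
  show ?thesis
    using AE_fN_tendsto 2
  proof eventually_elim
    case (elim \<omega>)
    show ?case
      unfolding weight_tendsto_def wN_integral w_integral
    proof (intro conjI allI weight_wN weight_w)
      show "AE t in \<rho>. (\<lambda>n. wN n \<omega> t) \<longlonglongrightarrow> w t"
        using elim(1) by eventually_elim (auto simp: wN_def w_def intro!: tendsto_intros)
      show "(\<lambda>n. 2 * ((\<Sum>l<Suc n. psi d \<rho> (Y l \<omega>)) / Suc n)) \<longlonglongrightarrow> 2 * expectation (\<lambda>\<omega>. psi d \<rho> (X \<omega>))"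
        by (intro tendsto_intros LIMSEQ_Suc[OF elim(2)])
    qed
  qed
qed

text \<open>The exchange of null sets is carried out over pairs of arguments; row convergence is
  then read off from the product measure.\<close>

lemma AE_kernel_tendsto: "AE \<omega> in M. kernel_tendsto \<rho> (\<lambda>n. wN n \<omega>) w (\<lambda>n. cov_kernel (fN n \<omega>)) (cov_kernel f)"
proof -
  interpret P: sigma_finite_measure "\<rho> \<Otimes>\<^sub>M \<rho>"
    by (rule sigma_finite_pair_measure; rule sigma_finite_\<rho>)
  interpret PM: pair_sigma_finite "\<rho> \<Otimes>\<^sub>M \<rho>" M ..
  have "AE \<omega> in M. AE p in \<rho> \<Otimes>\<^sub>M \<rho>. (\<lambda>n. cov_kernel (fN n \<omega>) (fst p) (snd p)) \<longlonglongrightarrow> cov_kernel f (fst p) (snd p)"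
  proof (rule PM.AE_tendsto_swap[where F = "\<lambda>n p \<omega>. cov_kernel (fN n \<omega>) (fst p) (snd p)" and F' = "\<lambda>p \<omega>. cov_kernel f (fst p) (snd p)"])
    show "(\<lambda>(p, \<omega>). cov_kernel (fN n \<omega>) (fst p) (snd p)) \<in> borel_measurable ((\<rho> \<Otimes>\<^sub>M \<rho>) \<Otimes>\<^sub>M M)" for n
      using fN_kernel_measurable[of n] by (simp add: split_beta')
    show "(\<lambda>(p, \<omega>). cov_kernel f (fst p) (snd p)) \<in> borel_measurable ((\<rho> \<Otimes>\<^sub>M \<rho>) \<Otimes>\<^sub>M M)"
      using measurable_compose[OF measurable_fst f_kernel_measurable, of M] by (simp add: split_beta')
  qed (rule cov_kernel_tendsto)
  then show ?thesis
  proof eventually_elim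
    case (elim \<omega>)
    have 1: "AE s in \<rho>. AE t in \<rho>. (\<lambda>n. cov_kernel (fN n \<omega>) s t) \<longlonglongrightarrow> cov_kernel f s t"
      using pair.AE_pair[OF elim] by simp
    \<comment> \<open>Both kernels are Hermitian, so column convergence is the conjugate of row
      convergence.\<close>
    have "(\<lambda>n. cov_kernel (fN n \<omega>) t s) \<longlonglongrightarrow> cov_kernel f t s" if "(\<lambda>n. cov_kernel (fN n \<omega>) s t) \<longlonglongrightarrow> cov_kernel f s t" for s t
      using tendsto_cnj[OF that] by (simp add: cov_kernel_f_cnj[of t s] cov_kernel_fN_cnj[of _ _ t s])
    then have "AE s in \<rho>. AE t in \<rho>. (\<lambda>n. cov_kernel (fN n \<omega>) t s) \<longlonglongrightarrow> cov_kernel f t s"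
      using 1 by (auto elim!: AE_mp)
    then show ?case
      unfolding kernel_tendsto_def using 1 dom_kernel_fN dom_kernel_f by blast
  qed
qed

abbreviation "C \<equiv> cov_kernel f"
abbreviation "BN N \<omega> \<equiv> dist_mat N d \<rho> (\<lambda>l. Y l \<omega>)"

theorem AE_estimators_tendsto:
  "AE \<omega> in M.
    (\<lambda>N. complex_of_real (mu1 N (BN N \<omega>))) \<longlonglongrightarrow> ktrace \<rho> C \<and>
    (\<lambda>N. complex_of_real (mu2 N (BN N \<omega>))) \<longlonglongrightarrow> ktrace \<rho> (kcomp \<rho> C C) \<and>
    (\<lambda>N. complex_of_real (mu3 N (BN N \<omega>))) \<longlonglongrightarrow> ktrace \<rho> (kcomp \<rho> (kcomp \<rho> C C) C) \<and>
    (\<lambda>N. complex_of_real (mu4 N (BN N \<omega>))) \<longlonglongrightarrow> ktrace \<rho> (kcomp \<rho> (kcomp \<rho> C C) (kcomp \<rho> C C))"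
  using AE_weight_tendsto AE_kernel_tendsto AE_fN_tendsto
proof eventually_elim
  case (elim \<omega>)
  let ?C = "\<lambda>n. cov_kernel (fN n \<omega>)"
  note w = elim(1) and C = elim(2)
  have C2: "kernel_tendsto \<rho> (\<lambda>n. wN n \<omega>) w (\<lambda>n. kcomp \<rho> (?C n) (?C n)) (kcomp \<rho> C C)"
    by (rule kernel_tendsto_kcomp[OF w C C])
  \<comment> \<open>The diagonal value \<open>1 - |f t|\<^sup>2\<close> involves the characteristic
    function at one point only, so almost everywhere convergence of \<open>fN\<close> settles the
    diagonal.\<close>
  have diag: "AE t in \<rho>. (\<lambda>n. ?C n t t) \<longlonglongrightarrow> C t t"
  proof -
    have "fN n \<omega> 0 = 1" "f 0 = 1" for n
      by (simp_all add: fN_def ecf_def f_def char_fun_def dotp_def prob_space del: of_nat_Suc)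
    then have "?C n t t = 1 - fN n \<omega> t * cnj (fN n \<omega> t)" "C t t = 1 - f t * cnj (f t)" for n t
      by (simp_all add: cov_kernel_def fN_uminus f_uminus)
    then show ?thesis
      using elim(3) by (auto intro!: tendsto_intros elim!: AE_mp)
  qed
  have 1: "(\<lambda>n. ktrace \<rho> (?C n)) \<longlonglongrightarrow> ktrace \<rho> C"
    by (rule ktrace_tendsto[OF w dom_kernel_fN dom_kernel_f diag])
  note 2 = ktrace_kcomp_tendsto[OF w C C] and 3 = ktrace_kcomp_tendsto[OF w C2 C] and 4 = ktrace_kcomp_tendsto[OF w C2 C2]
  have mu: "ktrace \<rho> (?C n) = of_real (mu1 (Suc n) (BN (Suc n) \<omega>))"
    "ktrace \<rho> (kcomp \<rho> (?C n) (?C n)) = of_real (mu2 (Suc n) (BN (Suc n) \<omega>))"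
    "ktrace \<rho> (kcomp \<rho> (kcomp \<rho> (?C n) (?C n)) (?C n)) = of_real (mu3 (Suc n) (BN (Suc n) \<omega>))"
    "ktrace \<rho> (kcomp \<rho> (kcomp \<rho> (?C n) (?C n)) (kcomp \<rho> (?C n) (?C n))) = of_real (mu4 (Suc n) (BN (Suc n) \<omega>))" for n
  proof -
    interpret S: sample d \<rho> "Suc n" "\<lambda>l. Y l \<omega>" by (rule sample_Y)
    show "ktrace \<rho> (?C n) = of_real (mu1 (Suc n) (BN (Suc n) \<omega>))"
      "ktrace \<rho> (kcomp \<rho> (?C n) (?C n)) = of_real (mu2 (Suc n) (BN (Suc n) \<omega>))"
      "ktrace \<rho> (kcomp \<rho> (kcomp \<rho> (?C n) (?C n)) (?C n)) = of_real (mu3 (Suc n) (BN (Suc n) \<omega>))"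
      "ktrace \<rho> (kcomp \<rho> (kcomp \<rho> (?C n) (?C n)) (kcomp \<rho> (?C n) (?C n))) = of_real (mu4 (Suc n) (BN (Suc n) \<omega>))"
      unfolding fN_def using S.ktrace_1 S.ktrace_2 S.ktrace_3 S.ktrace_4 by (simp_all only: S.f_def)
  qed
  show ?case
    using 1 2 3 4 unfolding mu by (intro conjI) (rule LIMSEQ_imp_Suc, assumption)+
qed

end

section \<open>Moments of the squared norm of a Gaussian field\<close>

lemma integral_eqI:
  fixes f g :: "'a \<Rightarrow> 'b::{banach, second_countable_topology}"
  assumes "has_bochner_integral M g x" "\<And>t. t \<in> space M \<Longrightarrow> f t = g t"
  shows "integral\<^sup>L M f = x"
proof -
  have "integral\<^sup>L M f = integral\<^sup>L M g"
    by (rule Bochner_Integration.integral_cong[OF refl assms(2)])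
  then show ?thesis using has_bochner_integral_integral_eq[OF assms(1)] by simp
qed

lemma kcomp_cong:
  assumes "\<And>s t. s \<in> space \<mu> \<Longrightarrow> t \<in> space \<mu> \<Longrightarrow> A s t = A' s t"
    and "\<And>s t. s \<in> space \<mu> \<Longrightarrow> t \<in> space \<mu> \<Longrightarrow> B s t = B' s t"
    and "s \<in> space \<mu>" "t \<in> space \<mu>"
  shows "kcomp \<mu> A B s t = kcomp \<mu> A' B' s t"
  unfolding kcomp_def using assms by (intro Bochner_Integration.integral_cong refl) simp

lemma ktrace_cong:
  assumes "\<And>t. t \<in> space \<mu> \<Longrightarrow> A t t = A' t t"
  shows "ktrace \<mu> A = ktrace \<mu> A'"
  unfolding ktrace_def using assms by (intro Bochner_Integration.integral_cong refl) simp

lemma ktrace_kcomp_cong: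
  assumes "\<And>s t. s \<in> space \<mu> \<Longrightarrow> t \<in> space \<mu> \<Longrightarrow> A s t = A' s t"
    and "\<And>s t. s \<in> space \<mu> \<Longrightarrow> t \<in> space \<mu> \<Longrightarrow> B s t = B' s t"
  shows "ktrace \<mu> (kcomp \<mu> A B) = ktrace \<mu> (kcomp \<mu> A' B')"
  by (intro ktrace_cong kcomp_cong assms)

section \<open>Iterated integrals over cycles of kernels\<close>

context sfm
begin

lemma has_integral_kcomp:
  assumes "weight \<mu> w" "dom_kernel \<mu> w K A" "dom_kernel \<mu> w K' B" "s \<in> space \<mu>" "t \<in> space \<mu>"
  shows "has_bochner_integral \<mu> (\<lambda>u. A s u * B u t) (kcomp \<mu> A B s t)"
  unfolding kcomp_def by (rule has_bochner_integral_integrable[OF kcomp_integrable[OF assms]])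

lemma has_integral_ktrace:
  assumes "weight \<mu> w" "dom_kernel \<mu> w K A"
  shows "has_bochner_integral \<mu> (\<lambda>t. A t t) (ktrace \<mu> A)"
  unfolding ktrace_def by (rule has_bochner_integral_integrable[OF ktrace_integrable[OF assms]])

text \<open>Each of the three products of two short cycles integrates to the squared trace of the
  square (\<open>3 * 4 = 12\<close>), each of the three long cycles to the trace of the fourth power
  (\<open>3 * 16 = 48\<close>). The variables are integrated out one at a time, the innermost
  first.\<close>

lemma cyclic_integral4:
  assumes w: "weight \<mu> w" and A: "dom_kernel \<mu> w K A"
    and sym: "\<And>s t. s \<in> space \<mu> \<Longrightarrow> t \<in> space \<mu> \<Longrightarrow> A s t = A t s"
  shows "(LINT s|\<mu>. LINT t|\<mu>. LINT u|\<mu>. LINT v|\<mu>.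
      4 * ((A s t)\<^sup>2 * (A u v)\<^sup>2 + (A s u)\<^sup>2 * (A t v)\<^sup>2 + (A s v)\<^sup>2 * (A t u)\<^sup>2) +
      16 * (A s t * A t u * A u v * A v s + A s t * A t v * A v u * A u s + A s u * A u t * A t v * A v s))
    = 48 * ktrace \<mu> (kcomp \<mu> (kcomp \<mu> A A) (kcomp \<mu> A A)) + 12 * (ktrace \<mu> (kcomp \<mu> A A))\<^sup>2"
    (is "(LINT s|\<mu>. LINT t|\<mu>. LINT u|\<mu>. LINT v|\<mu>. ?F s t u v) = _")
proof -
  let ?R = "kcomp \<mu> A A"
  let ?\<tau> = "ktrace \<mu> ?R"
  let ?G = "\<lambda>s t u. 4 * (A s t)\<^sup>2 * ?R u u + 4 * (A s u)\<^sup>2 * ?R t t + 4 * (A t u)\<^sup>2 * ?R s s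
      + 16 * (A s t * A t u) * ?R u s + 16 * (A s t * A u s) * ?R t u + 16 * (A s u * A u t) * ?R t s"
  let ?H = "\<lambda>s t. 4 * (A s t)\<^sup>2 * ?\<tau> + 4 * ?R t t * ?R s s + 4 * ?R s s * ?R t t
      + 16 * A s t * kcomp \<mu> A ?R t s + 16 * A s t * kcomp \<mu> ?R A t s + 16 * ?R t s * ?R s t"
  let ?J = "\<lambda>s. 4 * ?\<tau> * ?R s s + 8 * ?R s s * ?\<tau> + 16 * kcomp \<mu> A (kcomp \<mu> A ?R) s s
      + 16 * kcomp \<mu> A (kcomp \<mu> ?R A) s s + 16 * kcomp \<mu> ?R ?R s s"
  note R = dom_kernel_kcomp[OF w A A]
  note AR = dom_kernel_kcomp[OF w A R]
  note RA = dom_kernel_kcomp[OF w R A]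
  note hb = has_bochner_integral_add has_bochner_integral_mult_right
  have 1: "(LINT v|\<mu>. ?F s t u v) = ?G s t u" if st: "s \<in> space \<mu>" "t \<in> space \<mu>" "u \<in> space \<mu>" for s t u
  proof (rule integral_eqI)
    show "has_bochner_integral \<mu> (\<lambda>v. 4 * (A s t)\<^sup>2 * (A u v * A v u) + 4 * (A s u)\<^sup>2 * (A t v * A v t) + 4 * (A t u)\<^sup>2 * (A s v * A v s)
        + 16 * (A s t * A t u) * (A u v * A v s) + 16 * (A s t * A u s) * (A t v * A v u) + 16 * (A s u * A u t) * (A t v * A v s)) (?G s t u)"
      by (intro hb impI has_integral_kcomp[OF w A A] st)
  qed (use sym[OF _ st(3)] sym[OF _ st(2)] sym[OF _ st(1)] in \<open>simp add: algebra_simps power2_eq_square\<close>)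
  have 2: "(LINT u|\<mu>. ?G s t u) = ?H s t" if st: "s \<in> space \<mu>" "t \<in> space \<mu>" for s t
  proof (rule integral_eqI)
    show "has_bochner_integral \<mu> (\<lambda>u. 4 * (A s t)\<^sup>2 * ?R u u + 4 * ?R t t * (A s u * A u s) + 4 * ?R s s * (A t u * A u t)
      + 16 * A s t * (A t u * ?R u s) + 16 * A s t * (?R t u * A u s) + 16 * ?R t s * (A s u * A u t)) (?H s t)"
      by (intro hb impI has_integral_ktrace[OF w R] has_integral_kcomp[OF w A A] has_integral_kcomp[OF w A R] has_integral_kcomp[OF w R A] st)
  qed (use sym[OF _ st(2)] sym[OF _ st(1)] in \<open>simp add: algebra_simps power2_eq_square\<close>)
  have 3: "(LINT t|\<mu>. ?H s t) = ?J s" if s: "s \<in> space \<mu>" for s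
  proof (rule integral_eqI)
    show "has_bochner_integral \<mu> (\<lambda>t. 4 * ?\<tau> * (A s t * A t s) + 8 * ?R s s * ?R t t + 16 * (A s t * kcomp \<mu> A ?R t s)
        + 16 * (A s t * kcomp \<mu> ?R A t s) + 16 * (?R s t * ?R t s)) (?J s)"
      by (intro hb impI has_integral_ktrace[OF w R] has_integral_kcomp[OF w A A] has_integral_kcomp[OF w A AR]
          has_integral_kcomp[OF w A RA] has_integral_kcomp[OF w R R] s)
  qed (use sym[OF _ s] in \<open>simp add: algebra_simps power2_eq_square\<close>)
  have 4: "(LINT s|\<mu>. ?J s) = 4 * ?\<tau> * ?\<tau> + 8 * ?\<tau> * ?\<tau> + 16 * ktrace \<mu> (kcomp \<mu> A (kcomp \<mu> A ?R))
      + 16 * ktrace \<mu> (kcomp \<mu> A (kcomp \<mu> ?R A)) + 16 * ktrace \<mu> (kcomp \<mu> ?R ?R)"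
  proof (rule integral_eqI)
    show "has_bochner_integral \<mu> (\<lambda>s. 4 * ?\<tau> * ?R s s + 8 * ?\<tau> * ?R s s + 16 * kcomp \<mu> A (kcomp \<mu> A ?R) s s
        + 16 * kcomp \<mu> A (kcomp \<mu> ?R A) s s + 16 * kcomp \<mu> ?R ?R s s)
      (4 * ?\<tau> * ?\<tau> + 8 * ?\<tau> * ?\<tau> + 16 * ktrace \<mu> (kcomp \<mu> A (kcomp \<mu> A ?R))
        + 16 * ktrace \<mu> (kcomp \<mu> A (kcomp \<mu> ?R A)) + 16 * ktrace \<mu> (kcomp \<mu> ?R ?R))"
      by (intro hb impI has_integral_ktrace[OF w R] has_integral_ktrace[OF w dom_kernel_kcomp[OF w A AR]]
          has_integral_ktrace[OF w dom_kernel_kcomp[OF w A RA]] has_integral_ktrace[OF w dom_kernel_kcomp[OF w R R]])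
  qed simp
  \<comment> \<open>The three long cycles arrive with different bracketings; associativity and
    cyclicity of the trace identify them.\<close>
  have assoc1: "ktrace \<mu> (kcomp \<mu> A (kcomp \<mu> A ?R)) = ktrace \<mu> (kcomp \<mu> ?R ?R)"
    by (rule ktrace_cong) (rule kcomp_assoc[OF w A A R, symmetric])
  have assoc2: "ktrace \<mu> (kcomp \<mu> A (kcomp \<mu> ?R A)) = ktrace \<mu> (kcomp \<mu> ?R ?R)"
    unfolding ktrace_kcomp_commute[OF w A RA] by (rule ktrace_cong) (rule kcomp_assoc[OF w R A A])
  have "(LINT s|\<mu>. LINT t|\<mu>. LINT u|\<mu>. LINT v|\<mu>. ?F s t u v) = (LINT s|\<mu>. LINT t|\<mu>. LINT u|\<mu>. ?G s t u)"
    by (rule Bochner_Integration.integral_cong[OF refl])+ (rule 1)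
  also have "\<dots> = (LINT s|\<mu>. LINT t|\<mu>. ?H s t)"
    by (rule Bochner_Integration.integral_cong[OF refl])+ (rule 2)
  also have "\<dots> = (LINT s|\<mu>. ?J s)"
    by (rule Bochner_Integration.integral_cong[OF refl]) (rule 3)
  finally show ?thesis unfolding 4 assoc1 assoc2 by (simp add: power2_eq_square)
qed

end

text \<open>The factored bound on the absolute moments makes the integrand integrable over all three
  variables. Taking \<open>A\<close> or \<open>B\<close> to be a product measure extends two factors
  to three and four.\<close>

lemma expectation_product_of_integrals:
  fixes U :: "'a \<Rightarrow> 'v \<Rightarrow> real" and V :: "'b \<Rightarrow> 'v \<Rightarrow> real"
  assumes A: "sigma_finite_measure A" and B: "sigma_finite_measure B" and Q: "prob_space Q"
    and [measurable]: "(\<lambda>(a, \<omega>). U a \<omega>) \<in> borel_measurable (A \<Otimes>\<^sub>M Q)" "(\<lambda>(b, \<omega>). V b \<omega>) \<in> borel_measurable (B \<Otimes>\<^sub>M Q)"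
    and p: "integrable A p" "\<And>a. 0 \<le> p a" and q: "integrable B q" "\<And>b. 0 \<le> q b"
    and int: "\<And>a b. a \<in> space A \<Longrightarrow> b \<in> space B \<Longrightarrow> integrable Q (\<lambda>\<omega>. U a \<omega> * V b \<omega>)"
    and bound: "\<And>a b. a \<in> space A \<Longrightarrow> b \<in> space B \<Longrightarrow> (LINT \<omega>|Q. \<bar>U a \<omega> * V b \<omega>\<bar>) \<le> p a * q b"
  shows "(LINT \<omega>|Q. (LINT a|A. U a \<omega>) * (LINT b|B. V b \<omega>)) = (LINT a|A. LINT b|B. LINT \<omega>|Q. U a \<omega> * V b \<omega>)" (is ?A)
    and "integrable (A \<Otimes>\<^sub>M B) (\<lambda>(a, b). LINT \<omega>|Q. U a \<omega> * V b \<omega>)" (is ?B)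
proof -
  interpret A: sigma_finite_measure A by fact
  interpret B: sigma_finite_measure B by fact
  interpret Q: prob_space Q by fact
  interpret AB: pair_sigma_finite A B ..
  interpret P: sigma_finite_measure "A \<Otimes>\<^sub>M B" by (rule sigma_finite_pair_measure) fact+
  interpret PQ: pair_sigma_finite "A \<Otimes>\<^sub>M B" Q ..
  have [measurable]: "p \<in> borel_measurable A" "q \<in> borel_measurable B" using p q by auto
  have [measurable]: "(\<lambda>z. U (fst (fst z)) (snd z)) \<in> borel_measurable ((A \<Otimes>\<^sub>M B) \<Otimes>\<^sub>M Q)"
    "(\<lambda>z. V (snd (fst z)) (snd z)) \<in> borel_measurable ((A \<Otimes>\<^sub>M B) \<Otimes>\<^sub>M Q)"
    by measurable
  have pq: "integrable (A \<Otimes>\<^sub>M B) (\<lambda>(a, b). p a * q b)"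
  proof (rule AB.Fubini_integrable)
    show "integrable A (\<lambda>a. LINT b|B. norm (case (a, b) of (a, b) \<Rightarrow> p a * q b))"
      using p q by (simp add: abs_mult)
    show "AE a in A. integrable B (\<lambda>b. case (a, b) of (a, b) \<Rightarrow> p a * q b)"
      using q by simp
  qed measurable
  have F: "integrable ((A \<Otimes>\<^sub>M B) \<Otimes>\<^sub>M Q) (\<lambda>(c, \<omega>). U (fst c) \<omega> * V (snd c) \<omega>)"
  proof (rule PQ.Fubini_integrable)
    show "(\<lambda>(c, \<omega>). U (fst c) \<omega> * V (snd c) \<omega>) \<in> borel_measurable ((A \<Otimes>\<^sub>M B) \<Otimes>\<^sub>M Q)"
      unfolding split_beta' by measurable
    show "AE c in A \<Otimes>\<^sub>M B. integrable Q (\<lambda>\<omega>. case (c, \<omega>) of (c, \<omega>) \<Rightarrow> U (fst c) \<omega> * V (snd c) \<omega>)"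
      using int by (intro AE_I2) (auto simp: space_pair_measure)
    show "integrable (A \<Otimes>\<^sub>M B) (\<lambda>c. LINT \<omega>|Q. norm (case (c, \<omega>) of (c, \<omega>) \<Rightarrow> U (fst c) \<omega> * V (snd c) \<omega>))"
    proof (rule Bochner_Integration.integrable_bound[OF pq])
      show "(\<lambda>c. LINT \<omega>|Q. norm (case (c, \<omega>) of (c, \<omega>) \<Rightarrow> U (fst c) \<omega> * V (snd c) \<omega>)) \<in> borel_measurable (A \<Otimes>\<^sub>M B)"
        by (rule Q.borel_measurable_lebesgue_integral) (simp add: split_beta')
      show "AE c in A \<Otimes>\<^sub>M B. norm (LINT \<omega>|Q. norm (case (c, \<omega>) of (c, \<omega>) \<Rightarrow> U (fst c) \<omega> * V (snd c) \<omega>))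
          \<le> norm (case c of (a, b) \<Rightarrow> p a * q b)"
        using bound by (intro AE_I2) (auto simp: space_pair_measure intro: order_trans[OF _ abs_ge_self])
    qed
  qed
  have E: "integrable (A \<Otimes>\<^sub>M B) (\<lambda>c. LINT \<omega>|Q. U (fst c) \<omega> * V (snd c) \<omega>)"
    using PQ.integrable_fst'[OF F] by simp
  then show ?B
    by (simp add: split_beta')
  have "AE \<omega> in Q. integrable (A \<Otimes>\<^sub>M B) (\<lambda>c. U (fst c) \<omega> * V (snd c) \<omega>)"
    using PQ.AE_integrable_snd[OF F] .
  then have "AE \<omega> in Q. (LINT a|A. U a \<omega>) * (LINT b|B. V b \<omega>) = integral\<^sup>L (A \<Otimes>\<^sub>M B) (\<lambda>c. U (fst c) \<omega> * V (snd c) \<omega>)"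
  proof eventually_elim
    case (elim \<omega>)
    then show ?case using AB.integral_fst'[OF elim] by simp
  qed
  moreover have "(\<lambda>\<omega>. LINT a|A. U a \<omega>) \<in> borel_measurable Q" "(\<lambda>\<omega>. LINT b|B. V b \<omega>) \<in> borel_measurable Q"
    by (rule A.borel_measurable_lebesgue_integral B.borel_measurable_lebesgue_integral; measurable)+
  ultimately have "(LINT \<omega>|Q. (LINT a|A. U a \<omega>) * (LINT b|B. V b \<omega>)) = (LINT \<omega>|Q. integral\<^sup>L (A \<Otimes>\<^sub>M B) (\<lambda>c. U (fst c) \<omega> * V (snd c) \<omega>))"
    using PQ.integrable_snd[OF F] by (intro integral_cong_AE) auto
  also have "\<dots> = integral\<^sup>L (A \<Otimes>\<^sub>M B) (\<lambda>c. LINT \<omega>|Q. U (fst c) \<omega> * V (snd c) \<omega>)"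
    by (rule PQ.Fubini_integral[OF F])
  also have "\<dots> = (LINT a|A. LINT b|B. LINT \<omega>|Q. U a \<omega> * V b \<omega>)"
    using AB.integral_fst'[OF E] by simp
  finally show ?A .
qed

text \<open>Separate from \<open>gaussian_rv_moments\<close>, which presupposes mean zero: splitting
  the complex mean of the field into real and imaginary part already requires integrability.\<close>

lemma (in prob_space) gaussian_rv_integrable:
  assumes "gaussian_rv M Y"
  shows "integrable M Y"
proof -
  have [measurable]: "Y \<in> borel_measurable M" using assms by (simp add: gaussian_rv_def)
  from assms consider (normal) m s where "0 < s" "distributed M lborel Y (normal_density m s)"
    | (const) c where "AE \<omega> in M. Y \<omega> = c"
    by (auto simp: gaussian_rv_def)
  then show ?thesis
  proof cases
    case normal
    then show ?thesis
      using distributed_integrable[OF normal(2), of "\<lambda>x. x"] integrable_normal_moment_nz_1[OF normal(1)] by simp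
  next
    case const
    then show ?thesis using integrable_cong_AE[of Y M "\<lambda>_. c"] by simp
  qed
qed

text \<open>One kernel governs both second-order quantities: the pseudo-covariance is
  \<open>c\<close> with its second argument reflected. \<open>c_reflect\<close> expresses that
  characteristic functions are conjugated by reflection.\<close>

locale gaussian_field = symmetric_sfm \<mu> \<sigma> w + Q: prob_space Q
  for \<mu> :: "'t measure" and \<sigma> w and Q :: "'v measure" +
  fixes G :: "'t \<Rightarrow> 'v \<Rightarrow> complex" and c :: "'t \<Rightarrow> 't \<Rightarrow> complex" and K :: real
  assumes G_measurable: "(\<lambda>(t, \<omega>). G t \<omega>) \<in> borel_measurable (\<mu> \<Otimes>\<^sub>M Q)"
    and G_gaussian: "complex_gaussian_field Q (space \<mu>) G"
    and G_mean: "t \<in> space \<mu> \<Longrightarrow> Q.expectation (G t) = 0"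
    and G_cov: "s \<in> space \<mu> \<Longrightarrow> t \<in> space \<mu> \<Longrightarrow> (LINT \<omega>|Q. G s \<omega> * cnj (G t \<omega>)) = c s t"
    and G_pcov: "s \<in> space \<mu> \<Longrightarrow> t \<in> space \<mu> \<Longrightarrow> (LINT \<omega>|Q. G s \<omega> * G t \<omega>) = c s (\<sigma> t)"
    and c_dom: "dom_kernel \<mu> w K c"
    and c_reflect: "s \<in> space \<mu> \<Longrightarrow> t \<in> space \<mu> \<Longrightarrow> c (\<sigma> s) (\<sigma> t) = cnj (c s t)"
begin

definition V :: "('v \<Rightarrow> real) set" where
  "V = {\<lambda>\<omega>. \<Sum>t\<in>F. a t * Re (G t \<omega>) + b t * Im (G t \<omega>) | F a b. finite F \<and> F \<subseteq> space \<mu>}"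

lemma Re_in_V: "t \<in> space \<mu> \<Longrightarrow> (\<lambda>\<omega>. Re (G t \<omega>)) \<in> V"
  unfolding V_def by (rule CollectI, rule exI[of _ "{t}"], rule exI[of _ "\<lambda>_. 1"], rule exI[of _ "\<lambda>_. 0"]) simp

lemma Im_in_V: "t \<in> space \<mu> \<Longrightarrow> (\<lambda>\<omega>. Im (G t \<omega>)) \<in> V"
  unfolding V_def by (rule CollectI, rule exI[of _ "{t}"], rule exI[of _ "\<lambda>_. 0"], rule exI[of _ "\<lambda>_. 1"]) simp

lemma V_gaussian: "Y \<in> V \<Longrightarrow> gaussian_rv Q Y"
  using G_gaussian by (auto simp: V_def complex_gaussian_field_def)

lemma Re_Im_integrable:
  assumes "t \<in> space \<mu>"
  shows "integrable Q (\<lambda>\<omega>. Re (G t \<omega>))" "integrable Q (\<lambda>\<omega>. Im (G t \<omega>))"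
  using assms by (auto intro!: Q.gaussian_rv_integrable V_gaussian Re_in_V Im_in_V)

lemma Re_Im_mean:
  assumes t: "t \<in> space \<mu>"
  shows "Q.expectation (\<lambda>\<omega>. Re (G t \<omega>)) = 0" (is ?A) "Q.expectation (\<lambda>\<omega>. Im (G t \<omega>)) = 0"
proof -
  have "integrable Q (\<lambda>\<omega>. complex_of_real (Re (G t \<omega>)) + \<i> * complex_of_real (Im (G t \<omega>)))"
    using Re_Im_integrable[OF t] by simp
  then have G: "integrable Q (G t)" by (simp add: complex_eq[symmetric])
  show ?A "Q.expectation (\<lambda>\<omega>. Im (G t \<omega>)) = 0"
    using integral_Re[OF G] integral_Im[OF G] G_mean[OF t] by simp_all
qed

sublocale GV: gaussian_space Q V
proof
  fix Y assume "Y \<in> V"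
  then obtain F a b where Y: "Y = (\<lambda>\<omega>. \<Sum>t\<in>F. a t * Re (G t \<omega>) + b t * Im (G t \<omega>))" and F: "finite F" "F \<subseteq> space \<mu>"
    by (auto simp: V_def)
  show "gaussian_rv Q Y" by (rule V_gaussian) fact
  have "Q.expectation Y = (\<Sum>t\<in>F. a t * Q.expectation (\<lambda>\<omega>. Re (G t \<omega>)) + b t * Q.expectation (\<lambda>\<omega>. Im (G t \<omega>)))"
    unfolding Y using F Re_Im_integrable
    by (subst Bochner_Integration.integral_sum) (auto intro!: sum.cong)
  also have "\<dots> = 0" using F Re_Im_mean by (intro sum.neutral) auto
  finally show "Q.expectation Y = 0" .
  fix Z p q assume "Z \<in> V"
  then obtain F' a' b' where Z: "Z = (\<lambda>\<omega>. \<Sum>t\<in>F'. a' t * Re (G t \<omega>) + b' t * Im (G t \<omega>))" and F': "finite F'" "F' \<subseteq> space \<mu>"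
    by (auto simp: V_def)
  \<comment> \<open>Both coefficient families are extended by zero to the union of the index sets;
    outside its own set a family may be arbitrary, hence the indicators.\<close>
  let ?ind = "\<lambda>F t. if t \<in> F then 1 else (0 :: real)"
  have ext: "(\<Sum>t\<in>F1. h t) = (\<Sum>t\<in>F \<union> F'. ?ind F1 t * h t)" if "F1 \<subseteq> F \<union> F'" for F1 h
  proof -
    have "(\<Sum>t\<in>F1. h t) = (\<Sum>t\<in>F1. ?ind F1 t * h t)" by (intro sum.cong refl) simp
    also have "\<dots> = (\<Sum>t\<in>F \<union> F'. ?ind F1 t * h t)"
      using that F F' by (intro sum.mono_neutral_left) auto
    finally show ?thesis .
  qed
  have "p * Y \<omega> + q * Z \<omega> = (\<Sum>t\<in>F \<union> F'. (p * ?ind F t * a t + q * ?ind F' t * a' t) * Re (G t \<omega>)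
      + (p * ?ind F t * b t + q * ?ind F' t * b' t) * Im (G t \<omega>))" for \<omega>
    unfolding Y Z ext[OF Un_upper1] ext[OF Un_upper2] sum_distrib_left sum.distrib[symmetric]
    by (intro sum.cong refl) (simp add: algebra_simps)
  then show "(\<lambda>\<omega>. p * Y \<omega> + q * Z \<omega>) \<in> V"
    unfolding V_def using F F'
    by (intro CollectI exI[of _ "F \<union> F'"] exI[of _ "\<lambda>t. p * ?ind F t * a t + q * ?ind F' t * a' t"]
        exI[of _ "\<lambda>t. p * ?ind F t * b t + q * ?ind F' t * b' t"]) auto
qed

section \<open>The real companion field and the reflection symmetry\<close>

definition H :: "'t \<Rightarrow> 'v \<Rightarrow> real" where "H t \<omega> = Re (G t \<omega>) + Im (G t \<omega>)"

abbreviation "h \<equiv> hartley \<sigma> c"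
abbreviation "E \<equiv> Q.expectation"

lemma H_in_V: "t \<in> space \<mu> \<Longrightarrow> H t \<in> V"
  using GV.lincomb[OF Re_in_V Im_in_V, of t t 1 1] by (simp add: H_def[abs_def])

lemma G_measurable'[measurable]: "(\<lambda>p. G (fst p) (snd p)) \<in> borel_measurable (\<mu> \<Otimes>\<^sub>M Q)"
  using G_measurable by (simp add: split_beta')

lemma G_product_integrable:
  assumes "s \<in> space \<mu>" "t \<in> space \<mu>"
  shows "integrable Q (\<lambda>\<omega>. G s \<omega> * cnj (G t \<omega>))" (is ?A) "integrable Q (\<lambda>\<omega>. G s \<omega> * G t \<omega>)" (is ?B)
    and "E (\<lambda>\<omega>. G s \<omega> * cnj (G t \<omega>)) = Complex (GV.cov (\<lambda>\<omega>. Re (G s \<omega>)) (\<lambda>\<omega>. Re (G t \<omega>)) + GV.cov (\<lambda>\<omega>. Im (G s \<omega>)) (\<lambda>\<omega>. Im (G t \<omega>)))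
      (GV.cov (\<lambda>\<omega>. Im (G s \<omega>)) (\<lambda>\<omega>. Re (G t \<omega>)) - GV.cov (\<lambda>\<omega>. Re (G s \<omega>)) (\<lambda>\<omega>. Im (G t \<omega>)))" (is ?C)
    and "E (\<lambda>\<omega>. G s \<omega> * G t \<omega>) = Complex (GV.cov (\<lambda>\<omega>. Re (G s \<omega>)) (\<lambda>\<omega>. Re (G t \<omega>)) - GV.cov (\<lambda>\<omega>. Im (G s \<omega>)) (\<lambda>\<omega>. Im (G t \<omega>)))
      (GV.cov (\<lambda>\<omega>. Re (G s \<omega>)) (\<lambda>\<omega>. Im (G t \<omega>)) + GV.cov (\<lambda>\<omega>. Im (G s \<omega>)) (\<lambda>\<omega>. Re (G t \<omega>)))" (is ?D)
proof -
  note int = GV.integrable_cov[OF Re_in_V Re_in_V, OF assms] GV.integrable_cov[OF Re_in_V Im_in_V, OF assms]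
    GV.integrable_cov[OF Im_in_V Re_in_V, OF assms] GV.integrable_cov[OF Im_in_V Im_in_V, OF assms]
  have split: "z = of_real (Re z) + \<i> * of_real (Im z)" for z by (simp add: complex_eq)
  have C: "G s \<omega> * cnj (G t \<omega>) = of_real (Re (G s \<omega>) * Re (G t \<omega>) + Im (G s \<omega>) * Im (G t \<omega>)) +
      \<i> * of_real (Im (G s \<omega>) * Re (G t \<omega>) - Re (G s \<omega>) * Im (G t \<omega>))" for \<omega>
    by (simp add: complex_eq_iff)
  have D: "G s \<omega> * G t \<omega> = of_real (Re (G s \<omega>) * Re (G t \<omega>) - Im (G s \<omega>) * Im (G t \<omega>)) +
      \<i> * of_real (Re (G s \<omega>) * Im (G t \<omega>) + Im (G s \<omega>) * Re (G t \<omega>))" for \<omega>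
    by (simp add: complex_eq_iff)
  show ?A
    unfolding C using int by (intro Bochner_Integration.integrable_add integrable_mult_right integrable_of_real Bochner_Integration.integrable_diff)
  show ?B
    unfolding D using int by (intro Bochner_Integration.integrable_add integrable_mult_right integrable_of_real Bochner_Integration.integrable_diff)
  show ?C
    unfolding C using int
    by (subst Bochner_Integration.integral_add) (simp_all add: GV.cov_def complex_eq_iff del: of_real_add of_real_diff of_real_mult)
  show ?D
    unfolding D using int
    by (subst Bochner_Integration.integral_add) (simp_all add: GV.cov_def complex_eq_iff del: of_real_add of_real_diff of_real_mult)
qed

lemma c_cnj: "s \<in> space \<mu> \<Longrightarrow> t \<in> space \<mu> \<Longrightarrow> c t s = cnj (c s t)"
  unfolding G_cov[symmetric] by (subst Bochner_Integration.integral_cnj[symmetric]) (simp add: mult.commute)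

text \<open>Only two combinations of covariances of real and imaginary parts occur: the direct ones
  sum to the real part of \<open>c s t\<close>, the mixed ones to the imaginary part of the
  pseudo-covariance \<open>c s (\<sigma> t)\<close>.\<close>

lemma cov_H:
  assumes st: "s \<in> space \<mu>" "t \<in> space \<mu>"
  shows "of_real (GV.cov (H s) (H t)) = h s t"
proof -
  have "h s t = of_real (Re (c s t) + Im (c s (\<sigma> t)))"
  proof -
    have "c (\<sigma> s) t = cnj (c s (\<sigma> t))"
      using c_reflect[OF st(1) \<sigma>_space[OF st(2)]] \<sigma>_\<sigma>[OF st(2)] by simp
    then show ?thesis
      by (simp add: hartley_def c_reflect[OF st] complex_eq_iff)
  qed
  moreover have "GV.cov (H s) (H t) = GV.cov (\<lambda>\<omega>. Re (G s \<omega>)) (\<lambda>\<omega>. Re (G t \<omega>)) + GV.cov (\<lambda>\<omega>. Im (G s \<omega>)) (\<lambda>\<omega>. Im (G t \<omega>))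
      + (GV.cov (\<lambda>\<omega>. Re (G s \<omega>)) (\<lambda>\<omega>. Im (G t \<omega>)) + GV.cov (\<lambda>\<omega>. Im (G s \<omega>)) (\<lambda>\<omega>. Re (G t \<omega>)))"
  proof -
    note int = GV.integrable_cov[OF Re_in_V Re_in_V, OF st] GV.integrable_cov[OF Re_in_V Im_in_V, OF st]
      GV.integrable_cov[OF Im_in_V Re_in_V, OF st] GV.integrable_cov[OF Im_in_V Im_in_V, OF st]
    show ?thesis
      unfolding GV.cov_def H_def using int by (simp add: algebra_simps)
  qed
  ultimately show ?thesis
    using G_product_integrable(3,4)[OF st] G_cov[OF st] G_pcov[OF st] by simp
qed

definition r :: "'t \<Rightarrow> 't \<Rightarrow> real" where "r s t = Re (h s t)"

lemma h_r: "s \<in> space \<mu> \<Longrightarrow> t \<in> space \<mu> \<Longrightarrow> h s t = of_real (r s t)"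
  and cov_r: "s \<in> space \<mu> \<Longrightarrow> t \<in> space \<mu> \<Longrightarrow> GV.cov (H s) (H t) = r s t"
  using cov_H[of s t] by (simp_all add: r_def flip: cov_H)

lemma h_dom: "dom_kernel \<mu> w (2 * K) h"
  by (rule dom_kernel_hartley[OF c_dom])

text \<open>Spreads the constant \<open>2 * K\<close> of the kernel \<open>h\<close> evenly over its
  two arguments, giving the form \<open>u s * u t\<close> that the Gaussian moment bounds
  expect.\<close>

definition u :: "'t \<Rightarrow> real" where "u t = sqrt (2 * K) * w t"

lemma K_nonneg: "0 \<le> K"
  using c_dom by (simp add: dom_kernel_def)

lemma u_nonneg: "0 \<le> u t"
  using w K_nonneg by (simp add: u_def weight_def)

lemma u_sq_integrable: "integrable \<mu> (\<lambda>t. (u t)\<^sup>2)"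
  using w unfolding u_def power_mult_distrib by (simp add: weight_def)

lemma r_bound:
  assumes "s \<in> space \<mu>" "t \<in> space \<mu>"
  shows "\<bar>GV.cov (H s) (H t)\<bar> \<le> u s * u t"
proof -
  have "\<bar>r s t\<bar> \<le> cmod (h s t)" by (simp add: h_r[OF assms])
  also have "\<dots> \<le> 2 * K * (w s * w t)" by (rule dom_kernelD[OF h_dom assms])
  also have "\<dots> = (sqrt (2 * K) * sqrt (2 * K)) * (w s * w t)" using K_nonneg by simp
  also have "\<dots> = u s * u t" by (simp only: u_def mult_ac)
  finally show ?thesis by (simp add: cov_r[OF assms])
qed

text \<open>The mean squared modulus of the difference expands into values of \<open>c\<close> at
  \<open>(t, t)\<close> and its reflection. These are real and equal, and they cancel.\<close>

lemma G_reflect: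
  assumes t: "t \<in> space \<mu>"
  shows "AE \<omega> in Q. G (\<sigma> t) \<omega> = cnj (G t \<omega>)"
proof -
  note \<sigma>t = \<sigma>_space[OF t]
  let ?x = "c t t"
  have real: "cnj ?x = ?x" using c_cnj[OF t t] by simp
  have e: "(\<lambda>\<omega>. of_real ((cmod (G (\<sigma> t) \<omega> - cnj (G t \<omega>)))\<^sup>2))
    = (\<lambda>\<omega>. G (\<sigma> t) \<omega> * cnj (G (\<sigma> t) \<omega>) - G (\<sigma> t) \<omega> * G t \<omega> - cnj (G (\<sigma> t) \<omega> * G t \<omega>) + cnj (G t \<omega> * cnj (G t \<omega>)))"
    unfolding complex_norm_square by (simp add: algebra_simps fun_eq_iff)
  note int = G_product_integrable(1)[OF \<sigma>t \<sigma>t] G_product_integrable(2)[OF \<sigma>t t] G_product_integrable(1)[OF t t]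
  have inte: "integrable Q (\<lambda>\<omega>. complex_of_real ((cmod (G (\<sigma> t) \<omega> - cnj (G t \<omega>)))\<^sup>2))"
    unfolding e using int by (intro Bochner_Integration.integrable_add Bochner_Integration.integrable_diff integrable_cnj)
  have "(LINT \<omega>|Q. complex_of_real ((cmod (G (\<sigma> t) \<omega> - cnj (G t \<omega>)))\<^sup>2))
    = c (\<sigma> t) (\<sigma> t) - c (\<sigma> t) (\<sigma> t) - cnj (c (\<sigma> t) (\<sigma> t)) + cnj ?x"
    unfolding e using int G_cov[OF \<sigma>t \<sigma>t] G_pcov[OF \<sigma>t t] G_cov[OF t t]
    by (simp del: complex_cnj_mult)
  also have "\<dots> = 0" using c_reflect[OF t t] real by simp
  finally have "(LINT \<omega>|Q. (cmod (G (\<sigma> t) \<omega> - cnj (G t \<omega>)))\<^sup>2) = 0"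
    by (simp only: integral_complex_of_real of_real_eq_0_iff)
  moreover have "integrable Q (\<lambda>\<omega>. (cmod (G (\<sigma> t) \<omega> - cnj (G t \<omega>)))\<^sup>2)"
    using integrable_Re[OF inte] by simp
  ultimately have "AE \<omega> in Q. (cmod (G (\<sigma> t) \<omega> - cnj (G t \<omega>)))\<^sup>2 = 0"
    by (subst (asm) integral_nonneg_eq_0_iff_AE) auto
  then show ?thesis by eventually_elim simp
qed

interpretation \<mu>Q: pair_sigma_finite \<mu> Q ..

lemma AE_G_reflect: "AE \<omega> in Q. AE t in \<mu>. G (\<sigma> t) \<omega> = cnj (G t \<omega>)"
proof (rule \<mu>Q.AE_commute[THEN iffD1])
  have [measurable]: "(\<lambda>p. cnj (G (fst p) (snd p))) \<in> borel_measurable (\<mu> \<Otimes>\<^sub>M Q)"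
    by (intro measurable_compose[OF G_measurable'] borel_measurable_continuous_onI continuous_intros)
  have [measurable]: "(\<lambda>p. G (\<sigma> (fst p)) (snd p)) \<in> borel_measurable (\<mu> \<Otimes>\<^sub>M Q)"
    using measurable_compose[OF _ G_measurable', of "\<lambda>p. (\<sigma> (fst p), snd p)"] by simp
  show "{p \<in> space (\<mu> \<Otimes>\<^sub>M Q). G (\<sigma> (fst p)) (snd p) = cnj (G (fst p) (snd p))} \<in> sets (\<mu> \<Otimes>\<^sub>M Q)"
    by measurable
  show "AE t in \<mu>. AE \<omega> in Q. G (\<sigma> t) \<omega> = cnj (G t \<omega>)"
    by (intro AE_I2 G_reflect)
qed

definition Z :: "'v \<Rightarrow> real" where "Z \<omega> = (LINT t|\<mu>. (cmod (G t \<omega>))\<^sup>2)"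

lemma G_sq_integrable: "integrable (\<mu> \<Otimes>\<^sub>M Q) (\<lambda>(t, \<omega>). (cmod (G t \<omega>))\<^sup>2)" (is ?A)
  and E_G_sq: "t \<in> space \<mu> \<Longrightarrow> of_real (E (\<lambda>\<omega>. (cmod (G t \<omega>))\<^sup>2)) = c t t"
proof -
  have sq: "of_real (E (\<lambda>\<omega>. (cmod (G t \<omega>))\<^sup>2)) = c t t" "integrable Q (\<lambda>\<omega>. (cmod (G t \<omega>))\<^sup>2)" if t: "t \<in> space \<mu>" for t
  proof -
    have *: "(\<lambda>\<omega>. complex_of_real ((cmod (G t \<omega>))\<^sup>2)) = (\<lambda>\<omega>. G t \<omega> * cnj (G t \<omega>))"
      unfolding complex_norm_square ..
    show "of_real (E (\<lambda>\<omega>. (cmod (G t \<omega>))\<^sup>2)) = c t t"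
      using G_cov[OF t t] unfolding *[symmetric] integral_complex_of_real .
    show "integrable Q (\<lambda>\<omega>. (cmod (G t \<omega>))\<^sup>2)"
      using integrable_Re[OF G_product_integrable(1)[OF t t, folded *]] by simp
  qed
  then show "t \<in> space \<mu> \<Longrightarrow> of_real (E (\<lambda>\<omega>. (cmod (G t \<omega>))\<^sup>2)) = c t t" by simp
  show ?A
  proof (rule \<mu>Q.Fubini_integrable)
    show "(\<lambda>(t, \<omega>). (cmod (G t \<omega>))\<^sup>2) \<in> borel_measurable (\<mu> \<Otimes>\<^sub>M Q)"
      unfolding split_beta' by measurable
    show "AE t in \<mu>. integrable Q (\<lambda>\<omega>. case (t, \<omega>) of (t, \<omega>) \<Rightarrow> (cmod (G t \<omega>))\<^sup>2)"
      using sq by (intro AE_I2) simp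
    have "integrable \<mu> (\<lambda>t. Re (c t t))" by (rule integrable_Re[OF ktrace_integrable[OF w c_dom]])
    moreover have "Re (c t t) = E (\<lambda>\<omega>. (cmod (G t \<omega>))\<^sup>2)" if "t \<in> space \<mu>" for t
      using sq(1)[OF that] by (metis Re_complex_of_real)
    ultimately show "integrable \<mu> (\<lambda>t. LINT \<omega>|Q. norm (case (t, \<omega>) of (t, \<omega>) \<Rightarrow> (cmod (G t \<omega>))\<^sup>2))"
      by (subst Bochner_Integration.integrable_cong[OF refl, of _ _ "\<lambda>t. Re (c t t)"]) auto
  qed
qed

theorem expectation_Z: "of_real (E Z) = ktrace \<mu> c"
proof -
  have "E Z = (LINT t|\<mu>. E (\<lambda>\<omega>. (cmod (G t \<omega>))\<^sup>2))"
    unfolding Z_def by (rule \<mu>Q.Fubini_integral[OF G_sq_integrable])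
  then have "of_real (E Z) = (LINT t|\<mu>. complex_of_real (E (\<lambda>\<omega>. (cmod (G t \<omega>))\<^sup>2)))"
    by (simp only: integral_complex_of_real)
  also have "\<dots> = ktrace \<mu> c"
    unfolding ktrace_def by (rule Bochner_Integration.integral_cong[OF refl E_G_sq])
  finally show ?thesis .
qed

text \<open>The centred square of \<open>H\<close>; \<open>r t t\<close> is its variance. The
  central moments of \<open>Z\<close> are iterated integrals of mixed moments of
  \<open>W\<close>.\<close>

definition W :: "'t \<Rightarrow> 'v \<Rightarrow> real" where "W t \<omega> = (H t \<omega>)\<^sup>2 - r t t"

lemma r_diag_integrable: "integrable \<mu> (\<lambda>t. r t t)" and r_diag_integral: "(LINT t|\<mu>. r t t) = E Z"
proof -
  have int: "integrable \<mu> (\<lambda>t. h t t)" by (rule ktrace_integrable[OF w h_dom])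
  then show "integrable \<mu> (\<lambda>t. r t t)" unfolding r_def by (rule integrable_Re)
  have "(LINT t|\<mu>. r t t) = Re (ktrace \<mu> h)"
    unfolding r_def ktrace_def by (rule integral_Re[OF int])
  also have "\<dots> = E Z" by (simp add: ktrace_hartley[OF c_dom] flip: expectation_Z)
  finally show "(LINT t|\<mu>. r t t) = E Z" .
qed

text \<open>The squares of \<open>H\<close> and of the modulus of \<open>G\<close> differ by twice
  the product of real and imaginary part, which is odd under reflection. The centring integrates to
  the mean of \<open>Z\<close> because the Hartley transform preserves the trace.\<close>

lemma AE_W: "AE \<omega> in Q. integrable \<mu> (\<lambda>t. W t \<omega>) \<and> (LINT t|\<mu>. W t \<omega>) = Z \<omega> - E Z"
  using AE_G_reflect \<mu>Q.AE_integrable_snd[OF G_sq_integrable] AE_space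
proof eventually_elim
  case (elim \<omega>)
  have meas[measurable]: "(\<lambda>t. G t \<omega>) \<in> borel_measurable \<mu>"
    using measurable_Pair1[OF G_measurable elim(3)] by simp
  have G2: "integrable \<mu> (\<lambda>t. (cmod (G t \<omega>))\<^sup>2)" using elim(2) by simp
  let ?P = "\<lambda>t. Re (G t \<omega>) * Im (G t \<omega>)"
  have P: "integrable \<mu> ?P"
  proof (rule Bochner_Integration.integrable_bound[OF G2])
    show "AE t in \<mu>. norm (?P t) \<le> norm ((cmod (G t \<omega>))\<^sup>2)"
      by (intro AE_I2) (auto simp: abs_mult power2_eq_square intro!: mult_mono abs_Re_le_cmod abs_Im_le_cmod)
  qed measurable
  \<comment> \<open>Reflection conjugates \<open>G\<close>, hence changes the sign of
    \<open>?P\<close>, while the measure is invariant; so the integral is its own negative.\<close>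
  have "(LINT t|\<mu>. ?P t) = (LINT t|\<mu>. ?P (\<sigma> t))"
    by (rule integral_reflect[symmetric]) measurable
  also have "\<dots> = (LINT t|\<mu>. - ?P t)"
  proof (rule integral_cong_AE)
    show "AE t in \<mu>. ?P (\<sigma> t) = - ?P t" using elim(1) by eventually_elim simp
    show "(\<lambda>t. ?P (\<sigma> t)) \<in> borel_measurable \<mu>"
      by (rule measurable_compose[OF \<sigma>, of ?P]) measurable
  qed measurable
  finally have P0: "(LINT t|\<mu>. ?P t) = 0" by simp
  have W: "W t \<omega> = (cmod (G t \<omega>))\<^sup>2 + 2 * ?P t - r t t" for t
    unfolding W_def H_def cmod_power2 by (simp add: power2_sum)
  show ?case
    unfolding W Z_def[of \<omega>] using G2 P P0 r_diag_integrable r_diag_integral by simp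
qed

lemma W_cov: "t \<in> space \<mu> \<Longrightarrow> W t \<omega> = (H t \<omega>)\<^sup>2 - GV.cov (H t) (H t)"
  by (simp add: W_def cov_r)

lemma W_measurable: "(\<lambda>p. W (fst p) (snd p)) \<in> borel_measurable (\<mu> \<Otimes>\<^sub>M Q)"
proof -
  have [measurable]: "(\<lambda>t. r t t) \<in> borel_measurable \<mu>" using r_diag_integrable by auto
  show ?thesis unfolding W_def H_def by measurable
qed

lemma Z_measurable: "Z \<in> borel_measurable Q"
  using \<mu>Q.integrable_snd[OF G_sq_integrable] by (auto simp: Z_def[abs_def])

text \<open>The factored majorant allows expectation and integrals to be interchanged;
  \<open>n = 2, 3, 4\<close> yields the constants of the bounds below.\<close>

lemma W_product_bound:
  assumes "\<And>j. j < n \<Longrightarrow> t j \<in> space \<mu>"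
  shows "integrable Q (\<lambda>\<omega>. \<Prod>j<n. W (t j) \<omega>)" (is ?A)
    and "E (\<lambda>\<omega>. \<bar>\<Prod>j<n. W (t j) \<omega>\<bar>) \<le> 2 ^ n * fact (2 * n) * (\<Prod>j<n. (u (t j))\<^sup>2)" (is ?B)
proof -
  have *: "(\<Prod>j<n. W (t j) \<omega>) = (\<Prod>j\<in>{..<n}. (H (t j) \<omega>)\<^sup>2 - GV.cov (H (t j)) (H (t j)))" for \<omega>
    using assms by (intro prod.cong refl) (simp add: W_cov)
  show ?A
    unfolding * using assms
    by (intro GV.centered_squares_integrable_bound(1)[where u = "\<lambda>j. u (t j)"]) (auto intro: H_in_V u_nonneg r_bound)
  show ?B
    unfolding * using assms GV.centered_squares_integrable_bound(2)[of "{..<n}" "\<lambda>j. H (t j)" "\<lambda>j. u (t j)"]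
    by (auto intro: H_in_V u_nonneg r_bound)
qed


lemma W_measurable': "(\<lambda>(t, \<omega>). W t \<omega>) \<in> borel_measurable (\<mu> \<Otimes>\<^sub>M Q)"
  using W_measurable by (simp add: split_beta')

lemma W_pair_measurable: "(\<lambda>(p, \<omega>). W (fst p) \<omega> * W (snd p) \<omega>) \<in> borel_measurable ((\<mu> \<Otimes>\<^sub>M \<mu>) \<Otimes>\<^sub>M Q)"
proof -
  have "(\<lambda>z. (fst (fst z), snd z)) \<in> measurable ((\<mu> \<Otimes>\<^sub>M \<mu>) \<Otimes>\<^sub>M Q) (\<mu> \<Otimes>\<^sub>M Q)"
    "(\<lambda>z. (snd (fst z), snd z)) \<in> measurable ((\<mu> \<Otimes>\<^sub>M \<mu>) \<Otimes>\<^sub>M Q) (\<mu> \<Otimes>\<^sub>M Q)"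
    by measurable
  from this[THEN measurable_compose[OF _ W_measurable]] show ?thesis
    unfolding split_beta' by (intro borel_measurable_times) simp_all
qed

lemma u_pair_integrable: "integrable (\<mu> \<Otimes>\<^sub>M \<mu>) (\<lambda>p. (u (fst p))\<^sup>2 * (u (snd p))\<^sup>2)"
proof -
  have [measurable]: "u \<in> borel_measurable \<mu>" unfolding u_def by measurable
  have "integrable (\<mu> \<Otimes>\<^sub>M \<mu>) (\<lambda>(s, t). (u s)\<^sup>2 * (u t)\<^sup>2)"
  proof (rule pair.Fubini_integrable)
    show "integrable \<mu> (\<lambda>s. LINT t|\<mu>. norm (case (s, t) of (s, t) \<Rightarrow> (u s)\<^sup>2 * (u t)\<^sup>2))"
      using u_sq_integrable by simp
    show "AE s in \<mu>. integrable \<mu> (\<lambda>t. case (s, t) of (s, t) \<Rightarrow> (u s)\<^sup>2 * (u t)\<^sup>2)"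
      using u_sq_integrable by simp
  qed measurable
  then show ?thesis by (simp add: split_beta')
qed

lemma sigma_finite_\<mu>: "sigma_finite_measure \<mu>"
  by (rule sigma_finite_measure_axioms)

lemma sigma_finite_\<mu>\<mu>: "sigma_finite_measure (\<mu> \<Otimes>\<^sub>M \<mu>)"
  by (intro sigma_finite_pair_measure sigma_finite_\<mu>)

lemma integral_W_pair:
  assumes "integrable \<mu> (\<lambda>t. W t \<omega>)"
  shows "integral\<^sup>L (\<mu> \<Otimes>\<^sub>M \<mu>) (\<lambda>p. W (fst p) \<omega> * W (snd p) \<omega>) = (LINT t|\<mu>. W t \<omega>)\<^sup>2"
proof -
  have [measurable]: "(\<lambda>t. W t \<omega>) \<in> borel_measurable \<mu>" using assms by auto
  have "integrable (\<mu> \<Otimes>\<^sub>M \<mu>) (\<lambda>p. W (fst p) \<omega> * W (snd p) \<omega>)"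
  proof (rule pair.Fubini_integrable)
    show "integrable \<mu> (\<lambda>s. LINT t|\<mu>. norm (W (fst (s, t)) \<omega> * W (snd (s, t)) \<omega>))"
      using assms by (simp add: abs_mult)
    show "AE s in \<mu>. integrable \<mu> (\<lambda>t. W (fst (s, t)) \<omega> * W (snd (s, t)) \<omega>)"
      using assms by simp
  qed measurable
  from pair.integral_fst'[OF this] show ?thesis by (simp add: power2_eq_square)
qed

lemma r_symmetric: "s \<in> space \<mu> \<Longrightarrow> t \<in> space \<mu> \<Longrightarrow> r s t = r t s"
  using GV.cov_commute[of "H s" "H t"] by (simp add: cov_r)

lemma complex_integral_r:
  "complex_of_real (LINT s|\<mu>. F s) = (LINT s|\<mu>. complex_of_real (F s))"
  by (simp only: integral_complex_of_real)


lemma integral_W_measurable: "(\<lambda>\<omega>. LINT t|\<mu>. W t \<omega>) \<in> borel_measurable Q"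
  by (rule borel_measurable_lebesgue_integral)
     (use measurable_compose[OF measurable_pair_swap' W_measurable] in \<open>simp add: split_beta'\<close>)

section \<open>Mixed moments of the centred squares and central moments of the norm\<close>

lemma E_W2:
  assumes "s \<in> space \<mu>" "t \<in> space \<mu>"
  shows "E (\<lambda>\<omega>. W s \<omega> * W t \<omega>) = 2 * (r s t * r t s)"
  unfolding W_cov[OF assms(1)] W_cov[OF assms(2)] GV.expectation_centered_squares2[OF H_in_V[OF assms(1)] H_in_V[OF assms(2)]]
  using r_symmetric[OF assms] by (simp add: cov_r assms power2_eq_square)

lemma E_W3:
  assumes "s \<in> space \<mu>" "t \<in> space \<mu>" "v \<in> space \<mu>"
  shows "E (\<lambda>\<omega>. W s \<omega> * W t \<omega> * W v \<omega>) = 8 * (r s t * (r t v * r v s))"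
  unfolding W_cov[OF assms(1)] W_cov[OF assms(2)] W_cov[OF assms(3)]
    GV.expectation_centered_squares3[OF H_in_V[OF assms(1)] H_in_V[OF assms(2)] H_in_V[OF assms(3)]]
  by (simp add: cov_r assms)

lemma E_W4:
  assumes "s \<in> space \<mu>" "t \<in> space \<mu>" "v \<in> space \<mu>" "x \<in> space \<mu>"
  shows "E (\<lambda>\<omega>. (W s \<omega> * W t \<omega>) * (W v \<omega> * W x \<omega>)) =
    4 * ((r s t)\<^sup>2 * (r v x)\<^sup>2 + (r s v)\<^sup>2 * (r t x)\<^sup>2 + (r s x)\<^sup>2 * (r t v)\<^sup>2) +
    16 * (r s t * r t v * r v x * r x s + r s t * r t x * r x v * r v s + r s v * r v t * r t x * r x s)"
proof -
  have "E (\<lambda>\<omega>. (W s \<omega> * W t \<omega>) * (W v \<omega> * W x \<omega>)) = E (\<lambda>\<omega>. W s \<omega> * W t \<omega> * W v \<omega> * W x \<omega>)"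
    by (simp add: mult.assoc)
  then show ?thesis
    unfolding W_cov[OF assms(1)] W_cov[OF assms(2)] W_cov[OF assms(3)] W_cov[OF assms(4)]
      GV.expectation_centered_squares4[OF H_in_V[OF assms(1)] H_in_V[OF assms(2)] H_in_V[OF assms(3)] H_in_V[OF assms(4)]]
    by (simp only: cov_r assms)
qed

lemma W_bound2:
  assumes "s \<in> space \<mu>" "t \<in> space \<mu>"
  shows "integrable Q (\<lambda>\<omega>. W s \<omega> * W t \<omega>)" (is ?A) "E (\<lambda>\<omega>. \<bar>W s \<omega> * W t \<omega>\<bar>) \<le> (2 ^ 2 * fact 4 * (u s)\<^sup>2) * (u t)\<^sup>2"
proof -
  have *: "[s, t] ! j \<in> space \<mu>" if "j < 2" for j using that assms by (auto simp: less_2_cases_iff)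
  show ?A "E (\<lambda>\<omega>. \<bar>W s \<omega> * W t \<omega>\<bar>) \<le> (2 ^ 2 * fact 4 * (u s)\<^sup>2) * (u t)\<^sup>2"
    using W_product_bound[of 2 "\<lambda>j. [s, t] ! j", OF *] by (simp_all add: lessThan_nat_numeral lessThan_Suc mult_ac)
qed

lemma W_bound3:
  assumes "s \<in> space \<mu>" "t \<in> space \<mu>" "v \<in> space \<mu>"
  shows "integrable Q (\<lambda>\<omega>. W s \<omega> * W t \<omega> * W v \<omega>)" (is ?A)
    "E (\<lambda>\<omega>. \<bar>W s \<omega> * W t \<omega> * W v \<omega>\<bar>) \<le> (2 ^ 3 * fact 6 * ((u s)\<^sup>2 * (u t)\<^sup>2)) * (u v)\<^sup>2"
proof -
  have *: "[s, t, v] ! j \<in> space \<mu>" if "j < 3" for j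
    using that assms by (auto simp: less_Suc_eq eval_nat_numeral)
  show ?A
    "E (\<lambda>\<omega>. \<bar>W s \<omega> * W t \<omega> * W v \<omega>\<bar>) \<le> (2 ^ 3 * fact 6 * ((u s)\<^sup>2 * (u t)\<^sup>2)) * (u v)\<^sup>2"
    using W_product_bound[of 3 "\<lambda>j. [s, t, v] ! j", OF *] by (simp_all add: lessThan_nat_numeral lessThan_Suc mult_ac)
qed

lemma W_bound4:
  assumes "s \<in> space \<mu>" "t \<in> space \<mu>" "v \<in> space \<mu>" "x \<in> space \<mu>"
  shows "integrable Q (\<lambda>\<omega>. (W s \<omega> * W t \<omega>) * (W v \<omega> * W x \<omega>))" (is ?A)
    "E (\<lambda>\<omega>. \<bar>(W s \<omega> * W t \<omega>) * (W v \<omega> * W x \<omega>)\<bar>) \<le> (2 ^ 4 * fact 8 * ((u s)\<^sup>2 * (u t)\<^sup>2)) * ((u v)\<^sup>2 * (u x)\<^sup>2)"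
proof -
  have *: "[s, t, v, x] ! j \<in> space \<mu>" if "j < 4" for j
    using that assms by (auto simp: less_Suc_eq eval_nat_numeral)
  show ?A
    "E (\<lambda>\<omega>. \<bar>(W s \<omega> * W t \<omega>) * (W v \<omega> * W x \<omega>)\<bar>) \<le> (2 ^ 4 * fact 8 * ((u s)\<^sup>2 * (u t)\<^sup>2)) * ((u v)\<^sup>2 * (u x)\<^sup>2)"
    using W_product_bound[of 4 "\<lambda>j. [s, t, v, x] ! j", OF *] by (simp_all add: lessThan_nat_numeral lessThan_Suc mult_ac)
qed

lemma integral_W_pair_measurable:
  "(\<lambda>\<omega>. integral\<^sup>L (\<mu> \<Otimes>\<^sub>M \<mu>) (\<lambda>p. W (fst p) \<omega> * W (snd p) \<omega>)) \<in> borel_measurable Q"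
  by (rule sigma_finite_measure.borel_measurable_lebesgue_integral[OF sigma_finite_\<mu>\<mu>])
     (use measurable_compose[OF measurable_pair_swap' W_pair_measurable] in \<open>simp add: split_beta'\<close>)

theorem second_moment_Z: "of_real (E (\<lambda>\<omega>. (Z \<omega> - E Z)\<^sup>2)) = 2 * ktrace \<mu> (kcomp \<mu> c c)"
proof -
  have "E (\<lambda>\<omega>. (Z \<omega> - E Z)\<^sup>2) = E (\<lambda>\<omega>. (LINT s|\<mu>. W s \<omega>) * (LINT t|\<mu>. W t \<omega>))"
  proof (rule integral_cong_AE)
    show "AE \<omega> in Q. (Z \<omega> - E Z)\<^sup>2 = (LINT s|\<mu>. W s \<omega>) * (LINT t|\<mu>. W t \<omega>)"
      using AE_W by eventually_elim (simp add: power2_eq_square)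
  qed (use Z_measurable integral_W_measurable in measurable)
  also have "\<dots> = (LINT s|\<mu>. LINT t|\<mu>. E (\<lambda>\<omega>. W s \<omega> * W t \<omega>))"
    by (intro expectation_product_of_integrals(1)[OF sigma_finite_\<mu> sigma_finite_\<mu> Q.prob_space_axioms W_measurable' W_measurable',
          where p = "\<lambda>s. 2 ^ 2 * fact 4 * (u s)\<^sup>2" and q = "\<lambda>t. (u t)\<^sup>2"])
       (auto intro: u_sq_integrable W_bound2(1) order_trans[OF W_bound2(2)])
  also have "\<dots> = (LINT s|\<mu>. LINT t|\<mu>. 2 * (r s t * r t s))"
    by (intro Bochner_Integration.integral_cong refl E_W2)
  finally have "of_real (E (\<lambda>\<omega>. (Z \<omega> - E Z)\<^sup>2)) = (LINT s|\<mu>. LINT t|\<mu>. 2 * (h s t * h t s))"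
    by (simp only: complex_integral_r) (intro Bochner_Integration.integral_cong refl, simp add: h_r)
  also have "\<dots> = 2 * ktrace \<mu> (kcomp \<mu> h h)"
    by (simp add: ktrace_def kcomp_def)
  also have "ktrace \<mu> (kcomp \<mu> h h) = ktrace \<mu> (hartley \<sigma> (kcomp \<mu> c c))"
    by (rule ktrace_cong) (rule kcomp_hartley[OF c_dom c_dom])
  finally show ?thesis by (simp add: ktrace_hartley[OF dom_kernel_kcomp[OF w c_dom c_dom]])
qed

text \<open>The cube is split as a square, viewed as one integral over the product measure, times a
  single integral, so that the two-factor Fubini statement applies.\<close>

theorem third_moment_Z:
  "of_real (E (\<lambda>\<omega>. (Z \<omega> - E Z) ^ 3)) = 8 * ktrace \<mu> (kcomp \<mu> (kcomp \<mu> c c) c)"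
proof -
  interpret PP: pair_sigma_finite "\<mu> \<Otimes>\<^sub>M \<mu>" \<mu>
    by (intro pair_sigma_finite.intro sigma_finite_\<mu>\<mu> sigma_finite_\<mu>)
  note eq = expectation_product_of_integrals[OF sigma_finite_\<mu>\<mu> sigma_finite_\<mu> Q.prob_space_axioms W_pair_measurable W_measurable',
      where p = "\<lambda>p. 2 ^ 3 * fact 6 * ((u (fst p))\<^sup>2 * (u (snd p))\<^sup>2)" and q = "\<lambda>t. (u t)\<^sup>2"]
  note prems = u_pair_integrable u_sq_integrable W_bound3(1) order_trans[OF W_bound3(2)]
  have int: "integrable ((\<mu> \<Otimes>\<^sub>M \<mu>) \<Otimes>\<^sub>M \<mu>) (\<lambda>(p, v). E (\<lambda>\<omega>. W (fst p) \<omega> * W (snd p) \<omega> * W v \<omega>))"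
    by (rule eq(2)) (auto intro: prems simp: space_pair_measure)
  have "E (\<lambda>\<omega>. (Z \<omega> - E Z) ^ 3)
    = E (\<lambda>\<omega>. integral\<^sup>L (\<mu> \<Otimes>\<^sub>M \<mu>) (\<lambda>p. W (fst p) \<omega> * W (snd p) \<omega>) * (LINT t|\<mu>. W t \<omega>))"
  proof (rule integral_cong_AE)
    show "AE \<omega> in Q. (Z \<omega> - E Z) ^ 3 = integral\<^sup>L (\<mu> \<Otimes>\<^sub>M \<mu>) (\<lambda>p. W (fst p) \<omega> * W (snd p) \<omega>) * (LINT t|\<mu>. W t \<omega>)"
      using AE_W by eventually_elim (simp add: integral_W_pair power2_eq_square power3_eq_cube)
  qed (use Z_measurable integral_W_measurable integral_W_pair_measurable in measurable)
  also have "\<dots> = integral\<^sup>L (\<mu> \<Otimes>\<^sub>M \<mu>) (\<lambda>p. LINT v|\<mu>. E (\<lambda>\<omega>. W (fst p) \<omega> * W (snd p) \<omega> * W v \<omega>))"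
    by (rule eq(1)) (auto intro: prems simp: space_pair_measure)
  also have "\<dots> = (LINT s|\<mu>. LINT t|\<mu>. LINT v|\<mu>. E (\<lambda>\<omega>. W s \<omega> * W t \<omega> * W v \<omega>))"
    using pair.integral_fst'[OF PP.integrable_fst'[OF int]] by simp
  also have "\<dots> = (LINT s|\<mu>. LINT t|\<mu>. LINT v|\<mu>. 8 * (r s t * (r t v * r v s)))"
    by (intro Bochner_Integration.integral_cong refl E_W3)
  finally have "of_real (E (\<lambda>\<omega>. (Z \<omega> - E Z) ^ 3)) = (LINT s|\<mu>. LINT t|\<mu>. LINT v|\<mu>. 8 * (h s t * (h t v * h v s)))"
    by (simp only: complex_integral_r) (intro Bochner_Integration.integral_cong refl, simp add: h_r)
  also have "\<dots> = 8 * ktrace \<mu> (kcomp \<mu> h (kcomp \<mu> h h))"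
    by (simp add: ktrace_def kcomp_def)
  also have "ktrace \<mu> (kcomp \<mu> h (kcomp \<mu> h h)) = ktrace \<mu> (kcomp \<mu> (kcomp \<mu> h h) h)"
    by (rule ktrace_kcomp_commute[OF w h_dom dom_kernel_kcomp[OF w h_dom h_dom]])
  also have "\<dots> = ktrace \<mu> (kcomp \<mu> (hartley \<sigma> (kcomp \<mu> c c)) h)"
    by (intro ktrace_kcomp_cong kcomp_hartley[OF c_dom c_dom] refl)
  also have "\<dots> = ktrace \<mu> (hartley \<sigma> (kcomp \<mu> (kcomp \<mu> c c) c))"
    by (rule ktrace_cong) (rule kcomp_hartley[OF dom_kernel_kcomp[OF w c_dom c_dom] c_dom])
  finally show ?thesis
    by (simp add: ktrace_hartley[OF dom_kernel_kcomp[OF w dom_kernel_kcomp[OF w c_dom c_dom] c_dom]])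
qed

text \<open>The fourth power is split into two squares, each an integral over the product measure.
  The disjoint short cycles produce the squared trace besides the trace of the fourth power.\<close>

theorem fourth_moment_Z:
  "of_real (E (\<lambda>\<omega>. (Z \<omega> - E Z) ^ 4)) =
    48 * ktrace \<mu> (kcomp \<mu> (kcomp \<mu> c c) (kcomp \<mu> c c)) + 12 * (ktrace \<mu> (kcomp \<mu> c c))\<^sup>2"
proof -
  interpret PP: pair_sigma_finite "\<mu> \<Otimes>\<^sub>M \<mu>" "\<mu> \<Otimes>\<^sub>M \<mu>"
    by (intro pair_sigma_finite.intro sigma_finite_\<mu>\<mu>)
  let ?U = "\<lambda>p \<omega>. W (fst p) \<omega> * W (snd p) \<omega>"
  note eq = expectation_product_of_integrals[OF sigma_finite_\<mu>\<mu> sigma_finite_\<mu>\<mu> Q.prob_space_axioms W_pair_measurable W_pair_measurable,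
      where p = "\<lambda>p. 2 ^ 4 * fact 8 * ((u (fst p))\<^sup>2 * (u (snd p))\<^sup>2)" and q = "\<lambda>p. (u (fst p))\<^sup>2 * (u (snd p))\<^sup>2"]
  note prems = u_pair_integrable W_bound4(1) order_trans[OF W_bound4(2)]
  have int: "integrable ((\<mu> \<Otimes>\<^sub>M \<mu>) \<Otimes>\<^sub>M (\<mu> \<Otimes>\<^sub>M \<mu>)) (\<lambda>(p, q). E (\<lambda>\<omega>. ?U p \<omega> * ?U q \<omega>))"
    by (rule eq(2)) (auto intro: prems simp: space_pair_measure)
  \<comment> \<open>Integrability is shown for every \<open>p\<close>, not merely almost every one,
    so that the inner integral can be unfolded pointwise.\<close>
  have inner: "integrable (\<mu> \<Otimes>\<^sub>M \<mu>) (\<lambda>q. E (\<lambda>\<omega>. ?U p \<omega> * ?U q \<omega>))" if p: "p \<in> space (\<mu> \<Otimes>\<^sub>M \<mu>)" for p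
  proof (rule Bochner_Integration.integrable_bound)
    let ?B = "\<lambda>q. 2 ^ 4 * fact 8 * ((u (fst p))\<^sup>2 * (u (snd p))\<^sup>2) * ((u (fst q))\<^sup>2 * (u (snd q))\<^sup>2)"
    show "integrable (\<mu> \<Otimes>\<^sub>M \<mu>) ?B"
      by (intro integrable_mult_right u_pair_integrable)
    show "(\<lambda>q. E (\<lambda>\<omega>. ?U p \<omega> * ?U q \<omega>)) \<in> borel_measurable (\<mu> \<Otimes>\<^sub>M \<mu>)"
      using measurable_Pair2[OF borel_measurable_integrable[OF int] p] by simp
    show "AE q in \<mu> \<Otimes>\<^sub>M \<mu>. norm (E (\<lambda>\<omega>. ?U p \<omega> * ?U q \<omega>)) \<le> norm (?B q)"
    proof (rule AE_I2)
      fix q assume q: "q \<in> space (\<mu> \<Otimes>\<^sub>M \<mu>)"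
      have "norm (E (\<lambda>\<omega>. ?U p \<omega> * ?U q \<omega>)) \<le> E (\<lambda>\<omega>. \<bar>?U p \<omega> * ?U q \<omega>\<bar>)"
        using integral_abs_bound by simp
      also have "\<dots> \<le> ?B q"
        using p q by (intro W_bound4(2)) (auto simp: space_pair_measure)
      also have "\<dots> \<le> norm (?B q)" by simp
      finally show "norm (E (\<lambda>\<omega>. ?U p \<omega> * ?U q \<omega>)) \<le> norm (?B q)" .
    qed
  qed
  let ?\<Phi> = "\<lambda>s t v x. E (\<lambda>\<omega>. (W s \<omega> * W t \<omega>) * (W v \<omega> * W x \<omega>))"
  have inner_eq: "integral\<^sup>L (\<mu> \<Otimes>\<^sub>M \<mu>) (\<lambda>q. E (\<lambda>\<omega>. ?U p \<omega> * ?U q \<omega>)) = (LINT v|\<mu>. LINT x|\<mu>. ?\<Phi> (fst p) (snd p) v x)"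
    if p: "p \<in> space (\<mu> \<Otimes>\<^sub>M \<mu>)" for p
    using pair.integral_fst'[OF inner[OF p]] by simp
  have "E (\<lambda>\<omega>. (Z \<omega> - E Z) ^ 4)
    = E (\<lambda>\<omega>. integral\<^sup>L (\<mu> \<Otimes>\<^sub>M \<mu>) (\<lambda>p. ?U p \<omega>) * integral\<^sup>L (\<mu> \<Otimes>\<^sub>M \<mu>) (\<lambda>q. ?U q \<omega>))"
  proof (rule integral_cong_AE)
    show "AE \<omega> in Q. (Z \<omega> - E Z) ^ 4 = integral\<^sup>L (\<mu> \<Otimes>\<^sub>M \<mu>) (\<lambda>p. ?U p \<omega>) * integral\<^sup>L (\<mu> \<Otimes>\<^sub>M \<mu>) (\<lambda>q. ?U q \<omega>)"
      using AE_W by eventually_elim (simp add: integral_W_pair power2_eq_square power4_eq_xxxx)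
  qed (use Z_measurable integral_W_pair_measurable in measurable)
  also have "\<dots> = integral\<^sup>L (\<mu> \<Otimes>\<^sub>M \<mu>) (\<lambda>p. integral\<^sup>L (\<mu> \<Otimes>\<^sub>M \<mu>) (\<lambda>q. E (\<lambda>\<omega>. ?U p \<omega> * ?U q \<omega>)))"
    by (rule eq(1)) (auto intro: prems simp: space_pair_measure)
  also have "\<dots> = (LINT s|\<mu>. LINT t|\<mu>. integral\<^sup>L (\<mu> \<Otimes>\<^sub>M \<mu>) (\<lambda>q. E (\<lambda>\<omega>. ?U (s, t) \<omega> * ?U q \<omega>)))"
    using pair.integral_fst'[OF PP.integrable_fst'[OF int]] by simp
  also have "\<dots> = (LINT s|\<mu>. LINT t|\<mu>. LINT v|\<mu>. LINT x|\<mu>. ?\<Phi> s t v x)"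
    by (intro Bochner_Integration.integral_cong refl) (subst inner_eq, auto simp: space_pair_measure)
  also have "\<dots> = (LINT s|\<mu>. LINT t|\<mu>. LINT v|\<mu>. LINT x|\<mu>.
    4 * ((r s t)\<^sup>2 * (r v x)\<^sup>2 + (r s v)\<^sup>2 * (r t x)\<^sup>2 + (r s x)\<^sup>2 * (r t v)\<^sup>2) +
    16 * (r s t * r t v * r v x * r x s + r s t * r t x * r x v * r v s + r s v * r v t * r t x * r x s))"
    by (intro Bochner_Integration.integral_cong refl E_W4)
  finally have "of_real (E (\<lambda>\<omega>. (Z \<omega> - E Z) ^ 4)) = (LINT s|\<mu>. LINT t|\<mu>. LINT v|\<mu>. LINT x|\<mu>.
    4 * ((h s t)\<^sup>2 * (h v x)\<^sup>2 + (h s v)\<^sup>2 * (h t x)\<^sup>2 + (h s x)\<^sup>2 * (h t v)\<^sup>2) +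
    16 * (h s t * h t v * h v x * h x s + h s t * h t x * h x v * h v s + h s v * h v t * h t x * h x s))"
    by (simp only: complex_integral_r) (intro Bochner_Integration.integral_cong refl, simp add: h_r)
  also have "\<dots> = 48 * ktrace \<mu> (kcomp \<mu> (kcomp \<mu> h h) (kcomp \<mu> h h)) + 12 * (ktrace \<mu> (kcomp \<mu> h h))\<^sup>2"
    by (rule cyclic_integral4[OF w h_dom]) (simp add: h_r r_symmetric)
  also have "ktrace \<mu> (kcomp \<mu> h h) = ktrace \<mu> (hartley \<sigma> (kcomp \<mu> c c))"
    by (rule ktrace_cong) (rule kcomp_hartley[OF c_dom c_dom])
  also have "ktrace \<mu> (kcomp \<mu> (kcomp \<mu> h h) (kcomp \<mu> h h)) = ktrace \<mu> (kcomp \<mu> (hartley \<sigma> (kcomp \<mu> c c)) (hartley \<sigma> (kcomp \<mu> c c)))"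
    by (intro ktrace_kcomp_cong kcomp_hartley[OF c_dom c_dom])
  also have "\<dots> = ktrace \<mu> (hartley \<sigma> (kcomp \<mu> (kcomp \<mu> c c) (kcomp \<mu> c c)))"
    by (rule ktrace_cong) (rule kcomp_hartley[OF dom_kernel_kcomp[OF w c_dom c_dom] dom_kernel_kcomp[OF w c_dom c_dom]])
  finally show ?thesis
    by (simp add: ktrace_hartley[OF dom_kernel_kcomp[OF w c_dom c_dom]]
        ktrace_hartley[OF dom_kernel_kcomp[OF w dom_kernel_kcomp[OF w c_dom c_dom] dom_kernel_kcomp[OF w c_dom c_dom]]])
qed

end

section \<open>The limit theorem\<close>

lemma (in product_sigma_finite) ktrace_kcomp_prod:
  assumes "finite S" and w: "\<And>i. i \<in> S \<Longrightarrow> weight (M i) (w i)"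
    and A: "\<And>i. i \<in> S \<Longrightarrow> dom_kernel (M i) (w i) (K i) (A i)"
    and B: "\<And>i. i \<in> S \<Longrightarrow> dom_kernel (M i) (w i) (K' i) (B i)"
  shows "ktrace (Pi\<^sub>M S M) (kcomp (Pi\<^sub>M S M) (prod_kernel S A) (prod_kernel S B)) = (\<Prod>i\<in>S. ktrace (M i) (kcomp (M i) (A i) (B i)))"
proof -
  have "ktrace (Pi\<^sub>M S M) (kcomp (Pi\<^sub>M S M) (prod_kernel S A) (prod_kernel S B))
    = ktrace (Pi\<^sub>M S M) (prod_kernel S (\<lambda>i. kcomp (M i) (A i) (B i)))"
    by (rule ktrace_cong) (rule kcomp_prod[OF assms(1) w A B])
  also have "\<dots> = (\<Prod>i\<in>S. ktrace (M i) (kcomp (M i) (A i) (B i)))"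
    by (rule ktrace_prod[OF assms(1) w sfm.dom_kernel_kcomp[OF sfm_component w A B]])
  finally show ?thesis .
qed

lemma cov_kernel_uminus:
  assumes "\<And>t. f (- t) = cnj (f t)"
  shows "cov_kernel f (- s) (- t) = cnj (cov_kernel f s t)"
proof -
  have "f (- s - - t) = cnj (f (s - t))" using assms[of "s - t"] by simp
  then show ?thesis using assms[of "- t"] by (simp add: cov_kernel_def assms)
qed

text \<open>The traces are complex by type; the moment formulas exhibit them as embedded reals and
  bring the limits back.\<close>

lemma tendsto_of_realD:
  assumes "(\<lambda>n. complex_of_real (F n)) \<longlonglongrightarrow> z" "complex_of_real x = z"
  shows "F \<longlonglongrightarrow> x"
  using assms tendsto_of_real_iff by blast

theorem corollary4p13:
  fixes M :: "'w measure"
    and Q :: "'v measure"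
    and n :: nat
    and d :: "nat \<Rightarrow> nat"
    and \<rho> :: "nat \<Rightarrow> (nat \<Rightarrow> real) measure"
    and X :: "nat \<Rightarrow> 'w \<Rightarrow> nat \<Rightarrow> real"
    and Xs :: "nat \<Rightarrow> nat \<Rightarrow> 'w \<Rightarrow> nat \<Rightarrow> real"
    and S :: "nat set"
    and G :: "(nat \<Rightarrow> nat \<Rightarrow> real) \<Rightarrow> 'v \<Rightarrow> complex"
  assumes "prob_space M"
    and "\<And>i. i \<in> {1..n} \<Longrightarrow> admissible_measure (d i) (\<rho> i)"
    and "\<And>i. i \<in> {1..n} \<Longrightarrow> X i \<in> measurable M (euclid_borel (d i))"
    and "\<And>i. i \<in> {1..n} \<Longrightarrow> (\<integral>\<^sup>+ \<omega>. ennreal (psi (d i) (\<rho> i) (X i \<omega>)) \<partial>M) < \<infinity>"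
    and "prob_space.indep_vars M (\<lambda>_. Pi\<^sub>M {1..n} (\<lambda>i. euclid_borel (d i)))
           (\<lambda>l \<omega>. \<lambda>i\<in>{1..n}. Xs l i \<omega>) UNIV"
    and "\<And>l. distr M (Pi\<^sub>M {1..n} (\<lambda>i. euclid_borel (d i))) (\<lambda>\<omega>. \<lambda>i\<in>{1..n}. Xs l i \<omega>) =
             distr M (Pi\<^sub>M {1..n} (\<lambda>i. euclid_borel (d i))) (\<lambda>\<omega>. \<lambda>i\<in>{1..n}. X i \<omega>)"
    and "S \<subseteq> {1..n}" and "card S \<ge> 2"
    and "prob_space Q"
    and "limit_field Q S \<rho> (\<lambda>i. char_fun M (d i) (X i)) G"
  shows "let Z = (\<lambda>\<omega>. norm_sq S \<rho> (\<lambda>t. G t \<omega>));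
             EZ = prob_space.expectation Q Z
         in AE \<omega> in M. let x = (\<lambda>l i. Xs l i \<omega>) in
           (\<lambda>N. mu_prod mu1 S d \<rho> x N) \<longlonglongrightarrow> EZ \<and>
           (\<lambda>N. 2 * mu_prod mu2 S d \<rho> x N) \<longlonglongrightarrow> prob_space.variance Q Z \<and>
           (\<lambda>N. 8 * mu_prod mu3 S d \<rho> x N)
             \<longlonglongrightarrow> prob_space.expectation Q (\<lambda>\<omega>'. (Z \<omega>' - EZ) ^ 3) \<and>
           (\<lambda>N. 48 * mu_prod mu4 S d \<rho> x N + 12 * (mu_prod mu2 S d \<rho> x N) ^ 2)
             \<longlonglongrightarrow> prob_space.expectation Q (\<lambda>\<omega>'. (Z \<omega>' - EZ) ^ 4)"
proof -
  interpret M: prob_space M by fact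
  interpret Q: prob_space Q by fact
  have S: "finite S" using assms(7) finite_subset by blast
  let ?P = "Pi\<^sub>M {1..n} (\<lambda>i. euclid_borel (d i))"

  have comp: "component M (d i) (\<rho> i) (X i) (\<lambda>l. Xs l i)" if i: "i \<in> S" for i
  proof -
    have i': "i \<in> {1..n}" using i assms(7) by auto
    have proj: "(\<lambda>x. x i) \<in> measurable ?P (euclid_borel (d i))"
      using measurable_component_singleton[OF i', of "\<lambda>i. euclid_borel (d i)"] .
    have Xs: "(\<lambda>\<omega>. \<lambda>i\<in>{1..n}. Xs l i \<omega>) \<in> measurable M ?P" for l
      using assms(5) by (auto simp: M.indep_vars_def)
    have X: "(\<lambda>\<omega>. \<lambda>i\<in>{1..n}. X i \<omega>) \<in> measurable M ?P"
      by (intro measurable_restrict assms(3))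
    \<comment> \<open>The samples are given as restricted tuples with joint laws; projecting to
      coordinate \<open>i\<close> identifies the marginal laws needed for one component.\<close>
    have marginal: "distr M (euclid_borel (d i)) (Y i) = distr (distr M ?P (\<lambda>\<omega>. \<lambda>i\<in>{1..n}. Y i \<omega>)) (euclid_borel (d i)) (\<lambda>x. x i)"
      if "(\<lambda>\<omega>. \<lambda>i\<in>{1..n}. Y i \<omega>) \<in> measurable M ?P" for Y :: "nat \<Rightarrow> 'w \<Rightarrow> nat \<Rightarrow> real"
      using i' by (subst distr_distr[OF proj that]) (simp add: comp_def)
    have "M.indep_vars (\<lambda>_. euclid_borel (d i)) (\<lambda>l \<omega>. (\<lambda>i\<in>{1..n}. Xs l i \<omega>) i) UNIV"
      by (rule M.indep_vars_compose2[OF assms(5), where Y = "\<lambda>_ x. x i"]) (rule proj)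
    then have "M.indep_vars (\<lambda>_. euclid_borel (d i)) (\<lambda>l. Xs l i) UNIV"
      using i' by simp
    moreover have "distr M (euclid_borel (d i)) (Xs l i) = distr M (euclid_borel (d i)) (X i)" for l
      unfolding marginal[OF Xs] marginal[OF X] assms(6) ..
    ultimately show ?thesis
      using assms(2-4)[OF i']
      by (intro component.intro component_axioms.intro levy_measure.intro M.prob_space_axioms) auto
  qed

  define f where "f i = char_fun M (d i) (X i)" for i
  define w where "w i = component.w M (d i) (X i)" for i
  let ?C = "\<lambda>i. cov_kernel (f i)"
  have f: "f i = component.f M (d i) (X i)" if "i \<in> S" for i
    by (simp add: f_def component.f_def[OF comp[OF that]])
  have levy: "levy_measure (d i) (\<rho> i)" if "i \<in> S" for i
    using comp[OF that] by (simp add: component_def)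
  have weight: "weight (\<rho> i) (w i)" if "i \<in> S" for i
    unfolding w_def by (rule component.weight_w[OF comp[OF that]])
  have dom: "dom_kernel (\<rho> i) (w i) 1 (?C i)" if "i \<in> S" for i
    unfolding w_def f[OF that] by (rule component.dom_kernel_f[OF comp[OF that]])
  have w_uminus: "w i (- t) = w i t" if "i \<in> S" for i t
    unfolding w_def by (rule component.w_uminus[OF comp[OF that]])
  have f_uminus: "f i (- t) = cnj (f i t)" if "i \<in> S" for i t
    unfolding f[OF that] by (rule component.f_uminus[OF comp[OF that]])

  \<comment> \<open>\<open>product_sigma_finite\<close> asks for sigma-finiteness at every index,
    including those outside \<open>S\<close>; there the trivial measure on the empty space is
    inserted, which leaves the product over \<open>S\<close> unchanged.\<close>
  define \<rho>' where "\<rho>' i = (if i \<in> S then \<rho> i else count_space {})" for i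
  have \<rho>': "\<rho>' i = \<rho> i" if "i \<in> S" for i using that by (simp add: \<rho>'_def)
  interpret P: product_sigma_finite \<rho>'
  proof (rule product_sigma_finite.intro)
    show "sigma_finite_measure (\<rho>' i)" for i
      using levy_measure.sigma_finite_\<rho>[OF levy] by (auto simp: \<rho>'_def intro: sigma_finite_measure_count_space_finite)
  qed
  define \<mu> where "\<mu> = Pi\<^sub>M S \<rho>"
  have \<mu>: "\<mu> = Pi\<^sub>M S \<rho>'" unfolding \<mu>_def by (intro PiM_cong refl) (simp add: \<rho>')
  \<comment> \<open>Negation is restricted to \<open>S\<close> so that the result is again an
    extensional function, a point of the product space.\<close>
  define \<sigma> where "\<sigma> t = (\<lambda>i\<in>S. - t i)" for t :: "nat \<Rightarrow> nat \<Rightarrow> real"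
  define W where "W t = (\<Prod>i\<in>S. w i (t i))" for t
  define c where "c = prod_kernel S ?C"

  have \<sigma>: "\<sigma> \<in> measurable \<mu> \<mu>"
    unfolding \<sigma>_def[abs_def] \<mu>_def
  proof (rule measurable_restrict)
    fix i assume i: "i \<in> S"
    show "(\<lambda>t. - t i) \<in> measurable (Pi\<^sub>M S \<rho>) (\<rho> i)"
      by (rule measurable_compose[OF measurable_component_singleton[OF i, of \<rho>] levy_measure.uminus_measurable[OF levy[OF i]]])
  qed
  have space: "t i \<in> space (\<rho> i)" if "t \<in> space \<mu>" "i \<in> S" for t i
    using that by (auto simp: \<mu>_def space_PiM)
  \<comment> \<open>Product measures are determined by boxes, and on boxes the invariance reduces to
    that of each factor.\<close>
  have distr: "distr \<mu> \<mu> \<sigma> = \<mu>"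
    unfolding \<mu>
  proof (rule P.PiM_eqI[OF S])
    fix A assume A: "\<And>i. i \<in> S \<Longrightarrow> A i \<in> sets (\<rho>' i)"
    let ?A' = "\<lambda>i. uminus -` A i \<inter> space (\<rho>' i)"
    have A': "?A' i \<in> sets (\<rho>' i)" if "i \<in> S" for i
      using measurable_sets[OF levy_measure.uminus_measurable[OF levy[OF that]]] A[OF that] by (simp add: \<rho>'[OF that])
    have "\<sigma> -` Pi\<^sub>E S A \<inter> space (Pi\<^sub>M S \<rho>') = Pi\<^sub>E S ?A'"
      by (auto simp: \<sigma>_def space_PiM PiE_iff)
    then have "emeasure (distr (Pi\<^sub>M S \<rho>') (Pi\<^sub>M S \<rho>') \<sigma>) (Pi\<^sub>E S A) = emeasure (Pi\<^sub>M S \<rho>') (Pi\<^sub>E S ?A')"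
      using \<sigma> A S by (subst emeasure_distr) (auto simp: \<mu> intro: sets_PiM_I_finite)
    also have "\<dots> = (\<Prod>i\<in>S. emeasure (\<rho>' i) (?A' i))"
      by (rule P.emeasure_PiM[OF S A'])
    also have "\<dots> = (\<Prod>i\<in>S. emeasure (\<rho>' i) (A i))"
    proof (intro prod.cong refl)
      fix i assume i: "i \<in> S"
      have "emeasure (\<rho> i) (A i) = emeasure (distr (\<rho> i) (\<rho> i) uminus) (A i)"
        by (simp add: levy_measure.distr_uminus[OF levy[OF i]])
      also have "\<dots> = emeasure (\<rho> i) (uminus -` A i \<inter> space (\<rho> i))"
        using A[OF i] by (intro emeasure_distr levy_measure.uminus_measurable[OF levy[OF i]]) (simp add: \<rho>'[OF i])
      finally show "emeasure (\<rho>' i) (?A' i) = emeasure (\<rho>' i) (A i)" by (simp add: \<rho>'[OF i])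
    qed
    finally show "emeasure (distr (Pi\<^sub>M S \<rho>') (Pi\<^sub>M S \<rho>') \<sigma>) (Pi\<^sub>E S A) = (\<Prod>i\<in>S. emeasure (\<rho>' i) (A i))" .
  qed simp

  have weight_W: "weight \<mu> W"
    using P.weight_prod[OF S, of w] weight by (simp add: \<mu> W_def[abs_def] \<rho>')
  have dom_c: "dom_kernel \<mu> W 1 c"
    using P.dom_kernel_prod[OF S, of w "\<lambda>_. 1" ?C] weight dom by (simp add: \<mu> W_def[abs_def] c_def \<rho>')

  interpret F: gaussian_field \<mu> \<sigma> W Q G c 1
  proof (intro gaussian_field.intro symmetric_sfm.intro symmetric_sfm_axioms.intro gaussian_field_axioms.intro)
    show "sfm \<mu>"
      unfolding sfm_def \<mu> by (rule P.sigma_finite[OF S])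
    show "\<sigma> (\<sigma> t) = t" if "t \<in> space \<mu>" for t
      using that by (auto simp: \<sigma>_def \<mu>_def space_PiM fun_eq_iff PiE_iff extensional_def)
    show "W (\<sigma> t) = W t" for t
      unfolding W_def by (intro prod.cong refl) (simp add: \<sigma>_def w_uminus)
    note G = assms(10)[unfolded limit_field_def]
    show "(\<lambda>(t, \<omega>). G t \<omega>) \<in> borel_measurable (\<mu> \<Otimes>\<^sub>M Q)" "complex_gaussian_field Q (space \<mu>) G"
      using G by (auto simp: \<mu>_def)
    show "(LINT \<omega>|Q. G t \<omega>) = 0" if "t \<in> space \<mu>" for t
      using G that by (auto simp: \<mu>_def)
    show "(LINT \<omega>|Q. G s \<omega> * cnj (G t \<omega>)) = c s t" if "s \<in> space \<mu>" "t \<in> space \<mu>" for s t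
      using G that by (simp add: \<mu>_def c_def prod_kernel_def cov_kernel_def f_def)
    \<comment> \<open>Replacing \<open>t\<close> by its reflection turns the factors of the
      covariance, with \<open>s - t\<close> and \<open>- t\<close>, into those of the
      pseudo-covariance, with \<open>s + t\<close> and \<open>t\<close>.\<close>
    show "(LINT \<omega>|Q. G s \<omega> * G t \<omega>) = c s (\<sigma> t)" if "s \<in> space \<mu>" "t \<in> space \<mu>" for s t
      using G that by (simp add: \<mu>_def c_def prod_kernel_def cov_kernel_def f_def \<sigma>_def)
    show "c (\<sigma> s) (\<sigma> t) = cnj (c s t)" for s t
      unfolding c_def prod_kernel_def cnj_prod
      by (intro prod.cong refl) (simp add: \<sigma>_def cov_kernel_uminus f_uminus)
  qed (fact weight_W distr \<sigma> dom_c assms(9))+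

  have Z: "F.Z = (\<lambda>\<omega>. norm_sq S \<rho> (\<lambda>t. G t \<omega>))"
    unfolding fun_eq_iff F.Z_def norm_sq_def by (simp add: \<mu>_def)

  let ?C2 = "\<lambda>i. kcomp (\<rho> i) (?C i) (?C i)"
  \<comment> \<open>The constant that \<open>dom_kernel_kcomp\<close> delivers for two factors of
    constant 1, kept unsimplified to match that rule.\<close>
  let ?b = "\<lambda>i. 1 * 1 * (LINT u|\<rho> i. (w i u)\<^sup>2)"
  have sfm: "sfm (\<rho> i)" if "i \<in> S" for i
    using levy_measure.sigma_finite_\<rho>[OF levy[OF that]] by (simp add: sfm_def)
  have dom2: "dom_kernel (\<rho> i) (w i) (?b i) (?C2 i)" if "i \<in> S" for i
    by (rule sfm.dom_kernel_kcomp[OF sfm[OF that] weight[OF that] dom[OF that] dom[OF that]])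
  have c2: "kcomp \<mu> c c s t = prod_kernel S ?C2 s t" if "s \<in> space \<mu>" "t \<in> space \<mu>" for s t
    using P.kcomp_prod[OF S, of w "\<lambda>_. 1" ?C "\<lambda>_. 1" ?C s t] weight dom that
    by (simp add: \<mu> c_def \<rho>' prod_kernel_def cong: prod.cong)
  have t1: "ktrace \<mu> c = (\<Prod>i\<in>S. ktrace (\<rho> i) (?C i))"
    using P.ktrace_prod[OF S, of w "\<lambda>_. 1" ?C] weight dom by (simp add: \<mu> c_def \<rho>')
  have t2: "ktrace \<mu> (kcomp \<mu> c c) = (\<Prod>i\<in>S. ktrace (\<rho> i) (?C2 i))"
    using P.ktrace_kcomp_prod[OF S, of w "\<lambda>_. 1" ?C "\<lambda>_. 1" ?C] weight dom by (simp add: \<mu> c_def \<rho>')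
  have t3: "ktrace \<mu> (kcomp \<mu> (kcomp \<mu> c c) c) = (\<Prod>i\<in>S. ktrace (\<rho> i) (kcomp (\<rho> i) (?C2 i) (?C i)))"
  proof -
    have "ktrace \<mu> (kcomp \<mu> (kcomp \<mu> c c) c) = ktrace \<mu> (kcomp \<mu> (prod_kernel S ?C2) c)"
      by (intro ktrace_kcomp_cong c2 refl)
    then show ?thesis
      using P.ktrace_kcomp_prod[OF S, of w ?b ?C2 "\<lambda>_. 1" ?C] weight dom dom2 by (simp add: \<mu> c_def \<rho>')
  qed
  have t4: "ktrace \<mu> (kcomp \<mu> (kcomp \<mu> c c) (kcomp \<mu> c c)) = (\<Prod>i\<in>S. ktrace (\<rho> i) (kcomp (\<rho> i) (?C2 i) (?C2 i)))"
  proof -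
    have "ktrace \<mu> (kcomp \<mu> (kcomp \<mu> c c) (kcomp \<mu> c c)) = ktrace \<mu> (kcomp \<mu> (prod_kernel S ?C2) (prod_kernel S ?C2))"
      by (intro ktrace_kcomp_cong c2)
    then show ?thesis
      using P.ktrace_kcomp_prod[OF S, of w ?b ?C2 ?b ?C2] weight dom2 by (simp add: \<mu> \<rho>')
  qed

  \<comment> \<open>The finitely many exceptional sets, one for each component in \<open>S\<close>,
    are merged; no joint law of the components enters.\<close>
  have "AE \<omega> in M. \<forall>i\<in>S.
    (\<lambda>N. complex_of_real (mu1 N (dist_mat N (d i) (\<rho> i) (\<lambda>l. Xs l i \<omega>)))) \<longlonglongrightarrow> ktrace (\<rho> i) (?C i) \<and>
    (\<lambda>N. complex_of_real (mu2 N (dist_mat N (d i) (\<rho> i) (\<lambda>l. Xs l i \<omega>)))) \<longlonglongrightarrow> ktrace (\<rho> i) (?C2 i) \<and>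
    (\<lambda>N. complex_of_real (mu3 N (dist_mat N (d i) (\<rho> i) (\<lambda>l. Xs l i \<omega>)))) \<longlonglongrightarrow> ktrace (\<rho> i) (kcomp (\<rho> i) (?C2 i) (?C i)) \<and>
    (\<lambda>N. complex_of_real (mu4 N (dist_mat N (d i) (\<rho> i) (\<lambda>l. Xs l i \<omega>)))) \<longlonglongrightarrow> ktrace (\<rho> i) (kcomp (\<rho> i) (?C2 i) (?C2 i))"
    using component.AE_estimators_tendsto[OF comp] by (intro AE_finite_allI[OF S]) (simp add: f)
  then have "AE \<omega> in M.
    (\<lambda>N. mu_prod mu1 S d \<rho> (\<lambda>l i. Xs l i \<omega>) N) \<longlonglongrightarrow> F.E F.Z \<and>
    (\<lambda>N. 2 * mu_prod mu2 S d \<rho> (\<lambda>l i. Xs l i \<omega>) N) \<longlonglongrightarrow> F.E (\<lambda>\<omega>. (F.Z \<omega> - F.E F.Z)\<^sup>2) \<and>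
    (\<lambda>N. 8 * mu_prod mu3 S d \<rho> (\<lambda>l i. Xs l i \<omega>) N) \<longlonglongrightarrow> F.E (\<lambda>\<omega>. (F.Z \<omega> - F.E F.Z) ^ 3) \<and>
    (\<lambda>N. 48 * mu_prod mu4 S d \<rho> (\<lambda>l i. Xs l i \<omega>) N + 12 * (mu_prod mu2 S d \<rho> (\<lambda>l i. Xs l i \<omega>) N) ^ 2)
      \<longlonglongrightarrow> F.E (\<lambda>\<omega>. (F.Z \<omega> - F.E F.Z) ^ 4)"
  proof eventually_elim
    case (elim \<omega>)
    let ?m = "\<lambda>mu N. mu_prod mu S d \<rho> (\<lambda>l i. Xs l i \<omega>) N"
    have l1: "(\<lambda>N. complex_of_real (?m mu1 N)) \<longlonglongrightarrow> ktrace \<mu> c"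
      unfolding mu_prod_def of_real_prod t1 by (intro tendsto_prod) (use elim in blast)
    have l2: "(\<lambda>N. complex_of_real (?m mu2 N)) \<longlonglongrightarrow> ktrace \<mu> (kcomp \<mu> c c)"
      unfolding mu_prod_def of_real_prod t2 by (intro tendsto_prod) (use elim in blast)
    have l3: "(\<lambda>N. complex_of_real (?m mu3 N)) \<longlonglongrightarrow> ktrace \<mu> (kcomp \<mu> (kcomp \<mu> c c) c)"
      unfolding mu_prod_def of_real_prod t3 by (intro tendsto_prod) (use elim in blast)
    have l4: "(\<lambda>N. complex_of_real (?m mu4 N)) \<longlonglongrightarrow> ktrace \<mu> (kcomp \<mu> (kcomp \<mu> c c) (kcomp \<mu> c c))"
      unfolding mu_prod_def of_real_prod t4 by (intro tendsto_prod) (use elim in blast)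
    have "(\<lambda>N. complex_of_real (2 * ?m mu2 N)) \<longlonglongrightarrow> 2 * ktrace \<mu> (kcomp \<mu> c c)"
      "(\<lambda>N. complex_of_real (8 * ?m mu3 N)) \<longlonglongrightarrow> 8 * ktrace \<mu> (kcomp \<mu> (kcomp \<mu> c c) c)"
      "(\<lambda>N. complex_of_real (48 * ?m mu4 N + 12 * (?m mu2 N)\<^sup>2))
        \<longlonglongrightarrow> 48 * ktrace \<mu> (kcomp \<mu> (kcomp \<mu> c c) (kcomp \<mu> c c)) + 12 * (ktrace \<mu> (kcomp \<mu> c c))\<^sup>2"
      unfolding of_real_add of_real_mult of_real_power of_real_numeral by (intro tendsto_intros l2 l3 l4)+
    then show ?case
      by (intro conjI tendsto_of_realD[OF l1 F.expectation_Z]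
          tendsto_of_realD[OF _ F.second_moment_Z] tendsto_of_realD[OF _ F.third_moment_Z] tendsto_of_realD[OF _ F.fourth_moment_Z])
  qed
  then show ?thesis by (simp only: Let_def Z)
qed

end
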